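(* Let $\theta:\mathbb{R}^m\to(-\infty,\infty]$ be convex piecewise linear, let $\varphi_0:\mathbb{R}^n\times\mathbb{R}^d\to\mathbb{R}$ be $\mathcal{C}^2$-smooth, and let $\Phi:\mathbb{R}^n\times\mathbb{R}^d\to\mathbb{R}^m$ be $\mathcal{C}^2$-smooth around $(\bar x,\bar w)$, where $\bar w\in\mathbb{R}^d$ and $\bar x\in\mathbb{R}^n$ satisfies $\bar z:=\Phi(\bar x,\bar w)\in\operatorname{dom}\theta$. Let $\bar v\in\nabla_x\varphi_0(\bar x,\bar w)+\nabla_x\Phi(\bar x,\bar w)^*\partial\theta(\bar z)$, and let $\bar\lambda\in\partial\theta(\bar z)$ satisfy $\bar v=\nabla_x\varphi_0(\bar x,\bar w)+\nabla_x\Phi(\bar x,\bar w)^*\bar\lambda$, i.e. $(\bar x,\bar\lambda)\in S_{KKT}(\bar w,\bar v)$. Consider the following statements: (i) The KKT solution map $S_{KKT}$ has the SVLL property at $(\bar x,\bar\lambda,\bar w,\bar v)$, and $\bar x\in M_\gamma(\bar w,\bar v)$ for some $\gamma>0$. (ii) Both the composite SSOSC at $(\bar x,\bar w,\bar v,\bar\lambda)$ and the nondegeneracy condition ND at $(\bar x,\bar w)$ hold. Then (ii) implies (i). Conversely, (i) implies (ii) if in addition the first-order qualification condition $\partial^\infty\theta(\bar z)\cap\ker\nabla_x\Phi(\bar x,\bar w)^*=\{0\}$ is satisfied.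
   Context: **Convex piecewise linear (CPWL) functions.** $\theta:\mathbb{R}^m\to(-\infty,\infty]$ is CPWL if there are $l,p\in\mathbb{N}$, $a_i\in\mathbb{R}^m$, $\alpha_i\in\mathbb{R}$ ($i\in T_1:=\{1,\dots,l\}$), $d_i\in\mathbb{R}^m$, $\beta_i\in\mathbb{R}$ ($i\in T_2:=\{1,\dots,p\}$) such that $\operatorname{dom}\theta=\{z:\langle d_i,z\rangle\le\beta_i,\ i\in T_2\}\neq\emptyset$, $\theta(z)=\max_{i\in T_1}\{\langle a_i,z\rangle-\alpha_i\}$ for $z\in\operatorname{dom}\theta$, and $\theta(z)=\infty$ otherwise. Such a representation is fixed. For $\bar z\in\operatorname{dom}\theta$ let $K=K(\bar z):=\{i\in T_1:\langle a_i,\bar z\rangle-\alpha_i=\max_{j\in T_1}(\langle a_j,\bar z\rangle-\alpha_j)\}$ and $I=I(\bar z):=\{i\in T_2:\langle d_i,\bar z\rangle=\beta_i\}$. The subdifferential of convex analysis is $\partial\theta(\bar z)=\operatorname{conv}\{a_i:i\in K\}+\operatorname{cone}\{d_i:i\in I\}$, and the singular subdifferential is $\partial^\infty\theta(\bar z)=\{v:(v,0)\in N((\bar z,\theta(\bar z));\operatorname{epi}\theta)\}=N(\bar z;\operatorname{dom}\theta)$. **Standing assumption.** $0\in\operatorname{aff}\partial\theta(\bar z)$. **Problem.** For parameters $(w,v)\in\mathbb{R}^d\times\mathbb{R}^n$, $\mathcal{P}(w,v)$ is: minimize $\varphi_0(x,w)+\theta(\Phi(x,w))-\langle v,x\rangle$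 over $x\in\mathbb{R}^n$. For $\gamma>0$, $M_\gamma(w,v):=\operatorname{argmin}_{\|x-\bar x\|\le\gamma}\{\varphi_0(x,w)+\theta(\Phi(x,w))-\langle v,x\rangle\}$, with $\operatorname{argmin}:=\emptyset$ when the minimized expression is identically $\infty$. **KKT system.** With the Lagrangian $L(x,w,\lambda):=\varphi_0(x,w)+\langle\lambda,\Phi(x,w)\rangle$, let $S_{KKT}(w,v):=\{(x,\lambda)\in\mathbb{R}^n\times\mathbb{R}^m:\ v=\nabla_xL(x,w,\lambda),\ \lambda\in\partial\theta(\Phi(x,w))\}$. **SVLL (single-valued Lipschitzian localization) property** at $(\bar x,\bar\lambda,\bar w,\bar v)$: $S_{KKT}$ admits a Lipschitzian single-valued graphical localization around $(\bar w,\bar v,\bar x,\bar\lambda)$, i.e. there are neighborhoods $U$ of $(\bar w,\bar v)$ and $V$ of $(\bar x,\bar\lambda)$ and a Lipschitz continuous mapping $g:U\to V$ with $\operatorname{gph}S_{KKT}\cap(U\times V)=\operatorname{gph}g$. **Nondegeneracy condition ND** at $(\bar x,\bar w)$: $S(\bar z)\cap\ker\nabla_x\Phi(\bar x,\bar w)^*=\{0\}$ (equivalently $\nabla_x\Phi(\bar x,\bar w)\mathbb{R}^n+S(\bar z)^\perp=\mathbb{R}^m$), where $\bar z=\Phi(\bar x,\bar w)$ and $S(\bar z)$ is the linear subspace of $\mathbb{R}^m$ parallel to $\operatorname{aff}\partial\theta(\bar z)$. **Composite SSOSC** at $(\bar x,\bar w,\bar v,\bar\lambda)$. Write $\bar\lambda=\sum_{i\in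 K}\bar\lambda_ia_i+\sum_{i\in I}\bar\mu_id_i$ with $\bar\lambda_i\ge0$, $\sum_{i\in K}\bar\lambda_i=1$, $\bar\mu_i\ge0$, and put $J_1:=\{i\in K:\bar\lambda_i>0\}$, $J_2:=\{i\in I:\bar\mu_i>0\}$. Let $\mathcal{G}$ be the set of $u\in\mathbb{R}^m$ with $\langle a_i-a_j,u\rangle=0$ for $i,j\in J_1$; $\langle a_i-a_j,u\rangle\le0$ for $(i,j)\in(K\setminus J_1)\times J_1$; $\langle d_i,u\rangle=0$ for $i\in J_2$; $\langle d_i,u\rangle\le0$ for $i\in I\setminus J_2$. Let $\Gamma(J_1):=\{i\in K:\langle a_i-a_j,u\rangle=0\text{ for all }j\in J_1,\ u\in\mathcal{G}\}$ and $\Gamma(J_2):=\{t\in I:\langle d_t,u\rangle=0\text{ for all }u\in\mathcal{G}\}$ (these sets do not depend on the chosen representation of $\bar\lambda$). Let $\mathcal{S}:=\{u\in\mathbb{R}^n:\langle a_i-a_j,\nabla_x\Phi(\bar x,\bar w)u\rangle=0\text{ for }i,j\in\Gamma(J_1),\ \langle d_t,\nabla_x\Phi(\bar x,\bar w)u\rangle=0\text{ for }t\in\Gamma(J_2)\}$. The composite SSOSC means $\langle u,\nabla^2_{xx}L(\bar x,\bar w,\bar\lambda)u\rangle>0$ for all $0\ne u\in\mathcal{S}$. *)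

theory Defs
  imports "HOL-Analysis.Analysis"
begin

section \<open>Convex analysis\<close>

definition edom :: "('a \<Rightarrow> ereal) \<Rightarrow> 'a set" where
  "edom \<theta> = {z. \<theta> z < \<infinity>}"

definition epi :: "('a \<Rightarrow> ereal) \<Rightarrow> ('a \<times> real) set" where
  "epi \<theta> = {(z, r). \<theta> z \<le> ereal r}"

definition normal_cone :: "'a::real_inner \<Rightarrow> 'a set \<Rightarrow> 'a set" where
  "normal_cone x C = (if x \<in> C then {v. \<forall>y\<in>C. v \<bullet> (y - x) \<le> 0} else {})"

definition subdifferential :: "('a::real_inner \<Rightarrow> ereal) \<Rightarrow> 'a \<Rightarrow> 'a set" where
  "subdifferential \<theta> x =
     (if x \<in> edom \<theta> then {v. \<forall>y. \<theta> x + ereal (v \<bullet> (y - x)) \<le> \<theta> y} else {})"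

definition singular_subdifferential :: "('a::real_inner \<Rightarrow> ereal) \<Rightarrow> 'a \<Rightarrow> 'a set" where
  "singular_subdifferential \<theta> x =
     (if x \<in> edom \<theta> then {v. (v, 0) \<in> normal_cone (x, real_of_ereal (\<theta> x)) (epi \<theta>)} else {})"

definition parallel_subspace :: "'a::real_vector set \<Rightarrow> 'a set" where
  "parallel_subspace A = (THE S. subspace S \<and> affine_parallel A S)"

definition argmin_over :: "'a set \<Rightarrow> ('a \<Rightarrow> ereal) \<Rightarrow> 'a set" where
  "argmin_over A f =
     (if \<forall>x\<in>A. f x = \<infinity> then {} else {x \<in> A. \<forall>y\<in>A. f x \<le> f y})"

section \<open>Convex piecewise linear functions\<close>

text \<open>The function \<open>\<theta>\<close> is convex piecewise linear when such data exist. The index sets are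
  \<open>{1..l}\<close> (nonempty, so that the maximum makes sense) and \<open>{1..p}\<close>; for \<open>p = 0\<close> the domain is
  the whole space. The values of \<open>a\<close>, \<open>\<alpha>\<close>, \<open>d\<close>, \<open>\<beta>\<close> at other indices are irrelevant.\<close>

definition cpwl_rep ::
  "('a::real_inner \<Rightarrow> ereal) \<Rightarrow> nat \<Rightarrow> (nat \<Rightarrow> 'a) \<Rightarrow> (nat \<Rightarrow> real)
     \<Rightarrow> nat \<Rightarrow> (nat \<Rightarrow> 'a) \<Rightarrow> (nat \<Rightarrow> real) \<Rightarrow> bool" where
  "cpwl_rep \<theta> l a \<alpha> p d \<beta> \<longleftrightarrow>
     1 \<le> l \<and>
     edom \<theta> = {z. \<forall>i\<in>{1..p}. d i \<bullet> z \<le> \<beta> i} \<and>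
     edom \<theta> \<noteq> {} \<and>
     (\<forall>z. \<theta> z = (if z \<in> edom \<theta> then ereal (MAX i\<in>{1..l}. a i \<bullet> z - \<alpha> i) else \<infinity>))"

definition active_K :: "nat \<Rightarrow> (nat \<Rightarrow> 'a::real_inner) \<Rightarrow> (nat \<Rightarrow> real) \<Rightarrow> 'a \<Rightarrow> nat set" where
  "active_K l a \<alpha> z = {i\<in>{1..l}. a i \<bullet> z - \<alpha> i = (MAX j\<in>{1..l}. a j \<bullet> z - \<alpha> j)}"

definition active_I :: "nat \<Rightarrow> (nat \<Rightarrow> 'a::real_inner) \<Rightarrow> (nat \<Rightarrow> real) \<Rightarrow> 'a \<Rightarrow> nat set" where
  "active_I p d \<beta> z = {i\<in>{1..p}. d i \<bullet> z = \<beta> i}"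

section \<open>Smoothness and derivatives\<close>

definition C2_on :: "('a::real_normed_vector \<Rightarrow> 'b::real_normed_vector) \<Rightarrow> 'a set \<Rightarrow> bool" where
  "C2_on f A \<longleftrightarrow>
     (\<exists>(f' :: 'a \<Rightarrow> 'a \<Rightarrow>\<^sub>L 'b) (f'' :: 'a \<Rightarrow> 'a \<Rightarrow>\<^sub>L 'a \<Rightarrow>\<^sub>L 'b).
        (\<forall>x\<in>A. (f has_derivative blinfun_apply (f' x)) (at x)) \<and>
        (\<forall>x\<in>A. (f' has_derivative blinfun_apply (f'' x)) (at x)) \<and>
        continuous_on A f'')"

definition C2_around :: "('a::real_normed_vector \<Rightarrow> 'b::real_normed_vector) \<Rightarrow> 'a \<Rightarrow> bool" where
  "C2_around f x \<longleftrightarrow> (\<exists>A. open A \<and> x \<in> A \<and> C2_on f A)"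

definition gradient :: "('a::real_inner \<Rightarrow> real) \<Rightarrow> 'a \<Rightarrow> 'a" where
  "gradient f x = (THE D. GDERIV f x :> D)"

text \<open>The quadratic form of the Hessian, i.e. of the derivative of the gradient.\<close>

definition hess_form :: "('a::real_inner \<Rightarrow> real) \<Rightarrow> 'a \<Rightarrow> 'a \<Rightarrow> real" where
  "hess_form f x u = u \<bullet> frechet_derivative (gradient f) (at x) u"

definition jac_x :: "('n::real_normed_vector \<times> 'd \<Rightarrow> 'm::real_normed_vector)
    \<Rightarrow> 'n \<Rightarrow> 'd \<Rightarrow> 'n \<Rightarrow> 'm" where
  "jac_x \<Phi> x w = frechet_derivative (\<lambda>x'. \<Phi> (x', w)) (at x)"

abbreviation ker :: "('a \<Rightarrow> 'b::zero) \<Rightarrow> 'a set" where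
  "ker f \<equiv> {y. f y = 0}"

section \<open>The parametric composite problem and its KKT system\<close>

definition argmin_loc ::
  "('n::real_inner \<times> 'd \<Rightarrow> real) \<Rightarrow> ('m \<Rightarrow> ereal) \<Rightarrow> ('n \<times> 'd \<Rightarrow> 'm)
     \<Rightarrow> 'n \<Rightarrow> real \<Rightarrow> 'd \<Rightarrow> 'n \<Rightarrow> 'n set" where
  "argmin_loc \<phi>0 \<theta> \<Phi> xb \<gamma> w v =
     argmin_over {x. norm (x - xb) \<le> \<gamma>}
       (\<lambda>x. ereal (\<phi>0 (x, w)) + \<theta> (\<Phi> (x, w)) - ereal (v \<bullet> x))"

definition lagrangian ::
  "('n \<times> 'd \<Rightarrow> real) \<Rightarrow> ('n \<times> 'd \<Rightarrow> 'm::real_inner) \<Rightarrow> 'n \<Rightarrow> 'd \<Rightarrow> 'm \<Rightarrow> real" where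
  "lagrangian \<phi>0 \<Phi> x w lam = \<phi>0 (x, w) + lam \<bullet> \<Phi> (x, w)"

text \<open>The equation \<open>v = \<nabla>\<^sub>x L(x, w, \<lambda>)\<close> includes that the gradient exists: points at which
  \<open>L(\<cdot>, w, \<lambda>)\<close> is not differentiable contribute no KKT pairs.\<close>

definition S_KKT ::
  "('n::real_inner \<times> 'd \<Rightarrow> real) \<Rightarrow> ('m::real_inner \<Rightarrow> ereal) \<Rightarrow> ('n \<times> 'd \<Rightarrow> 'm)
     \<Rightarrow> 'd \<times> 'n \<Rightarrow> ('n \<times> 'm) set" where
  "S_KKT \<phi>0 \<theta> \<Phi> = (\<lambda>(w, v). {(x, lam).
       (GDERIV (\<lambda>x'. lagrangian \<phi>0 \<Phi> x' w lam) x :> v) \<and>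
       lam \<in> subdifferential \<theta> (\<Phi> (x, w))})"

definition lipschitz_localization ::
  "('p::metric_space \<Rightarrow> 'q::metric_space set) \<Rightarrow> 'p \<Rightarrow> 'q \<Rightarrow> bool" where
  "lipschitz_localization F pb qb \<longleftrightarrow>
     (\<exists>U V g L. pb \<in> interior U \<and> qb \<in> interior V \<and> g \<in> U \<rightarrow> V \<and> L-lipschitz_on U g \<and>
        {(s, t). t \<in> F s} \<inter> (U \<times> V) = {(s, g s) |s. s \<in> U})"

definition SVLL ::
  "('n::real_inner \<times> 'd::metric_space \<Rightarrow> real) \<Rightarrow> ('m::real_inner \<Rightarrow> ereal) \<Rightarrow> ('n \<times> 'd \<Rightarrow> 'm)
     \<Rightarrow> 'n \<Rightarrow> 'm \<Rightarrow> 'd \<Rightarrow> 'n \<Rightarrow> bool" where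
  "SVLL \<phi>0 \<theta> \<Phi> xb lamb wb vb \<longleftrightarrow>
     lipschitz_localization (S_KKT \<phi>0 \<theta> \<Phi>) (wb, vb) (xb, lamb)"

definition nondegenerate ::
  "('m::real_inner \<Rightarrow> ereal) \<Rightarrow> ('n::real_inner \<times> 'd \<Rightarrow> 'm) \<Rightarrow> 'n \<Rightarrow> 'd \<Rightarrow> bool" where
  "nondegenerate \<theta> \<Phi> xb wb \<longleftrightarrow>
     parallel_subspace (affine hull (subdifferential \<theta> (\<Phi> (xb, wb))))
       \<inter> ker (adjoint (jac_x \<Phi> xb wb)) = {0}"

definition first_order_qc ::
  "('m::real_inner \<Rightarrow> ereal) \<Rightarrow> ('n::real_inner \<times> 'd \<Rightarrow> 'm) \<Rightarrow> 'n \<Rightarrow> 'd \<Rightarrow> bool" where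
  "first_order_qc \<theta> \<Phi> xb wb \<longleftrightarrow>
     singular_subdifferential \<theta> (\<Phi> (xb, wb)) \<inter> ker (adjoint (jac_x \<Phi> xb wb)) = {0}"

section \<open>The composite strong second-order sufficient condition\<close>

text \<open>In this section \<open>K\<close> and \<open>I\<close> stand for the active index sets at the point under
  consideration.\<close>

definition multiplier_rep ::
  "(nat \<Rightarrow> 'm::real_inner) \<Rightarrow> (nat \<Rightarrow> 'm) \<Rightarrow> nat set \<Rightarrow> nat set \<Rightarrow> 'm
     \<Rightarrow> (nat \<Rightarrow> real) \<Rightarrow> (nat \<Rightarrow> real) \<Rightarrow> bool" where
  "multiplier_rep a d K I lamb c \<mu> \<longleftrightarrow>
     (\<forall>i\<in>K. 0 \<le> c i) \<and> (\<Sum>i\<in>K. c i) = 1 \<and> (\<forall>i\<in>I. 0 \<le> \<mu> i) \<and>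
     lamb = (\<Sum>i\<in>K. c i *\<^sub>R a i) + (\<Sum>i\<in>I. \<mu> i *\<^sub>R d i)"

definition crit_cone ::
  "(nat \<Rightarrow> 'm::real_inner) \<Rightarrow> (nat \<Rightarrow> 'm) \<Rightarrow> nat set \<Rightarrow> nat set \<Rightarrow> nat set \<Rightarrow> nat set
     \<Rightarrow> 'm set" where
  "crit_cone a d K I J1 J2 = {u.
     (\<forall>i\<in>J1. \<forall>j\<in>J1. (a i - a j) \<bullet> u = 0) \<and>
     (\<forall>i\<in>K - J1. \<forall>j\<in>J1. (a i - a j) \<bullet> u \<le> 0) \<and>
     (\<forall>i\<in>J2. d i \<bullet> u = 0) \<and>
     (\<forall>i\<in>I - J2. d i \<bullet> u \<le> 0)}"

definition Gamma1 ::
  "(nat \<Rightarrow> 'm::real_inner) \<Rightarrow> nat set \<Rightarrow> nat set \<Rightarrow> 'm set \<Rightarrow> nat set" where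
  "Gamma1 a K J1 G = {i\<in>K. \<forall>j\<in>J1. \<forall>u\<in>G. (a i - a j) \<bullet> u = 0}"

definition Gamma2 :: "(nat \<Rightarrow> 'm::real_inner) \<Rightarrow> nat set \<Rightarrow> 'm set \<Rightarrow> nat set" where
  "Gamma2 d I G = {t\<in>I. \<forall>u\<in>G. d t \<bullet> u = 0}"

definition crit_subspace ::
  "(nat \<Rightarrow> 'm::real_inner) \<Rightarrow> (nat \<Rightarrow> 'm) \<Rightarrow> nat set \<Rightarrow> nat set
     \<Rightarrow> (nat \<Rightarrow> real) \<Rightarrow> (nat \<Rightarrow> real) \<Rightarrow> ('n \<Rightarrow> 'm) \<Rightarrow> 'n set" where
  "crit_subspace a d K I c \<mu> A =
     (let J1 = {i\<in>K. 0 < c i}; J2 = {i\<in>I. 0 < \<mu> i}; G = crit_cone a d K I J1 J2 in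
      {u. (\<forall>i\<in>Gamma1 a K J1 G. \<forall>j\<in>Gamma1 a K J1 G. (a i - a j) \<bullet> A u = 0) \<and>
          (\<forall>t\<in>Gamma2 d I G. d t \<bullet> A u = 0)})"

text \<open>The condition is stated for some representation of the multiplier; by the lemma
  \<open>composite_SSOSC_iff\<close> below it can be checked on any representation, and one exists for every
  multiplier in the subdifferential, by \<open>subdifferential_cpwl\<close>.\<close>

definition composite_SSOSC ::
  "('n::real_inner \<times> 'd \<Rightarrow> real) \<Rightarrow> ('n \<times> 'd \<Rightarrow> 'm::real_inner)
     \<Rightarrow> nat \<Rightarrow> (nat \<Rightarrow> 'm) \<Rightarrow> (nat \<Rightarrow> real) \<Rightarrow> nat \<Rightarrow> (nat \<Rightarrow> 'm) \<Rightarrow> (nat \<Rightarrow> real)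
     \<Rightarrow> 'n \<Rightarrow> 'd \<Rightarrow> 'm \<Rightarrow> bool" where
  "composite_SSOSC \<phi>0 \<Phi> l a \<alpha> p d \<beta> xb wb lamb \<longleftrightarrow>
     (let K = active_K l a \<alpha> (\<Phi> (xb, wb)); I = active_I p d \<beta> (\<Phi> (xb, wb)) in
      \<exists>c \<mu>. multiplier_rep a d K I lamb c \<mu> \<and>
        (\<forall>u \<in> crit_subspace a d K I c \<mu> (jac_x \<Phi> xb wb).
           u \<noteq> 0 \<longrightarrow> 0 < hess_form (\<lambda>x. lagrangian \<phi>0 \<Phi> x wb lamb) xb u))"

section \<open>Consistency of the definitions\<close>

lemma multiplier_rep_inner:
  assumes "multiplier_rep a d K I lamb c \<mu>"
  shows "lamb \<bullet> u = (\<Sum>i\<in>K. c i * (a i \<bullet> u)) + (\<Sum>i\<in>I. \<mu> i * (d i \<bullet> u))"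
  using assms by (simp add: multiplier_rep_def inner_add_left inner_sum_left)

lemma multiplier_rep_J1:
  assumes "finite K" "multiplier_rep a d K I lamb c \<mu>"
  shows "\<exists>j\<in>K. 0 < c j"
proof (rule ccontr)
  assume "\<not> ?thesis"
  then have "(\<Sum>i\<in>K. c i) \<le> 0" by (intro sum_nonpos) (auto simp: not_less)
  with assms show False by (simp add: multiplier_rep_def)
qed

lemma crit_cone_inner:
  assumes fin: "finite K" "finite I" and rep: "multiplier_rep a d K I lamb c \<mu>"
    and u: "u \<in> crit_cone a d K I {i\<in>K. 0 < c i} {i\<in>I. 0 < \<mu> i}"
    and j: "j \<in> K" "0 < c j"
  shows "lamb \<bullet> u = a j \<bullet> u"
proof -
  have u1: "(a i - a j) \<bullet> u = 0" if "i \<in> K" "0 < c i" for i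
    using u j that unfolding crit_cone_def by blast
  have u2: "d i \<bullet> u = 0" if "i \<in> I" "0 < \<mu> i" for i
    using u that unfolding crit_cone_def by blast
  have 1: "c i * (a i \<bullet> u) = c i * (a j \<bullet> u)" if "i \<in> K" for i
  proof (cases "c i = 0")
    case False
    then have "0 < c i" using rep that unfolding multiplier_rep_def by (simp add: less_le)
    from u1[OF that this] show ?thesis by (simp add: inner_diff_left)
  qed simp
  have 2: "\<mu> i * (d i \<bullet> u) = 0" if "i \<in> I" for i
  proof (cases "\<mu> i = 0")
    case False
    then have "0 < \<mu> i" using rep that unfolding multiplier_rep_def by (simp add: less_le)
    from u2[OF that this] show ?thesis by simp
  qed simp
  have "(\<Sum>i\<in>K. c i * (a i \<bullet> u)) = (\<Sum>i\<in>K. c i) * (a j \<bullet> u)"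
    unfolding sum_distrib_right by (rule sum.cong[OF refl 1])
  then show ?thesis
    using multiplier_rep_inner[OF rep, of u] 2 rep by (simp add: multiplier_rep_def)
qed

lemma crit_cone_eq:
  assumes fin: "finite K" "finite I" and rep: "multiplier_rep a d K I lamb c \<mu>"
  shows "crit_cone a d K I {i\<in>K. 0 < c i} {i\<in>I. 0 < \<mu> i} =
    {u. (\<forall>i\<in>K. a i \<bullet> u \<le> lamb \<bullet> u) \<and> (\<forall>t\<in>I. d t \<bullet> u \<le> 0)}" (is "?G = ?R")
proof (intro set_eqI iffI)
  fix u assume u: "u \<in> ?G"
  obtain j where j: "j \<in> K" "0 < c j" using multiplier_rep_J1[OF fin(1) rep] by auto
  have "a i \<bullet> u \<le> lamb \<bullet> u" if "i \<in> K" for i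
  proof (cases "0 < c i")
    case True then show ?thesis using crit_cone_inner[OF fin rep u that] by simp
  next
    case False
    then have "(a i - a j) \<bullet> u \<le> 0" using u that j unfolding crit_cone_def by blast
    then show ?thesis using crit_cone_inner[OF fin rep u j] by (simp add: inner_diff_left)
  qed
  moreover have "d t \<bullet> u \<le> 0" if "t \<in> I" for t
    using u that unfolding crit_cone_def by (cases "0 < \<mu> t") auto
  ultimately show "u \<in> ?R" by simp
next
  fix u assume "u \<in> ?R"
  then have u: "\<And>i. i \<in> K \<Longrightarrow> a i \<bullet> u \<le> lamb \<bullet> u" "\<And>t. t \<in> I \<Longrightarrow> d t \<bullet> u \<le> 0" by auto
  have c: "\<And>i. i \<in> K \<Longrightarrow> 0 \<le> c i" "(\<Sum>i\<in>K. c i) = 1" "\<And>t. t \<in> I \<Longrightarrow> 0 \<le> \<mu> t"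
    using rep by (auto simp: multiplier_rep_def)
  have n1: "0 \<le> c i * (lamb \<bullet> u - a i \<bullet> u)" if "i \<in> K" for i using that u c by simp
  have n2: "0 \<le> \<mu> t * - (d t \<bullet> u)" if "t \<in> I" for t
    using that u(2) c(3) by (metis mult_nonneg_nonneg neg_0_le_iff_le)
  have "(\<Sum>i\<in>K. c i * (lamb \<bullet> u - a i \<bullet> u)) + (\<Sum>t\<in>I. \<mu> t * - (d t \<bullet> u))
      = (\<Sum>i\<in>K. c i) * (lamb \<bullet> u) - (\<Sum>i\<in>K. c i * (a i \<bullet> u)) - (\<Sum>t\<in>I. \<mu> t * (d t \<bullet> u))"
    by (simp add: right_diff_distrib sum_subtractf sum_distrib_right sum_negf)
  also have "\<dots> = 0" using multiplier_rep_inner[OF rep, of u] c by simp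
  finally have z: "(\<Sum>i\<in>K. c i * (lamb \<bullet> u - a i \<bullet> u)) = 0" "(\<Sum>t\<in>I. \<mu> t * - (d t \<bullet> u)) = 0"
    using sum_nonneg[of K "\<lambda>i. c i * (lamb \<bullet> u - a i \<bullet> u)"]
      sum_nonneg[of I "\<lambda>t. \<mu> t * - (d t \<bullet> u)"] n1 n2 by auto
  have e1: "a i \<bullet> u = lamb \<bullet> u" if "i \<in> K" "0 < c i" for i
    using z(1) that n1 by (subst (asm) sum_nonneg_eq_0_iff) (auto simp: fin)
  have e2: "d t \<bullet> u = 0" if "t \<in> I" "0 < \<mu> t" for t
    using z(2) that n2 by (subst (asm) sum_nonneg_eq_0_iff) (auto simp: fin)
  show "u \<in> ?G" using u e1 e2 by (auto simp: crit_cone_def inner_diff_left)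
qed

lemma Gamma1_eq:
  assumes fin: "finite K" "finite I" and rep: "multiplier_rep a d K I lamb c \<mu>"
    and G: "G = crit_cone a d K I {i\<in>K. 0 < c i} {i\<in>I. 0 < \<mu> i}"
  shows "Gamma1 a K {i\<in>K. 0 < c i} G = {i\<in>K. \<forall>u\<in>G. a i \<bullet> u = lamb \<bullet> u}"
proof -
  obtain j where j: "j \<in> K" "0 < c j" using multiplier_rep_J1[OF fin(1) rep] by auto
  have e: "(a i - a k) \<bullet> u = 0 \<longleftrightarrow> a i \<bullet> u = lamb \<bullet> u" if "k \<in> K" "0 < c k" "u \<in> G" for i k u
    using crit_cone_inner[OF fin rep that(3)[unfolded G] that(1,2)] by (simp add: inner_diff_left)
  show ?thesis unfolding Gamma1_def using e j by blast
qed

lemma crit_subspace_unique: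
  assumes fin: "finite K" "finite I"
    and rep: "multiplier_rep a d K I lamb c \<mu>" "multiplier_rep a d K I lamb c' \<mu>'"
  shows "crit_subspace a d K I c \<mu> A = crit_subspace a d K I c' \<mu>' A"
proof -
  note G = crit_cone_eq[OF fin rep(1)] crit_cone_eq[OF fin rep(2)]
  show ?thesis
    unfolding crit_subspace_def Let_def G Gamma1_eq[OF fin rep(1) G(1)[symmetric]]
      Gamma1_eq[OF fin rep(2) G(2)[symmetric]] ..
qed

lemma finite_active [simp]: "finite (active_K l a \<alpha> z)" "finite (active_I p d \<beta> z)"
  by (simp_all add: active_K_def active_I_def)

lemma composite_SSOSC_iff:
  assumes "K = active_K l a \<alpha> (\<Phi> (xb, wb))" "I = active_I p d \<beta> (\<Phi> (xb, wb))"
    and "multiplier_rep a d K I lamb c \<mu>"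
  shows "composite_SSOSC \<phi>0 \<Phi> l a \<alpha> p d \<beta> xb wb lamb \<longleftrightarrow>
    (\<forall>u \<in> crit_subspace a d K I c \<mu> (jac_x \<Phi> xb wb).
       u \<noteq> 0 \<longrightarrow> 0 < hess_form (\<lambda>x. lagrangian \<phi>0 \<Phi> x wb lamb) xb u)"
proof -
  have fin: "finite K" "finite I" using assms by auto
  show ?thesis
    unfolding composite_SSOSC_def Let_def assms(1,2)[symmetric]
    using assms(3) crit_subspace_unique[OF fin _ assms(3)] by metis
qed

lemma singular_subdifferential_eq:
  assumes "cpwl_rep \<theta> l a \<alpha> p d \<beta>"
  shows "singular_subdifferential \<theta> z = normal_cone z (edom \<theta>)"
proof (cases "z \<in> edom \<theta>")
  case True
  have fin: "\<exists>r. \<theta> y = ereal r" if "y \<in> edom \<theta>" for y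
    using assms that unfolding cpwl_rep_def by (auto split: if_splits)
  have ep: "(y, r) \<in> epi \<theta> \<Longrightarrow> y \<in> edom \<theta>" for y r
    by (auto simp: epi_def edom_def)
  have zin: "(y, real_of_ereal (\<theta> y)) \<in> epi \<theta>" if "y \<in> edom \<theta>" for y
    using fin[OF that] by (auto simp: epi_def)
  have "(v, 0) \<in> normal_cone (z, real_of_ereal (\<theta> z)) (epi \<theta>) \<longleftrightarrow>
      (\<forall>(y, r)\<in>epi \<theta>. v \<bullet> (y - z) \<le> 0)" for v
    using zin[OF True] by (auto simp: normal_cone_def inner_prod_def)
  also have "(\<forall>(y, r)\<in>epi \<theta>. v \<bullet> (y - z) \<le> 0) \<longleftrightarrow> (\<forall>y\<in>edom \<theta>. v \<bullet> (y - z) \<le> 0)" for v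
    using zin ep by blast
  finally have "(v, 0) \<in> normal_cone (z, real_of_ereal (\<theta> z)) (epi \<theta>) \<longleftrightarrow>
      (\<forall>y\<in>edom \<theta>. v \<bullet> (y - z) \<le> 0)" for v .
  with True show ?thesis by (simp add: singular_subdifferential_def normal_cone_def)
qed (simp add: singular_subdifferential_def normal_cone_def)

lemma cone_hull_image_rep:
  assumes "finite I" "y \<in> convex_cone hull (d ` I)"
  shows "\<exists>\<mu>. (\<forall>i\<in>I. 0 \<le> \<mu> i) \<and> y = (\<Sum>i\<in>I. \<mu> i *\<^sub>R d i)"
proof -
  let ?C = "{y. \<exists>\<mu>. (\<forall>i\<in>I. (0::real) \<le> \<mu> i) \<and> y = (\<Sum>i\<in>I. \<mu> i *\<^sub>R d i)}"
  have cone: "convex_cone ?C"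
    unfolding convex_cone_iff
  proof (intro conjI ballI allI impI)
    show "0 \<in> ?C" by (rule CollectI, rule exI[of _ "\<lambda>_. 0"]) simp
  next
    fix x y assume "x \<in> ?C" "y \<in> ?C"
    then obtain m m' where "\<forall>i\<in>I. (0::real) \<le> m i" "x = (\<Sum>i\<in>I. m i *\<^sub>R d i)"
      "\<forall>i\<in>I. (0::real) \<le> m' i" "y = (\<Sum>i\<in>I. m' i *\<^sub>R d i)" by blast
    then show "x + y \<in> ?C"
      by (intro CollectI exI[of _ "\<lambda>i. m i + m' i"]) (simp add: scaleR_left_distrib sum.distrib)
  next
    fix x and c :: real assume "x \<in> ?C" "0 \<le> c"
    then obtain m where "\<forall>i\<in>I. (0::real) \<le> m i" "x = (\<Sum>i\<in>I. m i *\<^sub>R d i)" by blast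
    with \<open>0 \<le> c\<close> show "c *\<^sub>R x \<in> ?C"
      by (intro CollectI exI[of _ "\<lambda>i. c * m i"]) (simp add: scaleR_sum_right)
  qed
  have "d ` I \<subseteq> ?C"
  proof (intro image_subsetI CollectI)
    fix t assume t: "t \<in> I"
    show "\<exists>\<mu>. (\<forall>i\<in>I. (0::real) \<le> \<mu> i) \<and> d t = (\<Sum>i\<in>I. \<mu> i *\<^sub>R d i)"
      using t assms(1)
      by (intro exI[of _ "\<lambda>i. if i = t then 1 else 0"]) (simp add: if_distrib[of "\<lambda>c. c *\<^sub>R _"] cong: if_cong)
  qed
  from hull_minimal[of "d ` I" ?C convex_cone, OF this cone] assms(2) show ?thesis by blast
qed

lemma convex_hull_image_rep:
  assumes "finite K" "x \<in> convex hull (a ` K)"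
  shows "\<exists>c. (\<forall>i\<in>K. 0 \<le> c i) \<and> (\<Sum>i\<in>K. c i) = 1 \<and> x = (\<Sum>i\<in>K. c i *\<^sub>R a i)"
proof -
  let ?C = "{x. \<exists>c. (\<forall>i\<in>K. (0::real) \<le> c i) \<and> (\<Sum>i\<in>K. c i) = 1 \<and> x = (\<Sum>i\<in>K. c i *\<^sub>R a i)}"
  have conv: "convex ?C"
  proof (rule convexI)
    fix x y and s t :: real assume st: "0 \<le> s" "0 \<le> t" "s + t = 1" and "x \<in> ?C" "y \<in> ?C"
    then obtain m m' where "\<forall>i\<in>K. (0::real) \<le> m i" "(\<Sum>i\<in>K. m i) = 1" "x = (\<Sum>i\<in>K. m i *\<^sub>R a i)"
      "\<forall>i\<in>K. (0::real) \<le> m' i" "(\<Sum>i\<in>K. m' i) = 1" "y = (\<Sum>i\<in>K. m' i *\<^sub>R a i)" by blast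
    with st show "s *\<^sub>R x + t *\<^sub>R y \<in> ?C"
      by (intro CollectI exI[of _ "\<lambda>i. s * m i + t * m' i"])
        (simp add: scaleR_left_distrib sum.distrib scaleR_sum_right flip: sum_distrib_left)
  qed
  have "a ` K \<subseteq> ?C"
  proof (intro image_subsetI CollectI)
    fix t assume t: "t \<in> K"
    show "\<exists>c. (\<forall>i\<in>K. (0::real) \<le> c i) \<and> (\<Sum>i\<in>K. c i) = 1 \<and> a t = (\<Sum>i\<in>K. c i *\<^sub>R a i)"
      using t assms(1)
      by (intro exI[of _ "\<lambda>i. if i = t then 1 else 0"]) (simp add: if_distrib[of "\<lambda>c. c *\<^sub>R _"] cong: if_cong)
  qed
  from hull_minimal[of "a ` K" ?C convex, OF this conv] assms(2) show ?thesis by blast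
qed

lemma active_K_nonempty:
  assumes "1 \<le> l"
  shows "active_K l a \<alpha> z \<noteq> {}"
proof -
  have "(MAX j\<in>{1..l}. a j \<bullet> z - \<alpha> j) \<in> (\<lambda>j. a j \<bullet> z - \<alpha> j) ` {1..l}"
    using assms by (intro Max_in) auto
  then show ?thesis unfolding active_K_def by force
qed

theorem subdifferential_cpwl:
  fixes \<theta> :: "'a::euclidean_space \<Rightarrow> ereal"
  assumes rep: "cpwl_rep \<theta> l a \<alpha> p d \<beta>" and z: "z \<in> edom \<theta>"
  defines "K \<equiv> active_K l a \<alpha> z" and "I \<equiv> active_I p d \<beta> z"
  shows "subdifferential \<theta> z =
      {x + y |x y. x \<in> convex hull (a ` K) \<and> y \<in> convex_cone hull (d ` I)}" (is "_ = ?C")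
    and "v \<in> subdifferential \<theta> z \<longleftrightarrow> (\<exists>c \<mu>. multiplier_rep a d K I v c \<mu>)"
proof -
  define m where "m y = (MAX i\<in>{1..l}. a i \<bullet> y - \<alpha> i)" for y
  have l: "1 \<le> l" and dom: "edom \<theta> = {z. \<forall>i\<in>{1..p}. d i \<bullet> z \<le> \<beta> i}"
    and th: "y \<in> edom \<theta> \<Longrightarrow> \<theta> y = ereal (m y)" "y \<notin> edom \<theta> \<Longrightarrow> \<theta> y = \<infinity>" for y
    using rep by (auto simp: cpwl_rep_def m_def)
  have fin: "finite K" "finite I" by (simp_all add: K_def I_def)
  have Kl: "i \<in> K \<longleftrightarrow> i \<in> {1..l} \<and> a i \<bullet> z - \<alpha> i = m z" for i
    by (auto simp: K_def active_K_def m_def)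
  have Il: "i \<in> I \<longleftrightarrow> i \<in> {1..p} \<and> d i \<bullet> z = \<beta> i" for i
    by (auto simp: I_def active_I_def)
  have mge: "a i \<bullet> y - \<alpha> i \<le> m y" if "i \<in> {1..l}" for i y
    unfolding m_def using that by (intro Max_ge) auto
  have mlt: "m y < r" if "\<And>i. i \<in> {1..l} \<Longrightarrow> a i \<bullet> y - \<alpha> i < r" for y r
    unfolding m_def using that l by (subst Max_less_iff) auto
  have mem: "v \<in> subdifferential \<theta> z \<longleftrightarrow> (\<forall>y\<in>edom \<theta>. m z + v \<bullet> (y - z) \<le> m y)" for v
  proof -
    have "(\<theta> z + ereal (v \<bullet> (y - z)) \<le> \<theta> y) \<longleftrightarrow> (y \<in> edom \<theta> \<longrightarrow> m z + v \<bullet> (y - z) \<le> m y)" for y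
      using th z by (cases "y \<in> edom \<theta>") simp_all
    then show ?thesis using z by (auto simp: subdifferential_def)
  qed
  have sub1: "v \<in> ?C \<Longrightarrow> \<exists>c \<mu>. multiplier_rep a d K I v c \<mu>" for v
  proof -
    assume "v \<in> ?C"
    then obtain x y where xy: "v = x + y" "x \<in> convex hull (a ` K)" "y \<in> convex_cone hull (d ` I)"
      by blast
    from convex_hull_image_rep[OF fin(1) xy(2)] cone_hull_image_rep[OF fin(2) xy(3)] xy(1)
    show ?thesis unfolding multiplier_rep_def by blast
  qed
  have sub2: "v \<in> subdifferential \<theta> z" if r: "multiplier_rep a d K I v c \<mu>" for v c \<mu>
    unfolding mem
  proof
    fix y assume y: "y \<in> edom \<theta>"
    have c: "\<And>i. i \<in> K \<Longrightarrow> 0 \<le> c i" "(\<Sum>i\<in>K. c i) = 1" "\<And>t. t \<in> I \<Longrightarrow> 0 \<le> \<mu> t"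
      using r by (auto simp: multiplier_rep_def)
    have "(\<Sum>i\<in>K. c i * (a i \<bullet> (y - z))) \<le> (\<Sum>i\<in>K. c i * (m y - m z))"
    proof (intro sum_mono mult_left_mono c)
      fix i assume "i \<in> K"
      then show "a i \<bullet> (y - z) \<le> m y - m z" using mge[of i y] Kl[of i] by (simp add: inner_diff_right)
    qed
    moreover have "(\<Sum>i\<in>K. c i * (m y - m z)) = m y - m z"
      using c(2) by (simp flip: sum_distrib_right)
    moreover have "(\<Sum>t\<in>I. \<mu> t * (d t \<bullet> (y - z))) \<le> 0"
    proof (intro sum_nonpos mult_nonneg_nonpos c)
      fix t assume "t \<in> I"
      then show "d t \<bullet> (y - z) \<le> 0" using y Il[of t] by (simp add: dom inner_diff_right)
    qed
    ultimately show "m z + v \<bullet> (y - z) \<le> m y"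
      using multiplier_rep_inner[OF r, of "y - z"] by linarith
  qed
  have sub3: "v \<in> ?C" if v: "v \<in> subdifferential \<theta> z" for v
  proof (rule ccontr)
    assume nin: "v \<notin> ?C"
    have ne: "K \<noteq> {}" using active_K_nonempty[OF l] by (simp add: K_def)
    have eqC: "?C = (\<Union>x\<in>convex hull (a ` K). \<Union>y\<in>convex_cone hull (d ` I). {x + y})" by auto
    have "closed ?C"
      unfolding eqC
    proof (rule compact_closed_sums)
      show "compact (convex hull (a ` K))" using fin by (intro finite_imp_compact_convex_hull) simp
      show "closed (convex_cone hull (d ` I))" using fin by (intro closed_convex_cone_hull) simp
    qed
    moreover have "convex ?C"
      unfolding eqC by (intro convex_sums convex_convex_hull convex_convex_cone_hull)
    ultimately obtain w b where w: "w \<bullet> v < b" "\<And>x. x \<in> ?C \<Longrightarrow> b < w \<bullet> x"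
      using separating_hyperplane_closed_point[of ?C v] nin by blast
    define u where "u = - w"
    have aK: "a i + s *\<^sub>R d t \<in> ?C" if "i \<in> K" "t \<in> I" "0 \<le> s" for i t s
      using that by (blast intro: hull_inc convex_cone_hull_mul)
    have ai: "a i \<in> ?C" if "i \<in> K" for i
    proof -
      have "a i + 0 \<in> ?C" using that by (blast intro: hull_inc convex_cone_hull_contains_0)
      then show ?thesis by simp
    qed
    have ua: "a i \<bullet> u < v \<bullet> u" if "i \<in> K" for i
      using w(2)[OF ai[OF that]] w(1) by (simp add: u_def inner_commute)
    have ud: "d t \<bullet> u \<le> 0" if t: "t \<in> I" for t
    proof (rule ccontr)
      assume "\<not> ?thesis"
      then have pos: "0 < d t \<bullet> u" by simp
      obtain i where i: "i \<in> K" using ne by blast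
      define s where "s = (v \<bullet> u - a i \<bullet> u) / (d t \<bullet> u)"
      have s: "0 \<le> s" using ua[OF i] pos by (simp add: s_def)
      have "w \<bullet> v < w \<bullet> (a i + s *\<^sub>R d t)" using w(2)[OF aK[OF i t s]] w(1) by linarith
      then have "a i \<bullet> u + s * (d t \<bullet> u) < v \<bullet> u"
        by (simp add: u_def inner_commute inner_add_right)
      with pos show False by (simp add: s_def)
    qed
    let ?y = "\<lambda>s. z + s *\<^sub>R u"
    have small1: "\<forall>\<^sub>F s in at_right 0. d t \<bullet> ?y s \<le> \<beta> t" if t: "t \<in> {1..p}" for t
    proof (cases "t \<in> I")
      case True
      have "\<forall>\<^sub>F s in at_right (0::real). 0 < s" by (rule eventually_at_right_less)
      then show ?thesis
        by eventually_elim (use True Il[of t] ud[OF True] in \<open>simp add: inner_add_right mult_nonneg_nonpos\<close>)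
    next
      case False
      then have "d t \<bullet> z < \<beta> t" using z t Il[of t] by (auto simp: dom less_le)
      moreover have "((\<lambda>s. d t \<bullet> ?y s) \<longlongrightarrow> d t \<bullet> ?y 0) (at_right 0)"
        by (intro tendsto_intros)
      ultimately have "\<forall>\<^sub>F s in at_right 0. d t \<bullet> ?y s < \<beta> t"
        by (intro order_tendstoD(2)) simp_all
      then show ?thesis by eventually_elim simp
    qed
    have small2: "\<forall>\<^sub>F s in at_right 0. a i \<bullet> ?y s - \<alpha> i < m z + s * (v \<bullet> u)" if i: "i \<in> {1..l}" for i
    proof (cases "i \<in> K")
      case True
      have "\<forall>\<^sub>F s in at_right (0::real). 0 < s" by (rule eventually_at_right_less)
      then show ?thesis
      proof eventually_elim
        case (elim s)
        then have "s * (a i \<bullet> u) < s * (v \<bullet> u)" using ua[OF True] by simp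
        then show ?case using True Kl[of i] by (simp add: inner_add_right)
      qed
    next
      case False
      then have "a i \<bullet> z - \<alpha> i < m z" using mge[OF i, of z] Kl[of i] i by auto
      moreover have "((\<lambda>s. a i \<bullet> ?y s - \<alpha> i - s * (v \<bullet> u)) \<longlongrightarrow> a i \<bullet> ?y 0 - \<alpha> i - 0 * (v \<bullet> u)) (at_right 0)"
        by (intro tendsto_intros)
      ultimately have "\<forall>\<^sub>F s in at_right 0. a i \<bullet> ?y s - \<alpha> i - s * (v \<bullet> u) < m z"
        by (intro order_tendstoD(2)) simp_all
      then show ?thesis by eventually_elim simp
    qed
    have "\<forall>\<^sub>F s in at_right (0::real). (\<forall>t\<in>{1..p}. d t \<bullet> ?y s \<le> \<beta> t)
        \<and> (\<forall>i\<in>{1..l}. a i \<bullet> ?y s - \<alpha> i < m z + s * (v \<bullet> u))"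
      using small1 small2 by (intro eventually_conj eventually_ball_finite) auto
    then obtain s where s: "\<forall>t\<in>{1..p}. d t \<bullet> ?y s \<le> \<beta> t"
        "\<forall>i\<in>{1..l}. a i \<bullet> ?y s - \<alpha> i < m z + s * (v \<bullet> u)"
      using eventually_happens'[OF trivial_limit_at_right_real] by blast
    have "?y s \<in> edom \<theta>" using s(1) by (simp add: dom)
    with v[unfolded mem] have "m z + v \<bullet> (?y s - z) \<le> m (?y s)" by blast
    moreover have "m (?y s) < m z + s * (v \<bullet> u)" using s(2) by (intro mlt) blast
    ultimately show False by simp
  qed
  show "subdifferential \<theta> z = ?C"
  proof (rule set_eqI)
    fix v
    show "v \<in> subdifferential \<theta> z \<longleftrightarrow> v \<in> ?C"
    proof
      assume "v \<in> subdifferential \<theta> z" then show "v \<in> ?C" by (rule sub3)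
    next
      assume "v \<in> ?C"
      from sub1[OF this] show "v \<in> subdifferential \<theta> z" by (elim exE) (rule sub2)
    qed
  qed
  show "v \<in> subdifferential \<theta> z \<longleftrightarrow> (\<exists>c \<mu>. multiplier_rep a d K I v c \<mu>)"
  proof
    assume "v \<in> subdifferential \<theta> z"
    from sub1[OF sub3[OF this]] show "\<exists>c \<mu>. multiplier_rep a d K I v c \<mu>" .
  next
    assume "\<exists>c \<mu>. multiplier_rep a d K I v c \<mu>"
    then show "v \<in> subdifferential \<theta> z" by (elim exE) (rule sub2)
  qed
qed

end

theory Submission
  imports Defs
begin

text \<open>Both directions rest on polyhedrality. If \<open>\<lambda> \<in> \<partial>\<theta>(z)\<close> with \<open>(z, \<lambda>)\<close> close to \<open>(zb, lamb)\<close>, then already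
  \<open>lamb \<in> \<partial>\<theta>(z)\<close>, because only finitely many polyhedra occur as subdifferentials near \<open>zb\<close>; hence
  \<open>z - zb\<close> lies in the critical cone \<open>G\<close> and \<open>\<theta>(z) - \<theta>(zb) = lamb \<bullet> (z - zb)\<close>. Nondegeneracy makes the
  constraint map metrically regular modulo the orthogonal complement of \<open>S0 = aff \<partial>\<theta>(zb)\<close>, along which \<open>\<theta>\<close> is
  constant. This yields feasible arcs, multipliers at local minimizers, and their continuity.

  Given SSOSC and nondegeneracy, \<open>xb\<close> is a strict local minimizer, so minimizers persist under perturbation and
  provide KKT points; uniqueness and the Lipschitz estimate follow from monotonicity of the subdifferential,
  since differences of values \<open>\<Phi>(x, w)\<close> at KKT points lie in the span of \<open>G\<close>, where the Hessian is positive definite.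

  Conversely, a unique multiplier near \<open>lamb\<close> for all perturbed \<open>v\<close> forces nondegeneracy. The localization then
  consists of local minimizers \<open>x(v)\<close>, and comparing the problems for \<open>v\<close> and \<open>v + (y - x(v)) / 2L\<close> gives
  quadratic growth with constant \<open>1 / 4L\<close>. Testing it on two arcs through the relative interior of \<open>G\<close>, on
  which \<open>lamb\<close> stays a multiplier, shows that the Hessian is positive definite on the critical subspace.\<close>

section \<open>Convex piecewise linear functions\<close>

text \<open>The standing assumption turns \<open>S0\<close> into a linear subspace that contains
  \<open>lamb\<close> and every active \<open>a i\<close> and \<open>d t\<close>. A displacement in
  its orthogonal complement is therefore invisible to all active data, so constraint errors in that
  complement never have to be corrected, and the transposed Jacobian only has to be injective on
  \<open>S0\<close>.

  Positive definiteness is needed on the span of the critical cone, not merely on the cone, because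
  solutions of two perturbed problems are compared with each other: their values differ by a
  difference of two elements of \<open>G\<close>. Growth at \<open>xb\<close> alone would test the
  Hessian only on directions leading into \<open>G\<close>. This is why the converse moves the base
  point: with \<open>v\<close> equal to the Lagrangian gradient at a point where \<open>lamb\<close>
  is still a subgradient, that point becomes the minimizer for \<open>v\<close>, and a second such
  point lies in a direction of the span. Since \<open>lamb\<close> is a subgradient at both points,
  \<theta> contributes only a linear term, and its kinks cause no error in the second-order
  comparison.\<close>

locale cpwl =
  fixes \<theta> :: "'m::euclidean_space \<Rightarrow> ereal" and l :: nat and a :: "nat \<Rightarrow> 'm" and \<alpha> :: "nat \<Rightarrow> real"
    and p :: nat and d :: "nat \<Rightarrow> 'm" and \<beta> :: "nat \<Rightarrow> real"
  assumes rep: "cpwl_rep \<theta> l a \<alpha> p d \<beta>"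
begin

abbreviation D where "D \<equiv> edom \<theta>"
abbreviation K where "K \<equiv> active_K l a \<alpha>"
abbreviation I where "I \<equiv> active_I p d \<beta>"

definition m :: "'m \<Rightarrow> real" where
  "m z = (MAX i\<in>{1..l}. a i \<bullet> z - \<alpha> i)"

lemma l_pos: "1 \<le> l"
  using rep by (simp add: cpwl_rep_def)

lemma theta_eq: "z \<in> D \<Longrightarrow> \<theta> z = ereal (m z)"
  and theta_infty: "z \<notin> D \<Longrightarrow> \<theta> z = \<infinity>"
  using rep by (auto simp: cpwl_rep_def m_def)

lemma mem_D: "z \<in> D \<longleftrightarrow> (\<forall>i\<in>{1..p}. d i \<bullet> z \<le> \<beta> i)"
  using rep by (auto simp: cpwl_rep_def)

lemma m_ge: "i \<in> {1..l} \<Longrightarrow> a i \<bullet> z - \<alpha> i \<le> m z"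
  unfolding m_def by (intro Max_ge) auto

lemma m_le_iff: "m z \<le> r \<longleftrightarrow> (\<forall>i\<in>{1..l}. a i \<bullet> z - \<alpha> i \<le> r)"
  unfolding m_def using l_pos by (subst Max_le_iff) auto

lemma K_iff: "i \<in> K z \<longleftrightarrow> i \<in> {1..l} \<and> a i \<bullet> z - \<alpha> i = m z"
  by (auto simp: active_K_def m_def)

lemma I_iff: "i \<in> I z \<longleftrightarrow> i \<in> {1..p} \<and> d i \<bullet> z = \<beta> i"
  by (auto simp: active_I_def)

lemma K_nonempty: obtains i where "i \<in> K z"
  using active_K_nonempty[OF l_pos] by blast

lemma convex_D: "convex D" and closed_D: "closed D"
proof -
  have eq: "D = (\<Inter>i\<in>{1..p}. {z. d i \<bullet> z \<le> \<beta> i})" by (auto simp: mem_D)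
  show "convex D" unfolding eq by (intro convex_INT convex_halfspace_le)
  show "closed D" unfolding eq by (intro closed_INT ballI closed_halfspace_le)
qed

lemma convex_m: "convex_on UNIV m"
proof (rule convex_onI)
  fix t :: real and x y assume t: "0 < t" "t < 1"
  show "m ((1 - t) *\<^sub>R x + t *\<^sub>R y) \<le> (1 - t) * m x + t * m y"
    unfolding m_le_iff
  proof
    fix i assume i: "i \<in> {1..l}"
    have "(1 - t) * (a i \<bullet> x - \<alpha> i) + t * (a i \<bullet> y - \<alpha> i) \<le> (1 - t) * m x + t * m y"
      using t m_ge[OF i] by (intro add_mono mult_left_mono) auto
    then show "a i \<bullet> ((1 - t) *\<^sub>R x + t *\<^sub>R y) - \<alpha> i \<le> (1 - t) * m x + t * m y"
      by (simp add: inner_add_right algebra_simps)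
  qed
qed simp

lemma continuous_m: "continuous_on UNIV m"
  using convex_on_continuous[OF open_UNIV convex_m] .

lemma isCont_m: "isCont m z"
  using continuous_m by (simp add: continuous_on_eq_continuous_at)

lemma subdifferential_iff:
  "v \<in> subdifferential \<theta> z \<longleftrightarrow> z \<in> D \<and> (\<forall>y\<in>D. m z + v \<bullet> (y - z) \<le> m y)"
proof -
  have "(\<theta> z + ereal (v \<bullet> (y - z)) \<le> \<theta> y) \<longleftrightarrow> (y \<in> D \<longrightarrow> m z + v \<bullet> (y - z) \<le> m y)"
    if "z \<in> D" for y
    using theta_eq theta_infty that by (cases "y \<in> D") simp_all
  then show ?thesis by (auto simp: subdifferential_def)
qed

lemma subdifferential_rep:
  "z \<in> D \<Longrightarrow> v \<in> subdifferential \<theta> z \<longleftrightarrow> (\<exists>c \<mu>. multiplier_rep a d (K z) (I z) v c \<mu>)"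
  by (rule subdifferential_cpwl(2)[OF rep])

lemma a_in_subdifferential: "z \<in> D \<Longrightarrow> i \<in> K z \<Longrightarrow> a i \<in> subdifferential \<theta> z"
proof -
  assume z: "z \<in> D" and i: "i \<in> K z"
  have "m z + a i \<bullet> (y - z) \<le> m y" for y
    using m_ge[of i y] i by (simp add: K_iff inner_diff_right)
  with z show ?thesis by (simp add: subdifferential_iff)
qed

lemma add_d_in_subdifferential:
  assumes v: "v \<in> subdifferential \<theta> z" and i: "i \<in> I z"
  shows "v + d i \<in> subdifferential \<theta> z"
proof -
  have "m z + (v + d i) \<bullet> (y - z) \<le> m y" if "y \<in> D" for y
  proof -
    have "m z + v \<bullet> (y - z) \<le> m y" using v that by (simp add: subdifferential_iff)
    moreover have "d i \<bullet> y \<le> \<beta> i" "d i \<bullet> z = \<beta> i" using that i by (auto simp: I_iff mem_D)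
    ultimately show ?thesis by (simp add: inner_add_left inner_diff_right)
  qed
  then show ?thesis using v by (simp add: subdifferential_iff)
qed

lemma convex_subdifferential: "convex (subdifferential \<theta> z)"
proof (rule convexI)
  fix x y and u v :: real
  assume xy: "x \<in> subdifferential \<theta> z" "y \<in> subdifferential \<theta> z" and uv: "0 \<le> u" "0 \<le> v" "u + v = 1"
  have "m z + (u *\<^sub>R x + v *\<^sub>R y) \<bullet> (w - z) \<le> m w" if "w \<in> D" for w
  proof -
    have "u * (m z + x \<bullet> (w - z)) + v * (m z + y \<bullet> (w - z)) \<le> m w"
      using xy that uv by (intro convex_bound_le) (auto simp: subdifferential_iff)
    moreover have "u * m z + v * m z = m z" using uv by (metis mult_1 distrib_right)
    ultimately show ?thesis by (simp add: inner_add_left distrib_left)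
  qed
  with xy show "u *\<^sub>R x + v *\<^sub>R y \<in> subdifferential \<theta> z" by (simp add: subdifferential_iff)
qed

lemma closed_subdifferential: "closed (subdifferential \<theta> z)"
proof (cases "z \<in> D")
  case True
  have "subdifferential \<theta> z = (\<Inter>y\<in>D. {v. (y - z) \<bullet> v \<le> m y - m z})"
    using True by (auto simp: subdifferential_iff inner_commute algebra_simps)
  then show ?thesis by (auto intro: closed_halfspace_le)
qed (simp add: subdifferential_def)

text \<open>The finitely many inactive pieces and constraints have positive slack at
  \<open>z\<close>, which persists nearby; feasibility near \<open>z\<close> is then decided by the
  active constraints alone.\<close>

lemma active_mono:
  assumes z: "z \<in> D"
  shows "\<exists>\<rho>>0. \<forall>y\<in>ball z \<rho>. K y \<subseteq> K z \<and> I y \<subseteq> I z \<and> (y \<in> D \<longleftrightarrow> (\<forall>t\<in>I z. d t \<bullet> (y - z) \<le> 0))"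
proof -
  have "\<forall>\<^sub>F y in nhds z. i \<notin> K y" if i: "i \<in> {1..l} - K z" for i
  proof -
    have "a i \<bullet> z - \<alpha> i - m z < 0" using i m_ge[of i z] by (auto simp: K_iff)
    moreover have "((\<lambda>y. a i \<bullet> y - \<alpha> i - m y) \<longlongrightarrow> a i \<bullet> z - \<alpha> i - m z) (nhds z)"
      using isCont_m unfolding continuous_at tendsto_at_iff_tendsto_nhds
      by (intro tendsto_intros filterlim_ident)
    ultimately have "\<forall>\<^sub>F y in nhds z. a i \<bullet> y - \<alpha> i - m y < 0" by (rule order_tendstoD(2)[rotated])
    then show ?thesis by eventually_elim (simp add: K_iff)
  qed
  moreover have "\<forall>\<^sub>F y in nhds z. d i \<bullet> y < \<beta> i" if i: "i \<in> {1..p} - I z" for i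
  proof -
    have "d i \<bullet> z < \<beta> i" using i z by (auto simp: I_iff mem_D less_le)
    moreover have "((\<lambda>y. d i \<bullet> y) \<longlongrightarrow> d i \<bullet> z) (nhds z)" by (intro tendsto_intros filterlim_ident)
    ultimately show ?thesis by (rule order_tendstoD(2)[rotated])
  qed
  ultimately have "\<forall>\<^sub>F y in nhds z. (\<forall>i\<in>{1..l} - K z. i \<notin> K y) \<and> (\<forall>i\<in>{1..p} - I z. d i \<bullet> y < \<beta> i)"
    by (intro eventually_conj eventually_ball_finite) auto
  then obtain \<rho> where \<rho>: "0 < \<rho>" "\<And>y. dist y z < \<rho> \<Longrightarrow> (\<forall>i\<in>{1..l} - K z. i \<notin> K y) \<and> (\<forall>i\<in>{1..p} - I z. d i \<bullet> y < \<beta> i)"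
    unfolding eventually_nhds_metric by blast
  show ?thesis
  proof (intro exI[of _ \<rho>] conjI ballI \<rho>(1))
    fix y assume "y \<in> ball z \<rho>"
    then have y: "\<forall>i\<in>{1..l} - K z. i \<notin> K y" "\<forall>i\<in>{1..p} - I z. d i \<bullet> y < \<beta> i"
      using \<rho>(2)[of y] by (auto simp: dist_commute)
    show "K y \<subseteq> K z" using y(1) by (auto simp: K_iff)
    show "I y \<subseteq> I z" using y(2) by (force simp: I_iff)
    have "d i \<bullet> y \<le> \<beta> i \<longleftrightarrow> d i \<bullet> (y - z) \<le> 0" if "i \<in> I z" for i
      using that by (simp add: I_iff inner_diff_right)
    then show "y \<in> D \<longleftrightarrow> (\<forall>t\<in>I z. d t \<bullet> (y - z) \<le> 0)"
      unfolding mem_D using y(2) by (metis DiffI I_iff less_imp_le)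
  qed
qed

text \<open>A representation over the smaller index sets becomes one over the larger sets once the
  missing coefficients are set to zero.\<close>

lemma subdifferential_mono:
  assumes "z \<in> D" "y \<in> D" "K y \<subseteq> K z" "I y \<subseteq> I z"
  shows "subdifferential \<theta> y \<subseteq> subdifferential \<theta> z"
proof
  fix v assume "v \<in> subdifferential \<theta> y"
  then obtain c \<mu> where "multiplier_rep a d (K y) (I y) v c \<mu>" using assms subdifferential_rep by blast
  then have r: "\<forall>i\<in>K y. 0 \<le> c i" "(\<Sum>i\<in>K y. c i) = 1" "\<forall>i\<in>I y. 0 \<le> \<mu> i"
      "v = (\<Sum>i\<in>K y. c i *\<^sub>R a i) + (\<Sum>i\<in>I y. \<mu> i *\<^sub>R d i)" by (auto simp: multiplier_rep_def)
  define c' where "c' i = (if i \<in> K y then c i else 0)" for i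
  define \<mu>' where "\<mu>' i = (if i \<in> I y then \<mu> i else 0)" for i
  have "(\<Sum>i\<in>K z. c' i) = (\<Sum>i\<in>K y. c i)" "(\<Sum>i\<in>K z. c' i *\<^sub>R a i) = (\<Sum>i\<in>K y. c i *\<^sub>R a i)"
      "(\<Sum>i\<in>I z. \<mu>' i *\<^sub>R d i) = (\<Sum>i\<in>I y. \<mu> i *\<^sub>R d i)"
    using assms(3,4) unfolding c'_def \<mu>'_def
    by (intro sum.mono_neutral_cong_right; simp; blast)+
  with r have "multiplier_rep a d (K z) (I z) v c' \<mu>'"
    by (simp add: multiplier_rep_def c'_def \<mu>'_def)
  with assms(1) subdifferential_rep show "v \<in> subdifferential \<theta> z" by blast
qed

text \<open>Only finitely many polyhedra occur as subdifferentials near \<open>z\<close>, and all of them are closed.\<close>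

lemma subdifferential_stable:
  assumes z: "z \<in> D"
  shows "\<exists>\<rho>>0. \<forall>y\<in>ball z \<rho>. \<forall>v\<in>subdifferential \<theta> y. norm (v - v0) < \<rho> \<longrightarrow> v0 \<in> subdifferential \<theta> y"
proof -
  define P where "P A B = {v. \<exists>c \<mu>. multiplier_rep a d A B v c \<mu>}" for A B
  have sub: "subdifferential \<theta> y = P (K y) (I y)" if "y \<in> D" for y
    using subdifferential_rep[OF that] by (auto simp: P_def)
  \<comment> \<open>One radius per pair of active sets: these sets determine the subdifferential, so
    either \<open>v0\<close> has positive distance from that closed set, or it belongs to every such
    subdifferential and any radius will do.\<close>
  have ex: "\<exists>\<rho>>0. \<forall>y\<in>D. K y = A \<longrightarrow> I y = B \<longrightarrow> (\<forall>v\<in>subdifferential \<theta> y. norm (v - v0) < \<rho> \<longrightarrow> v0 \<in> subdifferential \<theta> y)" for A B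
  proof (cases "\<exists>y\<in>D. K y = A \<and> I y = B \<and> v0 \<notin> subdifferential \<theta> y")
    case True
    then obtain y where y: "y \<in> D" "K y = A" "I y = B" "v0 \<notin> subdifferential \<theta> y" by blast
    have "open (- subdifferential \<theta> y)" using closed_subdifferential by (simp add: open_Compl)
    then obtain \<rho> where \<rho>: "\<rho> > 0" "ball v0 \<rho> \<subseteq> - subdifferential \<theta> y"
      using y(4) by (meson ComplI open_contains_ball)
    have "v0 \<in> subdifferential \<theta> y'"
      if "y' \<in> D" "K y' = A" "I y' = B" "v \<in> subdifferential \<theta> y'" "norm (v - v0) < \<rho>" for y' v
    proof -
      have "subdifferential \<theta> y' = subdifferential \<theta> y" using that y sub by metis
      moreover have "v \<in> ball v0 \<rho>" using that(5) by (simp add: dist_norm norm_minus_commute)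
      ultimately show ?thesis using that(4) \<rho>(2) by blast
    qed
    with \<rho>(1) show ?thesis by blast
  next
    case False
    with zero_less_one[where 'a = real] show ?thesis by blast
  qed
  define R where "R A B = (SOME \<rho>. \<rho> > 0 \<and> (\<forall>y\<in>D. K y = A \<longrightarrow> I y = B \<longrightarrow> (\<forall>v\<in>subdifferential \<theta> y. norm (v - v0) < \<rho> \<longrightarrow> v0 \<in> subdifferential \<theta> y)))" for A B
  have R: "R A B > 0 \<and> (\<forall>y\<in>D. K y = A \<longrightarrow> I y = B \<longrightarrow> (\<forall>v\<in>subdifferential \<theta> y. norm (v - v0) < R A B \<longrightarrow> v0 \<in> subdifferential \<theta> y))" for A B
    unfolding R_def by (rule someI_ex) (use ex[of A B] in blast)
  define \<rho> where "\<rho> = Min ((\<lambda>(A, B). R A B) ` (Pow {1..l} \<times> Pow {1..p}))"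
  have fin: "finite ((\<lambda>(A, B). R A B) ` (Pow {1..l} \<times> Pow {1..p}))" by simp
  have "\<rho> > 0" unfolding \<rho>_def using R by (subst Min_gr_iff) auto
  moreover have "v0 \<in> subdifferential \<theta> y" if "v \<in> subdifferential \<theta> y" "norm (v - v0) < \<rho>" for y v
  proof -
    have y: "y \<in> D" using that by (simp add: subdifferential_iff)
    have "(K y, I y) \<in> Pow {1..l} \<times> Pow {1..p}" by (auto simp: K_iff I_iff)
    then have "\<rho> \<le> R (K y) (I y)" unfolding \<rho>_def by (intro Min_le[OF fin]) force
    then have "norm (v - v0) < R (K y) (I y)" using that(2) by linarith
    with R[of "K y" "I y"] that(1) y show ?thesis by blast
  qed
  ultimately show ?thesis by blast
qed

text \<open>The chain rule is exact by polyhedrality: \<open>h \<mapsto> \<theta> (z + J h)\<close>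
  is again convex piecewise linear, with data pulled back by the adjoint, and a representation of
  \<open>v\<close> over these data is carried back to the original data with the same
  coefficients.\<close>

lemma subdifferential_chain:
  fixes J :: "'x::euclidean_space \<Rightarrow> 'm"
  assumes z: "z \<in> D" and J: "linear J"
    and v: "\<And>h. z + J h \<in> D \<Longrightarrow> m z + v \<bullet> h \<le> m (z + J h)"
  shows "\<exists>y\<in>subdifferential \<theta> z. v = adjoint J y"
proof -
  define \<theta>' where "\<theta>' h = \<theta> (z + J h)" for h
  define a' where "a' i = adjoint J (a i)" for i
  define d' where "d' i = adjoint J (d i)" for i
  define \<alpha>' where "\<alpha>' i = \<alpha> i - a i \<bullet> z" for i
  define \<beta>' where "\<beta>' i = \<beta> i - d i \<bullet> z" for i
  have inn: "a' i \<bullet> h - \<alpha>' i = a i \<bullet> (z + J h) - \<alpha> i" "d' i \<bullet> h \<le> \<beta>' i \<longleftrightarrow> d i \<bullet> (z + J h) \<le> \<beta> i"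
      "d' i \<bullet> h = \<beta>' i \<longleftrightarrow> d i \<bullet> (z + J h) = \<beta> i" for i h
    by (auto simp: a'_def d'_def \<alpha>'_def \<beta>'_def adjoint_clauses[OF J] inner_add_right)
  have J0: "J 0 = 0" using J by (rule linear_0)
  have dom: "edom \<theta>' = {h. z + J h \<in> D}" by (simp add: edom_def \<theta>'_def)
  have rep': "cpwl_rep \<theta>' l a' \<alpha>' p d' \<beta>'"
    unfolding cpwl_rep_def inn
  proof (intro conjI allI l_pos)
    show "edom \<theta>' = {h. \<forall>i\<in>{1..p}. d i \<bullet> (z + J h) \<le> \<beta> i}" unfolding dom mem_D ..
    have "0 \<in> edom \<theta>'" using z J0 by (simp add: dom)
    then show "edom \<theta>' \<noteq> {}" by blast
    show "\<theta>' h = (if h \<in> edom \<theta>' then ereal (MAX i\<in>{1..l}. a i \<bullet> (z + J h) - \<alpha> i) else \<infinity>)" for h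
      using theta_eq theta_infty unfolding dom m_def[symmetric] by (auto simp: \<theta>'_def)
  qed
  interpret c: cpwl \<theta>' l a' \<alpha>' p d' \<beta>' by unfold_locales (rule rep')
  have m': "c.m h = m (z + J h)" for h by (simp add: c.m_def m_def inn)
  have act: "c.K 0 = K z" "c.I 0 = I z"
    unfolding active_K_def active_I_def inn J0 by simp_all
  have "v \<in> subdifferential \<theta>' 0"
    using z v by (simp add: c.subdifferential_iff m' dom J0)
  then obtain c \<mu> where cm: "multiplier_rep a' d' (K z) (I z) v c \<mu>"
    using c.subdifferential_rep[of 0 v] z J0 act by (auto simp: dom)
  let ?l = "(\<Sum>i\<in>K z. c i *\<^sub>R a i) + (\<Sum>i\<in>I z. \<mu> i *\<^sub>R d i)"
  have "multiplier_rep a d (K z) (I z) ?l c \<mu>" using cm by (simp add: multiplier_rep_def)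
  then have "?l \<in> subdifferential \<theta> z" using subdifferential_rep[OF z] by blast
  moreover have "v = adjoint J ?l"
    using cm adjoint_linear[OF J]
    by (simp add: multiplier_rep_def a'_def d'_def linear_add linear_sum linear_scale o_def)
  ultimately show ?thesis by blast
qed

end

section \<open>The critical cone, its span, and the directions along which \<theta> is locally
  constant\<close>

locale cpwl_point = cpwl \<theta> l a \<alpha> p d \<beta>
  for \<theta> :: "'m::euclidean_space \<Rightarrow> ereal" and l a \<alpha> p d \<beta> +
  fixes zb lamb :: 'm
  assumes zb: "zb \<in> D" and lamb: "lamb \<in> subdifferential \<theta> zb"
    and aff0: "0 \<in> affine hull (subdifferential \<theta> zb)"
begin

definition S0 :: "'m set" where "S0 = affine hull (subdifferential \<theta> zb)"
text \<open>The critical cone in the form of \<open>crit_cone_eq\<close>: it refers to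
  \<open>lamb\<close> itself and hence not to the weights that represent it.\<close>

definition G :: "'m set" where
  "G = {u. (\<forall>i\<in>K zb. a i \<bullet> u \<le> lamb \<bullet> u) \<and> (\<forall>t\<in>I zb. d t \<bullet> u \<le> 0)}"
text \<open>The linear span of \<open>G\<close>, in the form in which it enters the SSOSC.\<close>

definition N :: "'m set" where
  "N = {y. (\<forall>i\<in>K zb. (\<forall>u\<in>G. a i \<bullet> u = lamb \<bullet> u) \<longrightarrow> a i \<bullet> y = lamb \<bullet> y) \<and>
           (\<forall>t\<in>I zb. (\<forall>u\<in>G. d t \<bullet> u = 0) \<longrightarrow> d t \<bullet> y = 0)}"
abbreviation S1 :: "'m set" where "S1 \<equiv> orthogonal_comp S0"

lemma S1_iff: "q \<in> S1 \<longleftrightarrow> (\<forall>s\<in>S0. s \<bullet> q = 0)"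
  by (simp add: orthogonal_comp_def orthogonal_def)

lemma subspace_S0: "subspace S0"
  using aff0 by (simp add: S0_def subspace_affine affine_affine_hull)

lemma subdifferential_subset_S0: "subdifferential \<theta> zb \<subseteq> S0"
  by (simp add: S0_def hull_subset)

lemma parallel_subspace_eq: "parallel_subspace S0 = S0"
proof -
  have "affine S0" "S0 \<noteq> {}" using aff0 by (auto simp: S0_def affine_affine_hull)
  from affine_parallel_subspace[OF this] show ?thesis
    unfolding parallel_subspace_def
    by (rule the1_equality) (auto simp: subspace_S0 affine_parallel_def intro: exI[of _ 0])
qed

lemma lamb_S0: "lamb \<in> S0"
  using lamb subdifferential_subset_S0 by blast

lemma a_S0: "i \<in> K zb \<Longrightarrow> a i \<in> S0"
  using a_in_subdifferential[OF zb] subdifferential_subset_S0 by blast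

text \<open>Both \<open>lamb\<close> and \<open>lamb + d t\<close> are subgradients, and the
  subspace \<open>S0\<close> is closed under differences.\<close>

lemma d_S0: "t \<in> I zb \<Longrightarrow> d t \<in> S0"
  using add_d_in_subdifferential[OF lamb] subdifferential_subset_S0 lamb_S0
    subspace_diff[OF subspace_S0, of "lamb + d t" lamb] by auto

text \<open>Near \<open>zb\<close> only pieces and constraints active at \<open>zb\<close> matter,
  and their gradients lie in \<open>S0\<close>, so a move in \<open>S1\<close> changes none of
  them.\<close>

lemma theta_S1_invariant:
  "\<exists>\<rho>>0. \<forall>z\<in>ball zb \<rho>. \<forall>z'\<in>ball zb \<rho>. z' - z \<in> S1 \<longrightarrow> (z \<in> D \<longrightarrow> z' \<in> D) \<and> m z' = m z"
proof -
  obtain \<rho> where \<rho>: "\<rho> > 0" and A: "\<And>y. y \<in> ball zb \<rho> \<Longrightarrow> K y \<subseteq> K zb"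
      "\<And>y. y \<in> ball zb \<rho> \<Longrightarrow> y \<in> D \<longleftrightarrow> (\<forall>t\<in>I zb. d t \<bullet> (y - zb) \<le> 0)"
    using active_mono[OF zb] by metis
  have le: "m z \<le> m z'" if z: "z \<in> ball zb \<rho>" and "z' - z \<in> S1" for z z'
  proof -
    obtain i where i: "i \<in> K z" by (rule K_nonempty)
    then have "a i \<bullet> (z' - z) = 0" using A(1)[OF z] a_S0 that by (auto simp: S1_iff)
    with i m_ge[of i z'] show ?thesis by (simp add: K_iff inner_diff_right)
  qed
  have "z' \<in> D \<and> m z' = m z" if z: "z \<in> ball zb \<rho>" "z' \<in> ball zb \<rho>" "z' - z \<in> S1" and "z \<in> D" for z z'
  proof
    have "d t \<bullet> (z' - zb) = d t \<bullet> (z - zb)" if "t \<in> I zb" for t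
      using z(3) d_S0[OF that] by (simp add: S1_iff inner_diff_right)
    then show "z' \<in> D" using A(2) z \<open>z \<in> D\<close> by simp
  qed (use le z subspace_neg[OF subspace_orthogonal_comp z(3)] in \<open>force intro!: antisym\<close>)
  moreover have "m z' = m z" if z: "z \<in> ball zb \<rho>" "z' \<in> ball zb \<rho>" "z' - z \<in> S1" for z z'
    using le[of z z'] le[of z' z] z subspace_neg[OF subspace_orthogonal_comp z(3)] by simp
  ultimately show ?thesis using \<rho> by blast
qed

text \<open>A subgradient common to \<open>zb\<close> and \<open>z\<close> makes both subgradient
  inequalities equalities. The pieces active at \<open>zb\<close> start at the value of \<theta> and
  cannot exceed it at \<open>z\<close>, which gives the inequalities that define
  \<open>G\<close>.\<close>

lemma G_of_subdifferential:
  assumes "lamb \<in> subdifferential \<theta> z"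
  shows "z - zb \<in> G" and "m z = m zb + lamb \<bullet> (z - zb)"
proof -
  have z: "z \<in> D" "m z + lamb \<bullet> (zb - z) \<le> m zb" "m zb + lamb \<bullet> (z - zb) \<le> m z"
    using assms lamb zb by (auto simp: subdifferential_iff)
  then show eq: "m z = m zb + lamb \<bullet> (z - zb)" by (simp add: inner_diff_right)
  have "a i \<bullet> (z - zb) \<le> lamb \<bullet> (z - zb)" if "i \<in> K zb" for i
    using m_ge[of i z] that eq by (simp add: K_iff inner_diff_right)
  moreover have "d t \<bullet> (z - zb) \<le> 0" if "t \<in> I zb" for t
    using z(1) that by (auto simp: I_iff mem_D inner_diff_right)
  ultimately show "z - zb \<in> G" by (simp add: G_def)
qed

text \<open>A local converse: for a small step into \<open>G\<close> no active piece rises faster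
  than the affine minorant with slope \<open>lamb\<close> at \<open>zb\<close>, so this minorant
  also touches \<theta> at \<open>z\<close>.\<close>

lemma subdifferential_of_G:
  "\<exists>\<rho>>0. \<forall>z\<in>ball zb \<rho>. z - zb \<in> G \<longrightarrow> lamb \<in> subdifferential \<theta> z"
proof -
  obtain \<rho> where \<rho>: "\<rho> > 0" and A: "\<And>y. y \<in> ball zb \<rho> \<Longrightarrow> K y \<subseteq> K zb"
      "\<And>y. y \<in> ball zb \<rho> \<Longrightarrow> y \<in> D \<longleftrightarrow> (\<forall>t\<in>I zb. d t \<bullet> (y - zb) \<le> 0)"
    using active_mono[OF zb] by metis
  have "lamb \<in> subdifferential \<theta> z" if z: "z \<in> ball zb \<rho>" "z - zb \<in> G" for z
  proof -
    have D: "z \<in> D" using A(2)[OF z(1)] z(2) by (simp add: G_def)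
    obtain i where i: "i \<in> K z" by (rule K_nonempty)
    then have "a i \<bullet> (z - zb) \<le> lamb \<bullet> (z - zb)" using A(1)[OF z(1)] z(2) by (auto simp: G_def)
    moreover have "a i \<bullet> zb - \<alpha> i \<le> m zb" using i m_ge by (simp add: K_iff)
    ultimately have "m z \<le> m zb + lamb \<bullet> (z - zb)" using i by (simp add: K_iff inner_diff_right)
    moreover have "m zb + lamb \<bullet> (y - zb) \<le> m y" if "y \<in> D" for y
      using lamb that by (simp add: subdifferential_iff)
    ultimately have "m z + lamb \<bullet> (y - z) \<le> m y" if "y \<in> D" for y
      using that by (force simp: inner_diff_right)
    then show ?thesis using D by (simp add: subdifferential_iff)
  qed
  with \<rho> show ?thesis by blast
qed

lemma subdifferential_near:
  "\<exists>\<rho>>0. \<forall>z\<in>ball zb \<rho>. subdifferential \<theta> z \<subseteq> subdifferential \<theta> zb \<and>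
      (\<forall>v\<in>subdifferential \<theta> z. norm (v - lamb) < \<rho> \<longrightarrow> lamb \<in> subdifferential \<theta> z)"
proof -
  obtain \<rho>1 where 1: "\<rho>1 > 0" "\<forall>y\<in>ball zb \<rho>1. K y \<subseteq> K zb \<and> I y \<subseteq> I zb"
    using active_mono[OF zb] by metis
  obtain \<rho>2 where 2: "\<rho>2 > 0" "\<forall>y\<in>ball zb \<rho>2. \<forall>v\<in>subdifferential \<theta> y. norm (v - lamb) < \<rho>2 \<longrightarrow> lamb \<in> subdifferential \<theta> y"
    using subdifferential_stable[OF zb] by metis
  have "subdifferential \<theta> z \<subseteq> subdifferential \<theta> zb" if "z \<in> ball zb \<rho>1" for z
    using subdifferential_mono[OF zb, of z] 1(2) that by (cases "z \<in> D") (auto simp: subdifferential_iff)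
  with 1(1) 2 show ?thesis by (intro exI[of _ "min \<rho>1 \<rho>2"]) auto
qed

lemma subspace_N: "subspace N"
  by (auto simp: subspace_def N_def inner_add_right)

lemma G_subset_N: "G \<subseteq> N"
  by (auto simp: N_def)

lemma S1_orth: "q \<in> S1 \<Longrightarrow> i \<in> K zb \<Longrightarrow> a i \<bullet> q = 0" "q \<in> S1 \<Longrightarrow> t \<in> I zb \<Longrightarrow> d t \<bullet> q = 0"
  "q \<in> S1 \<Longrightarrow> lamb \<bullet> q = 0"
  using a_S0 d_S0 lamb_S0 by (auto simp: S1_iff)

lemma G_add_S1: "u \<in> G \<Longrightarrow> q \<in> S1 \<Longrightarrow> u + q \<in> G"
  by (auto simp: G_def inner_add_right S1_orth)

lemma S1_subset_N: "S1 \<subseteq> N"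
  by (auto simp: N_def S1_orth)

lemma G_scale: "u \<in> G \<Longrightarrow> 0 \<le> t \<Longrightarrow> t *\<^sub>R u \<in> G"
  by (auto simp: G_def mult_nonneg_nonpos mult_left_mono)

lemma G_add: "u \<in> G \<Longrightarrow> v \<in> G \<Longrightarrow> u + v \<in> G"
  by (auto simp: G_def inner_add_right add_mono add_nonpos_nonpos)

lemma zero_G: "0 \<in> G"
  by (simp add: G_def)

lemma G_sum: "finite A \<Longrightarrow> (\<And>i. i \<in> A \<Longrightarrow> f i \<in> G) \<Longrightarrow> sum f A \<in> G"
  by (induction A rule: finite_induct) (auto simp: zero_G G_add)

text \<open>The point \<open>g\<close> is relatively interior to \<open>G\<close>. It makes every
  direction of \<open>N\<close> a positive multiple of a difference of two elements of
  \<open>G\<close>, which is how the SSOSC is later tested on the whole span.\<close>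

lemma G_relative_interior:
  "\<exists>g\<in>G. \<forall>y\<in>N. \<exists>e>0. g + e *\<^sub>R y \<in> G"
proof -
  define P where "P = {i\<in>K zb. \<exists>u\<in>G. a i \<bullet> u < lamb \<bullet> u}"
  define Q where "Q = {t\<in>I zb. \<exists>u\<in>G. d t \<bullet> u < 0}"
  have "\<forall>i\<in>P. \<exists>u. u \<in> G \<and> a i \<bullet> u < lamb \<bullet> u" by (auto simp: P_def)
  then obtain f where f: "\<And>i. i \<in> P \<Longrightarrow> f i \<in> G \<and> a i \<bullet> f i < lamb \<bullet> f i" by metis
  have "\<forall>t\<in>Q. \<exists>u. u \<in> G \<and> d t \<bullet> u < 0" by (auto simp: Q_def)
  then obtain h where h: "\<And>t. t \<in> Q \<Longrightarrow> h t \<in> G \<and> d t \<bullet> h t < 0" by metis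
  have fin: "finite P" "finite Q" by (simp_all add: P_def Q_def)
  \<comment> \<open>One summand for each inequality that is strict somewhere on \<open>G\<close>.
    The other summands satisfy that inequality weakly, so the sum satisfies all of these
    inequalities strictly at once.\<close>
  define g where "g = sum f P + sum h Q"
  have gG: "g \<in> G" unfolding g_def using f h fin by (intro G_add G_sum) auto
  have strict1: "a i \<bullet> g < lamb \<bullet> g" if "i \<in> P" for i
  proof -
    have "g = f i + (sum f (P - {i}) + sum h Q)" unfolding g_def using that fin by (simp add: sum.remove add.assoc)
    moreover have "sum f (P - {i}) + sum h Q \<in> G" using f h fin by (intro G_add G_sum) auto
    ultimately show ?thesis using f[OF that] that by (auto simp: G_def P_def inner_add_right add_less_le_mono)
  qed
  have strict2: "d t \<bullet> g < 0" if "t \<in> Q" for t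
  proof -
    have "g = h t + (sum f P + sum h (Q - {t}))" unfolding g_def using that fin by (simp add: sum.remove algebra_simps)
    moreover have "sum f P + sum h (Q - {t}) \<in> G" using f h fin by (intro G_add G_sum) auto
    ultimately show ?thesis using h[OF that] that by (auto simp: G_def Q_def inner_add_right add_neg_nonpos)
  qed
  have "\<exists>e>0. g + e *\<^sub>R y \<in> G" if y: "y \<in> N" for y
  proof -
    have pos: "\<forall>\<^sub>F e in at_right (0::real). 0 < e" by (rule eventually_at_right_less)
    have 1: "\<forall>\<^sub>F e in at_right (0::real). a i \<bullet> (g + e *\<^sub>R y) \<le> lamb \<bullet> (g + e *\<^sub>R y)" if i: "i \<in> K zb" for i
    proof (cases "i \<in> P")
      case True
      have "((\<lambda>e. a i \<bullet> (g + e *\<^sub>R y) - lamb \<bullet> (g + e *\<^sub>R y)) \<longlongrightarrow> a i \<bullet> (g + 0 *\<^sub>R y) - lamb \<bullet> (g + 0 *\<^sub>R y)) (at_right 0)"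
        by (intro tendsto_intros)
      then have "\<forall>\<^sub>F e in at_right (0::real). a i \<bullet> (g + e *\<^sub>R y) - lamb \<bullet> (g + e *\<^sub>R y) < 0"
        by (rule order_tendstoD(2)) (use strict1[OF True] in simp)
      then show ?thesis by eventually_elim simp
    next
      case False
      then have "\<forall>u\<in>G. a i \<bullet> u = lamb \<bullet> u" using i by (force simp: P_def G_def)
      then have "a i \<bullet> y = lamb \<bullet> y" "a i \<bullet> g = lamb \<bullet> g" using y i gG by (auto simp: N_def)
      then show ?thesis by (simp add: inner_add_right)
    qed
    have 2: "\<forall>\<^sub>F e in at_right (0::real). d t \<bullet> (g + e *\<^sub>R y) \<le> 0" if t: "t \<in> I zb" for t
    proof (cases "t \<in> Q")
      case True
      have "((\<lambda>e. d t \<bullet> (g + e *\<^sub>R y)) \<longlongrightarrow> d t \<bullet> (g + 0 *\<^sub>R y)) (at_right 0)"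
        by (intro tendsto_intros)
      then have "\<forall>\<^sub>F e in at_right (0::real). d t \<bullet> (g + e *\<^sub>R y) < 0"
        by (rule order_tendstoD(2)) (use strict2[OF True] in simp)
      then show ?thesis by eventually_elim simp
    next
      case False
      then have "\<forall>u\<in>G. d t \<bullet> u = 0" using t by (force simp: Q_def G_def)
      then have "d t \<bullet> y = 0" "d t \<bullet> g = 0" using y t gG by (auto simp: N_def)
      then show ?thesis by (simp add: inner_add_right)
    qed
    have "\<forall>\<^sub>F e in at_right (0::real). 0 < e \<and> (\<forall>i\<in>K zb. a i \<bullet> (g + e *\<^sub>R y) \<le> lamb \<bullet> (g + e *\<^sub>R y))
        \<and> (\<forall>t\<in>I zb. d t \<bullet> (g + e *\<^sub>R y) \<le> 0)"
      using pos 1 2 by (intro eventually_conj eventually_ball_finite) auto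
    from eventually_happens'[OF trivial_limit_at_right_real this] show ?thesis
      unfolding G_def mem_Collect_eq by blast
  qed
  with gG show ?thesis by blast
qed

text \<open>The SSOSC asks the values \<open>a i \<bullet> y\<close> over \<open>Gamma1\<close> to
  agree with each other, \<open>N\<close> asks them to agree with \<open>lamb \<bullet> y\<close>.
  These are the same: the weights of \<open>lamb\<close> live on \<open>J1\<close> and
  \<open>J2\<close>, which lie inside \<open>Gamma1\<close> and \<open>Gamma2\<close>, so
  \<open>lamb \<bullet> y\<close> averages equal numbers.\<close>

lemma crit_subspace_eq:
  assumes r: "multiplier_rep a d (K zb) (I zb) lamb c \<mu>"
  shows "crit_subspace a d (K zb) (I zb) c \<mu> A = {u. A u \<in> N}"
proof -
  have fin: "finite (K zb)" "finite (I zb)" by simp_all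
  define J1 where "J1 = {i\<in>K zb. 0 < c i}"
  define J2 where "J2 = {i\<in>I zb. 0 < \<mu> i}"
  have G: "crit_cone a d (K zb) (I zb) J1 J2 = G"
    unfolding J1_def J2_def using crit_cone_eq[OF fin r] by (simp add: G_def)
  have G1: "Gamma1 a (K zb) J1 G = {i\<in>K zb. \<forall>u\<in>G. a i \<bullet> u = lamb \<bullet> u}"
    unfolding J1_def by (rule Gamma1_eq[OF fin r]) (use G J1_def J2_def in simp)
  have G2: "Gamma2 d (I zb) G = {t\<in>I zb. \<forall>u\<in>G. d t \<bullet> u = 0}" by (simp add: Gamma2_def)
  have J1: "J1 \<subseteq> Gamma1 a (K zb) J1 G"
  proof
    fix i assume i: "i \<in> J1"
    then have "lamb \<bullet> u = a i \<bullet> u" if "u \<in> G" for u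
      using crit_cone_inner[OF fin r, of u i] that unfolding G[symmetric] J1_def J2_def by simp
    with i show "i \<in> Gamma1 a (K zb) J1 G" unfolding G1 by (simp add: J1_def)
  qed
  have J2: "J2 \<subseteq> Gamma2 d (I zb) G"
    unfolding G2 using G by (auto simp: J2_def crit_cone_def)
  have key: "a i \<bullet> y = lamb \<bullet> y"
    if y: "\<forall>i\<in>Gamma1 a (K zb) J1 G. \<forall>j\<in>Gamma1 a (K zb) J1 G. (a i - a j) \<bullet> y = 0"
      "\<forall>t\<in>Gamma2 d (I zb) G. d t \<bullet> y = 0" and i: "i \<in> Gamma1 a (K zb) J1 G" for i y
  proof -
    have c: "\<And>i. i \<in> K zb \<Longrightarrow> 0 \<le> c i" "(\<Sum>i\<in>K zb. c i) = 1" "\<And>t. t \<in> I zb \<Longrightarrow> 0 \<le> \<mu> t"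
      using r by (auto simp: multiplier_rep_def)
    have 1: "c j * (a j \<bullet> y) = c j * (a i \<bullet> y)" if "j \<in> K zb" for j
    proof (cases "j \<in> J1")
      case True
      then have "(a j - a i) \<bullet> y = 0" using y(1) J1 i by blast
      then show ?thesis by (simp add: inner_diff_left)
    next
      case False
      then show ?thesis using that c(1)[OF that] by (simp add: J1_def)
    qed
    have 2: "\<mu> t * (d t \<bullet> y) = 0" if "t \<in> I zb" for t
      using y(2) J2 c(3)[OF that] that by (cases "t \<in> J2") (auto simp: J2_def)
    have "(\<Sum>j\<in>K zb. c j * (a j \<bullet> y)) = (\<Sum>j\<in>K zb. c j) * (a i \<bullet> y)"
      unfolding sum_distrib_right by (rule sum.cong[OF refl 1])
    then show ?thesis using multiplier_rep_inner[OF r, of y] 2 c(2) by simp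
  qed
  have "(\<forall>i\<in>Gamma1 a (K zb) J1 G. \<forall>j\<in>Gamma1 a (K zb) J1 G. (a i - a j) \<bullet> y = 0) \<and>
        (\<forall>t\<in>Gamma2 d (I zb) G. d t \<bullet> y = 0) \<longleftrightarrow> y \<in> N" (is "?L \<longleftrightarrow> _") for y
  proof
    assume "?L"
    then show "y \<in> N" using key[of y] unfolding N_def G1 G2 by blast
  next
    assume "y \<in> N"
    then show "?L" unfolding N_def G1 G2 by (auto simp: inner_diff_left)
  qed
  then show ?thesis
    unfolding crit_subspace_def Let_def J1_def[symmetric] J2_def[symmetric] G by blast
qed

end

section \<open>Metric regularity under nondegeneracy\<close>

lemma orthogonal_projection_exists:
  fixes S :: "'a::euclidean_space set"
  assumes "subspace S"
  obtains P where "linear P" "\<And>y. P y \<in> S" "\<And>y. y - P y \<in> orthogonal_comp S" "\<And>y. norm (P y) \<le> norm y"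
proof -
  obtain B where B: "B \<subseteq> S" "pairwise orthogonal B" "\<And>x. x \<in> B \<Longrightarrow> norm x = 1"
      "independent B" "span B = S"
    using orthonormal_basis_subspace[OF assms] by metis
  have fin: "finite B" using B(4) by (rule independent_imp_finite)
  define P where "P y = (\<Sum>b\<in>B. (y \<bullet> b) *\<^sub>R b)" for y
  have "linear P"
    unfolding P_def by (rule linearI) (simp_all add: inner_add_left scaleR_left_distrib sum.distrib scaleR_sum_right)
  moreover have PS: "P y \<in> S" for y
    unfolding P_def using B(1) assms by (intro subspace_sum subspace_scale) auto
  moreover have orth: "y - P y \<in> orthogonal_comp S" for y
  proof -
    have "c \<bullet> P y = y \<bullet> c" if c: "c \<in> B" for c
    proof -
      have "c \<bullet> P y = (\<Sum>b\<in>B. (y \<bullet> b) * (c \<bullet> b))" by (simp add: P_def inner_sum_right)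
      also have "\<dots> = (\<Sum>b\<in>B. if b = c then y \<bullet> c else 0)"
      proof (rule sum.cong[OF refl])
        fix b assume "b \<in> B"
        then show "(y \<bullet> b) * (c \<bullet> b) = (if b = c then y \<bullet> c else 0)"
          using B(2,3) c by (auto simp: pairwise_def orthogonal_def norm_eq_1)
      qed
      finally show ?thesis using c fin by simp
    qed
    then have "orthogonal (y - P y) c" if "c \<in> B" for c
      using that by (simp add: orthogonal_def inner_diff_left inner_diff_right inner_commute)
    then have "orthogonal (y - P y) s" if "s \<in> span B" for s
      using orthogonal_to_span[OF that] by blast
    then show ?thesis using B(5) by (simp add: orthogonal_comp_def orthogonal_commute)
  qed
  moreover have "norm (P y) \<le> norm y" for y
  proof -
    have "P y \<bullet> (y - P y) = 0" using orth[of y] PS[of y] by (simp add: orthogonal_comp_def orthogonal_def)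
    then have "norm (P y) * norm (P y) \<le> norm (P y) * norm y"
      using norm_cauchy_schwarz[of "P y" y]
      by (simp add: inner_diff_right power2_norm_eq_inner flip: power2_eq_square)
    then show ?thesis by (cases "P y = 0") auto
  qed
  ultimately show thesis using that by blast
qed

text \<open>Strict differentiability in the first variable combined with a mere Lipschitz bound in
  the parameter. The constant \<open>C\<close> is fixed before \<open>e\<close>, so sharpening the
  estimate in the first variable does not worsen the dependence on the parameter.\<close>

definition strict_partial :: "('x::real_normed_vector \<times> 'w::real_normed_vector \<Rightarrow> 'y::real_normed_vector)
    \<Rightarrow> ('x \<Rightarrow> 'y) \<Rightarrow> 'x \<times> 'w \<Rightarrow> bool" where
  "strict_partial f A q0 \<longleftrightarrow> (\<exists>C\<ge>0. \<forall>e>0. \<exists>\<delta>>0. \<forall>q\<in>ball q0 \<delta>. \<forall>q'\<in>ball q0 \<delta>.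
     norm (f q - f q' - A (fst q - fst q')) \<le> e * norm (fst q - fst q') + C * norm (snd q - snd q'))"

text \<open>The consequences of smoothness on which the argument runs. \<open>H\<close> is the
  x-derivative of the Lagrangian gradient with the multiplier frozen at \<open>lamb\<close>; the
  effect of a varying multiplier is controlled through \<open>lip_J\<close>.\<close>

locale composite = cpwl_point \<theta> l a \<alpha> p d \<beta> zb lamb
  for \<theta> :: "'m::euclidean_space \<Rightarrow> ereal" and l a \<alpha> p d \<beta> zb lamb +
  fixes \<phi>0 :: "'x::euclidean_space \<times> 'w::euclidean_space \<Rightarrow> real" and \<Phi> :: "'x \<times> 'w \<Rightarrow> 'm"
    and xb :: 'x and wb :: 'w and Om :: "('x \<times> 'w) set"
    and g\<phi> :: "'x \<times> 'w \<Rightarrow> 'x" and J :: "'x \<times> 'w \<Rightarrow> 'x \<Rightarrow>\<^sub>L 'm" and H :: "'x \<Rightarrow> 'x" and vb :: 'x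
  assumes zb_eq: "zb = \<Phi> (xb, wb)" and open_Om: "open Om" and q0_Om: "(xb, wb) \<in> Om"
    and d\<phi>: "(x, w) \<in> Om \<Longrightarrow> ((\<lambda>x. \<phi>0 (x, w)) has_derivative (\<lambda>h. g\<phi> (x, w) \<bullet> h)) (at x)"
    and d\<Phi>: "(x, w) \<in> Om \<Longrightarrow> ((\<lambda>x. \<Phi> (x, w)) has_derivative J (x, w)) (at x)"
    and cont_\<phi>: "continuous_on Om \<phi>0" and cont_\<Phi>: "continuous_on Om \<Phi>" and cont_g: "continuous_on Om g\<phi>"
    and strict_\<Phi>: "strict_partial \<Phi> (J (xb, wb)) (xb, wb)"
    and linear_H: "linear H"
    and strict_L: "strict_partial (\<lambda>q. g\<phi> q + adjoint (J q) lamb) H (xb, wb)"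
    and lip_J: "\<exists>C. \<exists>\<delta>>0. \<forall>q\<in>ball (xb, wb) \<delta>. \<forall>q'\<in>ball (xb, wb) \<delta>. norm (J q - J q') \<le> C * norm (q - q')"
    and vb_eq: "vb = g\<phi> (xb, wb) + adjoint (J (xb, wb)) lamb"
begin

abbreviation q0 :: "'x \<times> 'w" where "q0 \<equiv> (xb, wb)"
abbreviation A :: "'x \<Rightarrow> 'm" where "A \<equiv> blinfun_apply (J q0)"
abbreviation Jt :: "'x \<times> 'w \<Rightarrow> 'm \<Rightarrow> 'x" where "Jt q \<equiv> adjoint (blinfun_apply (J q))"

definition kkt :: "'x \<Rightarrow> 'x \<times> 'w \<Rightarrow> 'm \<Rightarrow> bool" where
  "kkt v q y \<longleftrightarrow> y \<in> subdifferential \<theta> (\<Phi> q) \<and> v = g\<phi> q + Jt q y"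

text \<open>Real-valued even off the domain: \<open>m\<close> stands in for \<theta>, and
  feasibility \<open>\<Phi> q \<in> D\<close> is always carried as a separate condition.\<close>

definition obj :: "'x \<Rightarrow> 'x \<times> 'w \<Rightarrow> real" where
  "obj v q = \<phi>0 q + m (\<Phi> q) - v \<bullet> fst q"

lemma linear_J: "linear (blinfun_apply (J q))"
  by (simp add: blinfun.bounded_linear_right bounded_linear.linear)

lemma linear_Jt: "linear (Jt q)"
  using linear_J by (rule adjoint_linear)

lemma Jt_inner: "Jt q y \<bullet> h = y \<bullet> J q h" "h \<bullet> Jt q y = J q h \<bullet> y"
  using adjoint_clauses[OF linear_J] by auto

text \<open>\<open>adjoint\<close> returns a plain function without an operator norm, so the bound
  is obtained by testing the difference against itself.\<close>

lemma norm_Jt_diff: "norm (Jt q y - Jt q' y) \<le> norm (J q - J q') * norm y"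
proof -
  let ?u = "Jt q y - Jt q' y"
  have "?u \<bullet> h = y \<bullet> blinfun_apply (J q - J q') h" for h
    by (simp add: inner_diff_left Jt_inner(1) blinfun.diff_left inner_diff_right)
  then have "norm ?u * norm ?u = y \<bullet> blinfun_apply (J q - J q') ?u"
    by (metis power2_norm_eq_inner power2_eq_square)
  also have "\<dots> \<le> norm y * (norm (J q - J q') * norm ?u)"
    by (intro order_trans[OF norm_cauchy_schwarz] mult_left_mono norm_blinfun) auto
  finally show ?thesis by (cases "?u = 0") (auto simp: algebra_simps)
qed

lemma eventually_Om: "\<forall>\<^sub>F q in nhds q0. q \<in> Om"
  using open_Om q0_Om by (rule eventually_nhds_in_open)

lemma eventually_close:
  assumes "continuous_on Om f" "e > 0"
  shows "\<forall>\<^sub>F q in nhds q0. norm (f q - f q0) < e"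
proof -
  have "isCont f q0" using assms(1) open_Om q0_Om continuous_on_eq_continuous_at by blast
  then have "(f \<longlongrightarrow> f q0) (nhds q0)" unfolding continuous_at tendsto_at_iff_tendsto_nhds .
  from tendstoD[OF this assms(2)] show ?thesis by (simp add: dist_norm)
qed

lemma eventually_close_J:
  assumes "e > 0"
  shows "\<forall>\<^sub>F q in nhds q0. norm (J q - J q0) < e"
proof -
  obtain C \<delta> where C: "\<delta> > 0" "\<forall>q\<in>ball q0 \<delta>. \<forall>q'\<in>ball q0 \<delta>. norm (J q - J q') \<le> C * norm (q - q')"
    using lip_J by blast
  define r where "r = min \<delta> (e / (\<bar>C\<bar> + 1))"
  have r: "r > 0" using C(1) assms by (simp add: r_def)
  have "norm (J q - J q0) < e" if "dist q q0 < r" for q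
  proof -
    have "norm (J q - J q0) \<le> C * norm (q - q0)"
      using C that by (auto simp: r_def dist_commute)
    also have "\<dots> \<le> (\<bar>C\<bar> + 1) * norm (q - q0)" by (intro mult_right_mono) auto
    also have "\<dots> < (\<bar>C\<bar> + 1) * (e / (\<bar>C\<bar> + 1))"
      using that by (intro mult_strict_left_mono) (auto simp: r_def dist_norm)
    finally show ?thesis by (simp add: add_nonneg_eq_0_iff)
  qed
  then show ?thesis unfolding eventually_nhds_metric using r by blast
qed

lemma eventually_subdifferential:
  "\<exists>\<rho>>0. \<forall>\<^sub>F q in nhds q0. subdifferential \<theta> (\<Phi> q) \<subseteq> subdifferential \<theta> zb \<and>
      (\<forall>v\<in>subdifferential \<theta> (\<Phi> q). norm (v - lamb) < \<rho> \<longrightarrow> lamb \<in> subdifferential \<theta> (\<Phi> q))"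
proof -
  obtain \<rho> where \<rho>: "\<rho> > 0" and P: "\<forall>z\<in>ball zb \<rho>. subdifferential \<theta> z \<subseteq> subdifferential \<theta> zb \<and>
      (\<forall>v\<in>subdifferential \<theta> z. norm (v - lamb) < \<rho> \<longrightarrow> lamb \<in> subdifferential \<theta> z)"
    using subdifferential_near by blast
  have "\<forall>\<^sub>F q in nhds q0. \<Phi> q \<in> ball zb \<rho>"
    using eventually_close[OF cont_\<Phi> \<rho>] by eventually_elim (simp add: zb_eq dist_norm norm_minus_commute)
  then have "\<forall>\<^sub>F q in nhds q0. subdifferential \<theta> (\<Phi> q) \<subseteq> subdifferential \<theta> zb \<and>
      (\<forall>v\<in>subdifferential \<theta> (\<Phi> q). norm (v - lamb) < \<rho> \<longrightarrow> lamb \<in> subdifferential \<theta> (\<Phi> q))"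
    by eventually_elim (use P in blast)
  with \<rho> show ?thesis by blast
qed

end

locale composite_nd = composite +
  assumes nd: "s \<in> S0 \<Longrightarrow> Jt q0 s = 0 \<Longrightarrow> s = 0"
begin

text \<open>Nondegeneracy says that the projection of \<open>A\<close> onto \<open>S0\<close> is
  surjective: a vector of \<open>S0\<close> orthogonal to its range would be annihilated by
  \<open>Jt q0\<close>.\<close>

lemma right_inverse_exists:
  obtains T where "linear T" "\<And>y. A (T y) - y \<in> S1"
proof -
  obtain P where P: "linear P" "\<And>y. P y \<in> S0" "\<And>y. y - P y \<in> S1"
    using orthogonal_projection_exists[OF subspace_S0] by metis
  let ?f = "\<lambda>x. P (A x)"
  have lf: "linear ?f" using linear_compose[OF linear_J P(1)] by (simp add: o_def)
  have range: "range ?f = S0"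
  proof (rule ccontr)
    have sp: "subspace (range ?f)" by (rule linear_subspace_image[OF lf subspace_UNIV])
    assume "range ?f \<noteq> S0"
    then have "span (range ?f) \<subset> span S0"
      using P(2) sp subspace_S0 by (auto simp: span_eq_iff[THEN iffD2])
    then obtain s where s: "s \<noteq> 0" "s \<in> span S0" "\<And>y. y \<in> span (range ?f) \<Longrightarrow> orthogonal s y"
      by (rule orthogonal_to_subspace_exists_gen) blast
    have sS: "s \<in> S0" using s(2) subspace_S0 by (metis span_eq_iff)
    have "Jt q0 s \<bullet> h = 0" for h
    proof -
      have "s \<bullet> ?f h = 0" using s(3)[of "?f h"] by (simp add: orthogonal_def span_base)
      moreover have "s \<bullet> (A h - ?f h) = 0" using P(3)[of "A h"] sS by (simp add: S1_iff)
      ultimately show ?thesis by (simp add: Jt_inner inner_diff_right)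
    qed
    then have "Jt q0 s = 0" by (metis inner_eq_zero_iff)
    with nd sS s(1) show False by blast
  qed
  obtain g where g: "linear g" "\<forall>v\<in>range ?f. ?f (g v) = v"
    using linear_exists_right_inverse_on[OF lf subspace_UNIV] by blast
  show thesis
  proof
    show "linear (\<lambda>y. g (P y))" using linear_compose[OF P(1) g(1)] by (simp add: o_def)
    fix y
    have "P (A (g (P y))) = P y" using g(2) P(2) range by blast
    then have "A (g (P y)) - y = (A (g (P y)) - P (A (g (P y)))) - (y - P y)" by simp
    then show "A (g (P y)) - y \<in> S1"
      using subspace_diff[OF subspace_orthogonal_comp P(3) P(3)] by metis
  qed
qed

text \<open>Dual to the right inverse: up to \<open>S1\<close>, which is orthogonal to
  \<open>s\<close>, the vector \<open>A (T s)\<close> equals \<open>s\<close>, so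
  \<open>s \<bullet> s\<close> becomes \<open>Jt q0 s \<bullet> T s\<close>.\<close>

lemma Jt_injective_bound:
  "\<exists>C>0. \<forall>s\<in>S0. norm s \<le> C * norm (Jt q0 s)"
proof -
  obtain T where T: "linear T" "\<And>y. A (T y) - y \<in> S1" using right_inverse_exists by metis
  obtain B where B: "B > 0" "\<And>y. norm (T y) \<le> B * norm y" using linear_bounded_pos[OF T(1)] by blast
  have "norm s \<le> B * norm (Jt q0 s)" if s: "s \<in> S0" for s
  proof -
    have "s \<bullet> (A (T s) - s) = 0" using T(2) s by (simp add: S1_iff)
    then have "norm s * norm s = Jt q0 s \<bullet> T s"
      by (simp add: inner_diff_right Jt_inner power2_norm_eq_inner flip: power2_eq_square)
    also have "\<dots> \<le> norm (Jt q0 s) * (B * norm s)"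
      by (intro order_trans[OF norm_cauchy_schwarz] mult_left_mono B(2)) auto
    finally show ?thesis using B(1) by (cases "s = 0") (auto simp: algebra_simps)
  qed
  with B(1) show ?thesis by blast
qed

text \<open>A chord iteration \<open>s \<mapsto> s - P(\<Phi>(x0 + T s, w) - \<Phi>(x0, w) - u)\<close> with a right inverse \<open>T\<close> of \<open>P A\<close> contracts on
  a ball of \<open>S0\<close>.\<close>

lemma metric_regularity:
  "\<exists>C>0. \<exists>\<delta>>0. \<forall>x0\<in>ball xb \<delta>. \<forall>w\<in>ball wb \<delta>. \<forall>u. norm u < \<delta> \<longrightarrow>
     (\<exists>x. norm (x - x0) \<le> C * norm u \<and> \<Phi> (x, w) - \<Phi> (x0, w) - u \<in> S1)"
proof -
  obtain T where T: "linear T" "\<And>y. A (T y) - y \<in> S1" using right_inverse_exists by metis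
  obtain B where B: "B > 0" "\<And>y. norm (T y) \<le> B * norm y" using linear_bounded_pos[OF T(1)] by blast
  obtain P where P: "linear P" "\<And>y. P y \<in> S0" "\<And>y. y - P y \<in> S1" "\<And>y. norm (P y) \<le> norm y"
    using orthogonal_projection_exists[OF subspace_S0] by metis
  have P0: "P y = 0" if "y \<in> S1" for y
  proof -
    have "P y = y - (y - P y)" by simp
    then have "P y \<in> S1" using subspace_diff[OF subspace_orthogonal_comp that P(3)] by metis
    then have "P y \<bullet> P y = 0" using P(2)[of y] by (simp add: S1_iff)
    then show ?thesis by simp
  qed
  have PAT: "P (A (T s)) = s" if "s \<in> S0" for s
  proof -
    have "P (A (T s)) = P s" using P0[OF T(2), of s] P(1) by (simp add: linear_diff)
    moreover have "s - P s = 0"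
      using P(3)[of s] subspace_diff[OF subspace_S0 that P(2)] S1_iff inner_eq_zero_iff by blast
    ultimately show ?thesis by simp
  qed
  obtain CC where CC: "\<forall>e>0. \<exists>\<delta>>0. \<forall>q\<in>ball q0 \<delta>. \<forall>q'\<in>ball q0 \<delta>.
     norm (\<Phi> q - \<Phi> q' - A (fst q - fst q')) \<le> e * norm (fst q - fst q') + CC * norm (snd q - snd q')"
    using strict_\<Phi> unfolding strict_partial_def by blast
  \<comment> \<open>\<open>T\<close> has bound \<open>B\<close> and the projection has bound 1, so
    this accuracy gives the contraction factor 1/2.\<close>
  have e0: "1 / (2 * B) > 0" using B by simp
  from CC[rule_format, OF e0] obtain \<delta>0 where \<delta>0: "\<delta>0 > 0" and st: "\<forall>q\<in>ball q0 \<delta>0. \<forall>q'\<in>ball q0 \<delta>0.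
     norm (\<Phi> q - \<Phi> q' - A (fst q - fst q')) \<le> 1 / (2 * B) * norm (fst q - fst q') + CC * norm (snd q - snd q')"
    by blast
  \<comment> \<open>The deviations of \<open>x0\<close> and \<open>w\<close> and the step
    \<open>T s\<close> each use up at most a quarter of \<open>\<delta>0\<close>.\<close>
  define \<delta> where "\<delta> = min (\<delta>0 / 4) (\<delta>0 / (8 * B))"
  have \<delta>: "\<delta> > 0" using \<delta>0 B by (simp add: \<delta>_def)
  have "\<exists>x. norm (x - x0) \<le> 2 * B * norm u \<and> \<Phi> (x, w) - \<Phi> (x0, w) - u \<in> S1"
    if x0: "x0 \<in> ball xb \<delta>" and w: "w \<in> ball wb \<delta>" and u: "norm u < \<delta>" for x0 w u
  proof -
    \<comment> \<open>The iteration starts with \<open>F 0 = P u\<close>; with contraction factor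
      1/2 the ball of radius \<open>2 * norm u\<close> is mapped into itself.\<close>
    let ?X = "S0 \<inter> cball 0 (2 * norm u)"
    define F where "F s = s - P (\<Phi> (x0 + T s, w) - \<Phi> (x0, w) - u)" for s
    have Tb: "norm (T s) \<le> 2 * B * norm u" if "s \<in> ?X" for s
    proof -
      have "norm (T s) \<le> B * norm s" by (rule B(2))
      also have "\<dots> \<le> B * (2 * norm u)" using that B(1) by (intro mult_left_mono) auto
      finally show ?thesis by simp
    qed
    have inb: "(x0 + T s, w) \<in> ball q0 \<delta>0" if "s \<in> ?X" for s
    proof -
      have "2 * B * norm u \<le> 2 * B * \<delta>" using u B(1) by (intro mult_left_mono) auto
      also have "\<dots> \<le> 2 * B * (\<delta>0 / (8 * B))" using B(1) by (intro mult_left_mono) (auto simp: \<delta>_def)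
      also have "\<dots> = \<delta>0 / 4" using B(1) by simp
      finally have "norm (T s) \<le> \<delta>0 / 4" using Tb[OF that] by linarith
      moreover have "norm (x0 - xb) < \<delta>0 / 4" "norm (w - wb) < \<delta>0 / 4"
        using x0 w by (auto simp: \<delta>_def dist_norm norm_minus_commute)
      moreover have "norm ((x0 + T s, w) - q0) \<le> norm (x0 + T s - xb) + norm (w - wb)"
        by (simp add: norm_Pair_le)
      moreover have "norm (x0 + T s - xb) \<le> norm (x0 - xb) + norm (T s)"
        using norm_triangle_ineq[of "x0 - xb" "T s"] by (simp add: algebra_simps)
      ultimately have "norm ((x0 + T s, w) - q0) < \<delta>0" using \<delta>0 by linarith
      then show ?thesis unfolding mem_ball by (subst dist_commute) (simp only: dist_norm)
    qed
    have contr: "norm (F s - F s') \<le> 1/2 * norm (s - s')" if s: "s \<in> ?X" "s' \<in> ?X" for s s'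
    proof -
      have ss: "s - s' \<in> S0" using s subspace_diff[OF subspace_S0] by blast
      have "F s - F s' = (s - s') - P (\<Phi> (x0 + T s, w) - \<Phi> (x0 + T s', w))"
        unfolding F_def by (simp add: linear_diff[OF P(1)])
      also have "\<dots> = - P (\<Phi> (x0 + T s, w) - \<Phi> (x0 + T s', w) - A (T (s - s')))"
        using PAT[OF ss] by (simp add: linear_diff[OF P(1)])
      finally have "norm (F s - F s') \<le> norm (\<Phi> (x0 + T s, w) - \<Phi> (x0 + T s', w) - A (T (s - s')))"
        using P(4) by simp
      also have "\<dots> \<le> 1 / (2 * B) * norm (T (s - s'))"
        using st[rule_format, OF inb[OF s(1)] inb[OF s(2)]] by (simp add: linear_diff[OF T(1)])
      also have "\<dots> \<le> 1 / (2 * B) * (B * norm (s - s'))" using B by (intro mult_left_mono) auto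
      finally show ?thesis using B by simp
    qed
    have zeroX: "0 \<in> ?X" using subspace_0[OF subspace_S0] by simp
    have F0: "F 0 = P u" unfolding F_def using linear_0[OF T(1)] P(1) by (simp add: linear_neg)
    have "\<exists>!s\<in>?X. F s = s"
    proof (rule Banach_fix)
      show "complete ?X" using subspace_S0 by (intro complete_eq_closed[THEN iffD2] closed_Int closed_subspace closed_cball)
      show "?X \<noteq> {}" using zeroX by blast
      show "F ` ?X \<subseteq> ?X"
      proof (intro image_subsetI IntI)
        fix s assume s: "s \<in> ?X"
        show "F s \<in> S0" unfolding F_def using s P(2) subspace_diff[OF subspace_S0] by blast
        have "norm (F s) \<le> norm (F s - F 0) + norm (P u)" using norm_triangle_sub[of "F s" "F 0"] F0 by simp
        also have "\<dots> \<le> 1/2 * norm s + norm u" using contr[OF s zeroX] P(4)[of u] by simp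
        also have "\<dots> \<le> 2 * norm u" using s by simp
        finally show "F s \<in> cball 0 (2 * norm u)" by simp
      qed
      show "dist (F s) (F s') \<le> 1/2 * dist s s'" if "s \<in> ?X" "s' \<in> ?X" for s s'
        using contr[OF that] by (simp add: dist_norm)
    qed auto
    then obtain s where s: "s \<in> ?X" "F s = s" by blast
    then have "P (\<Phi> (x0 + T s, w) - \<Phi> (x0, w) - u) = 0" by (simp add: F_def)
    then have "\<Phi> (x0 + T s, w) - \<Phi> (x0, w) - u \<in> S1"
      using P(3)[of "\<Phi> (x0 + T s, w) - \<Phi> (x0, w) - u"] by simp
    then show ?thesis using Tb[OF s(1)] by (intro exI[of _ "x0 + T s"]) simp
  qed
  then show ?thesis using \<delta> B(1) by (intro exI[of _ "2 * B"] conjI exI[of _ \<delta>]) auto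
qed

lemma box_nhds:
  assumes "\<delta> > 0"
  shows "\<forall>\<^sub>F q in nhds q0. fst q \<in> ball xb \<delta> \<and> snd q \<in> ball wb \<delta>"
  unfolding eventually_nhds_metric
proof (intro exI[of _ \<delta>] conjI allI impI assms)
  fix q assume q: "dist q q0 < \<delta>"
  then show "fst q \<in> ball xb \<delta>" "snd q \<in> ball wb \<delta>"
    using dist_fst_le[of q q0] dist_snd_le[of q q0] by (auto simp: dist_commute)
qed

text \<open>At \<open>fst q + t *\<^sub>R h\<close> the linearization is missed only by o(t), and
  metric regularity repairs this with a correction of the same order. The base point
  \<open>q\<close> varies and its own Jacobian \<open>J q\<close> appears, since optimality must
  also be exploited at perturbed minimizers.\<close>

lemma feasible_path:
  "\<forall>\<^sub>F q in nhds q0. \<forall>h. \<forall>e>0. \<exists>\<tau>>0. \<forall>t. 0 < t \<and> t < \<tau> \<longrightarrow>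
     (\<exists>y. norm (y - fst q - t *\<^sub>R h) \<le> e * t \<and> \<Phi> (y, snd q) - \<Phi> q - t *\<^sub>R J q h \<in> S1)"
proof -
  obtain C \<delta> where C: "C > 0" "\<delta> > 0" and mr: "\<And>x0 w u. x0 \<in> ball xb \<delta> \<Longrightarrow> w \<in> ball wb \<delta> \<Longrightarrow> norm u < \<delta> \<Longrightarrow>
     (\<exists>x. norm (x - x0) \<le> C * norm u \<and> \<Phi> (x, w) - \<Phi> (x0, w) - u \<in> S1)"
    using metric_regularity by metis
  have half: "\<delta> / 2 > 0" using C by simp
  from box_nhds[OF half] eventually_Om show ?thesis
  proof eventually_elim
    case (elim q)
    obtain x w where q: "q = (x, w)" by (cases q)
    have xw: "dist xb x < \<delta> / 2" "w \<in> ball wb \<delta>" "(x, w) \<in> Om" using elim q C by auto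
    have "\<exists>\<tau>>0. \<forall>t. 0 < t \<and> t < \<tau> \<longrightarrow>
       (\<exists>y. norm (y - x - t *\<^sub>R h) \<le> e * t \<and> \<Phi> (y, w) - \<Phi> (x, w) - t *\<^sub>R J (x, w) h \<in> S1)"
      if e: "e > 0" for h e
    proof -
      define n where "n = norm h + 1"
      have n: "n > 0" "norm h \<le> n" by (simp_all add: n_def add_nonneg_pos)
      \<comment> \<open>Regularity multiplies the linearization error, at most
        \<open>e' * (t * n)\<close>, by \<open>C\<close>; this choice leaves a correction of at most
        \<open>e * t\<close>.\<close>
      define e' where "e' = e / (C * n)"
      have e': "e' > 0" using e C n by (simp add: e'_def)
      obtain r where r: "r > 0" and dr: "\<And>y. norm (y - x) < r \<Longrightarrow>
          norm (\<Phi> (y, w) - \<Phi> (x, w) - J (x, w) (y - x)) \<le> e' * norm (y - x)"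
        using d\<Phi>[OF xw(3)] e' unfolding has_derivative_at_alt by blast
      \<comment> \<open>The three bounds make the derivative estimate applicable, keep
        \<open>x + t *\<^sub>R h\<close> in the regularity ball, and keep the defect
        \<open>u\<close> below \<delta>.\<close>
      define \<tau> where "\<tau> = min (r / n) (min (\<delta> / (2 * n)) (\<delta> * C / e))"
      have \<tau>: "\<tau> > 0" using r n C e by (simp add: \<tau>_def)
      have "\<exists>y. norm (y - x - t *\<^sub>R h) \<le> e * t \<and> \<Phi> (y, w) - \<Phi> (x, w) - t *\<^sub>R J (x, w) h \<in> S1"
        if t: "0 < t" "t < \<tau>" for t
      proof -
        have tn: "t * n < r" "t * n < \<delta> / 2" "e * t < \<delta> * C"
          using t n C e by (auto simp: \<tau>_def field_simps)
        have th: "norm (t *\<^sub>R h) \<le> t * n" using t n by simp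
        define u where "u = \<Phi> (x, w) + t *\<^sub>R J (x, w) h - \<Phi> (x + t *\<^sub>R h, w)"
        have "norm u = norm (\<Phi> (x + t *\<^sub>R h, w) - \<Phi> (x, w) - J (x, w) (x + t *\<^sub>R h - x))"
          unfolding u_def by (subst norm_minus_commute) (simp add: blinfun.scaleR_right algebra_simps)
        also have "\<dots> \<le> e' * norm (t *\<^sub>R h)" using dr[of "x + t *\<^sub>R h"] th tn(1) by simp
        also have "\<dots> \<le> e' * (t * n)" using th e' by (intro mult_left_mono) auto
        finally have u: "C * norm u \<le> e * t" using C n by (simp add: e'_def field_simps)
        have "norm u < \<delta>" using u tn(3) C by (smt (verit) mult.commute mult_less_cancel_left_pos)
        moreover have "x + t *\<^sub>R h \<in> ball xb \<delta>"
        proof -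
          have "dist xb (x + t *\<^sub>R h) \<le> dist xb x + dist x (x + t *\<^sub>R h)" by (rule dist_triangle)
          then show ?thesis using xw(1) th tn(2) by (simp add: dist_norm)
        qed
        ultimately obtain y where y: "norm (y - (x + t *\<^sub>R h)) \<le> C * norm u"
            "\<Phi> (y, w) - \<Phi> (x + t *\<^sub>R h, w) - u \<in> S1"
          using mr xw(2) by blast
        have "norm (y - x - t *\<^sub>R h) \<le> e * t" using y(1) u by (simp add: diff_diff_eq)
        moreover have "\<Phi> (y, w) - \<Phi> (x, w) - t *\<^sub>R J (x, w) h \<in> S1"
          using y(2) by (simp add: u_def algebra_simps)
        ultimately show ?thesis by blast
      qed
      with \<tau> show ?thesis by blast
    qed
    then show ?case by (simp add: q)
  qed
qed

end

section \<open>Minimizers and multipliers\<close>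

context composite_nd begin

text \<open>Nearby subdifferentials lie in the one at \<open>zb\<close>, so \<open>y - lamb\<close>
  is in \<open>S0\<close>, where \<open>Jt q0\<close> is bounded below. The KKT equations make
  \<open>Jt q0 (y - lamb)\<close> small up to a small multiple of \<open>norm y\<close>, which is
  absorbed.\<close>

lemma multiplier_close:
  assumes e: "e > 0"
  shows "\<exists>\<delta>>0. \<forall>\<^sub>F q in nhds q0. \<forall>v y. norm (v - vb) < \<delta> \<longrightarrow> kkt v q y \<longrightarrow> norm (y - lamb) < e"
proof -
  obtain C where C: "C > 0" "\<And>s. s \<in> S0 \<Longrightarrow> norm s \<le> C * norm (Jt q0 s)" using Jt_injective_bound by blast
  define \<delta> where "\<delta> = e / (8 * C)"
  \<comment> \<open>The first bound lets half of \<open>norm (y - lamb)\<close> be absorbed, the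
    second limits the contribution of \<open>norm lamb\<close> to \<open>e / 8\<close>. Together
    with \<open>2 * (C * \<delta>) = e / 4\<close> the result is at most three quarters of
    \<open>e\<close>.\<close>
  define \<eta> where "\<eta> = min (1 / (2 * C)) (e / (8 * C * (norm lamb + 1)))"
  have nl: "norm lamb + 1 > 0" by (simp add: add_nonneg_pos)
  have pos: "\<delta> > 0" "\<eta> > 0" using e C nl by (simp_all add: \<delta>_def \<eta>_def)
  obtain \<rho> where "\<forall>\<^sub>F q in nhds q0. subdifferential \<theta> (\<Phi> q) \<subseteq> subdifferential \<theta> zb \<and>
      (\<forall>v\<in>subdifferential \<theta> (\<Phi> q). norm (v - lamb) < \<rho> \<longrightarrow> lamb \<in> subdifferential \<theta> (\<Phi> q))"
    using eventually_subdifferential by blast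
  then have "\<forall>\<^sub>F q in nhds q0. \<forall>v y. norm (v - vb) < \<delta> \<longrightarrow> kkt v q y \<longrightarrow> norm (y - lamb) < e"
    using eventually_close[OF cont_g pos(1)] eventually_close_J[OF pos(2)]
  proof eventually_elim
    case (elim q)
    show ?case
    proof (intro allI impI)
      fix v y assume v: "norm (v - vb) < \<delta>" and k: "kkt v q y"
      let ?s = "y - lamb"
      have yS: "y \<in> S0" using k elim(1) subdifferential_subset_S0 by (auto simp: kkt_def)
      then have sS: "?s \<in> S0" using lamb_S0 subspace_diff[OF subspace_S0] by blast
      have "Jt q0 ?s = (v - vb) - (g\<phi> q - g\<phi> q0) - (Jt q y - Jt q0 y)"
        using k by (simp add: kkt_def vb_eq linear_diff[OF linear_Jt])
      then have "norm (Jt q0 ?s) \<le> norm (v - vb) + norm (g\<phi> q - g\<phi> q0) + norm (Jt q y - Jt q0 y)"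
        by (smt (verit) norm_triangle_ineq4)
      also have "norm (Jt q y - Jt q0 y) \<le> norm (J q - J q0) * norm y" by (rule norm_Jt_diff)
      also have "\<dots> \<le> \<eta> * (norm ?s + norm lamb)"
        using elim(3) norm_triangle_sub[of y lamb] pos by (intro mult_mono) auto
      finally have "norm (Jt q0 ?s) \<le> 2 * \<delta> + \<eta> * (norm ?s + norm lamb)" using v elim(2) by simp
      then have "norm ?s \<le> C * (2 * \<delta> + \<eta> * (norm ?s + norm lamb))"
        using C(2)[OF sS] C(1) by (smt (verit) mult_left_mono)
      also have "\<dots> = 2 * (C * \<delta>) + (C * \<eta>) * norm ?s + C * (\<eta> * norm lamb)" by (simp add: algebra_simps)
      also have "C * \<delta> = e / 8" using C by (simp add: \<delta>_def)
      also have "(C * \<eta>) * norm ?s \<le> (C * (1 / (2 * C))) * norm ?s"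
        using C by (intro mult_right_mono mult_left_mono) (auto simp: \<eta>_def)
      also have "\<dots> = norm ?s / 2" using C by simp
      also have "C * (\<eta> * norm lamb) \<le> C * (e / (8 * C * (norm lamb + 1)) * (norm lamb + 1))"
        using C pos nl by (intro mult_left_mono mult_mono) (auto simp: \<eta>_def)
      also have "\<dots> = e / 8" using C nl by simp
      finally show "norm ?s < e" using e by simp
    qed
  qed
  with pos show ?thesis by blast
qed

text \<open>The convex model \<open>h \<mapsto> m (\<Phi> q + J q h) - (v - g\<phi> q) \<bullet>
  h\<close> must be minimal over feasible \<open>h\<close> at 0: otherwise
  \<open>feasible_path\<close> turns a better \<open>h\<close> into an arc of feasible points with
  smaller objective. The polyhedral chain rule then supplies the multiplier.\<close>

lemma local_minimizer_kkt:
  "\<forall>\<^sub>F q in nhds q0. \<forall>v. \<Phi> q \<in> D \<longrightarrow>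
     (\<exists>r>0. \<forall>y\<in>ball (fst q) r. \<Phi> (y, snd q) \<in> D \<longrightarrow> obj v q \<le> obj v (y, snd q)) \<longrightarrow> (\<exists>y. kkt v q y)"
proof -
  obtain \<rho> where \<rho>: "\<rho> > 0" and inv: "\<And>z z'. z \<in> ball zb \<rho> \<Longrightarrow> z' \<in> ball zb \<rho> \<Longrightarrow> z' - z \<in> S1 \<Longrightarrow>
      (z \<in> D \<longrightarrow> z' \<in> D) \<and> m z' = m z"
    using theta_S1_invariant by blast
  have \<rho>2: "\<rho> / 2 > 0" using \<rho> by simp
  from feasible_path eventually_Om eventually_close[OF cont_\<Phi> \<rho>2] show ?thesis
  proof eventually_elim
    case (elim q)
    obtain x w where q: "q = (x, w)" by (cases q)
    let ?z = "\<Phi> (x, w)"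
    let ?J = "blinfun_apply (J (x, w))"
    have "\<exists>y. kkt v q y" if D: "?z \<in> D" and r0: "r0 > 0"
      and min: "\<And>y. y \<in> ball x r0 \<Longrightarrow> \<Phi> (y, w) \<in> D \<Longrightarrow> obj v (x, w) \<le> obj v (y, w)" for v r0
    proof -
      let ?v = "v - g\<phi> (x, w)"
      have "m ?z + ?v \<bullet> h \<le> m (?z + ?J h)" if hD: "?z + ?J h \<in> D" for h
      proof (rule ccontr)
        assume neg: "\<not> ?thesis"
        define \<kappa> where "\<kappa> = m ?z + ?v \<bullet> h - m (?z + ?J h)"
        have \<kappa>: "\<kappa> > 0" using neg by (simp add: \<kappa>_def)
        define M where "M = norm ?v + norm h + 1"
        have M: "M > 0" by (simp add: M_def add_nonneg_pos)
        \<comment> \<open>\<open>e * M\<close> dominates all first-order errors per unit of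
          \<open>t\<close>, so the model decrease \<kappa> would have to be at most
          \<open>\<kappa> / 2\<close>.\<close>
        define e where "e = min 1 (\<kappa> / (2 * M))"
        have e: "e > 0" "e \<le> 1" "e * M \<le> \<kappa> / 2"
          using \<kappa> M by (auto simp: e_def min_def field_simps)
        obtain \<tau> where \<tau>: "\<tau> > 0" and path: "\<And>t. 0 < t \<Longrightarrow> t < \<tau> \<Longrightarrow>
           \<exists>y. norm (y - x - t *\<^sub>R h) \<le> e * t \<and> \<Phi> (y, w) - ?z - t *\<^sub>R ?J h \<in> S1"
          using elim(1)[rule_format, OF e(1), of h] by (auto simp: q)
        have Om: "(x, w) \<in> Om" using elim(2) by (simp add: q)
        obtain r1 where r1: "r1 > 0" and d1: "\<And>y. norm (y - x) < r1 \<Longrightarrow>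
            norm (\<phi>0 (y, w) - \<phi>0 (x, w) - g\<phi> (x, w) \<bullet> (y - x)) \<le> e * norm (y - x)"
          using d\<phi>[OF Om] e(1) unfolding has_derivative_at_alt by blast
        have "isCont (\<lambda>y. \<Phi> (y, w)) x" using d\<Phi>[OF Om] by (rule has_derivative_continuous)
        then obtain r2 where r2: "r2 > 0" and d2: "\<And>y. dist y x < r2 \<Longrightarrow> dist (\<Phi> (y, w)) ?z < \<rho> / 2"
          using \<rho>2 unfolding continuous_at_eps_delta by blast
        define s where "s = min r0 (min r1 r2)"
        have s: "s > 0" using r0 r1 r2 by (simp add: s_def)
        define t where "t = min (\<tau> / 2) (min 1 (min (s / (2 * M)) (\<rho> / (4 * (norm (?J h) + 1)))))"
        have nJ: "norm (?J h) + 1 > 0" by (simp add: add_nonneg_pos)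
        have t: "0 < t" "t < \<tau>" "t \<le> 1" "t * M < s" "t * norm (?J h) < \<rho> / 2"
        proof -
          show "0 < t" using \<tau> s M \<rho> nJ by (simp add: t_def)
          show "t < \<tau>" "t \<le> 1" using \<tau> by (auto simp: t_def)
          have "t * M \<le> s / (2 * M) * M" using M by (intro mult_right_mono) (auto simp: t_def)
          then show "t * M < s" using M s by simp
          have cancel: "\<rho> / (4 * c) * c = \<rho> / 4" if "c > 0" for c :: real using that by simp
          have "t * norm (?J h) \<le> \<rho> / (4 * (norm (?J h) + 1)) * (norm (?J h) + 1)"
            using \<open>0 < t\<close> nJ by (intro mult_mono) (auto simp: t_def)
          also have "\<dots> = \<rho> / 4" by (rule cancel[OF nJ])
          finally show "t * norm (?J h) < \<rho> / 2" using \<rho> by linarith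
        qed
        obtain y where y: "norm (y - x - t *\<^sub>R h) \<le> e * t" "\<Phi> (y, w) - ?z - t *\<^sub>R ?J h \<in> S1"
          using path[OF t(1,2)] by blast
        have "norm (y - x) \<le> norm (y - x - t *\<^sub>R h) + norm (t *\<^sub>R h)" using norm_triangle_ineq[of "y - x - t *\<^sub>R h" "t *\<^sub>R h"] by simp
        also have "\<dots> \<le> e * t + t * norm h" using y(1) t(1) by simp
        also have "\<dots> = t * (e + norm h)" by (simp add: algebra_simps)
        finally have yx: "norm (y - x) \<le> t * (e + norm h)" .
        also have "e + norm h \<le> M" using e(2) norm_ge_zero[of ?v] unfolding M_def by linarith
        then have "t * (e + norm h) \<le> t * M" using t(1) by (intro mult_left_mono) auto
        finally have yx2: "norm (y - x) < s" using t(4) by simp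
        let ?z' = "?z + t *\<^sub>R ?J h"
        have z1: "?z' \<in> ball zb \<rho>"
        proof -
          have "norm (?z' - zb) \<le> norm (?z - zb) + norm (t *\<^sub>R ?J h)"
            using norm_triangle_ineq[of "?z - zb" "t *\<^sub>R ?J h"] by (simp add: algebra_simps)
          then show ?thesis using elim(3) t(1,5) by (simp add: q zb_eq dist_norm norm_minus_commute)
        qed
        have z2: "\<Phi> (y, w) \<in> ball zb \<rho>"
        proof -
          have "dist zb (\<Phi> (y, w)) \<le> dist zb ?z + dist ?z (\<Phi> (y, w))" by (rule dist_triangle)
          moreover have "dist zb ?z < \<rho> / 2" using elim(3) by (simp add: q zb_eq dist_norm norm_minus_commute)
          moreover have "dist ?z (\<Phi> (y, w)) < \<rho> / 2"
            using d2[of y] yx2 by (simp add: s_def dist_norm norm_minus_commute)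
          ultimately show ?thesis by simp
        qed
        \<comment> \<open>The direction \<open>h\<close> need not be small: convexity of the domain
          and of \<open>m\<close> transfers feasibility and decrease to the short step
          \<open>t\<close>. The actual value \<open>\<Phi> (y, w)\<close> differs from
          \<open>?z'\<close> only by \<open>S1\<close>, so it inherits both.\<close>
        have z'eq: "?z' = (1 - t) *\<^sub>R ?z + t *\<^sub>R (?z + ?J h)" by (simp add: algebra_simps)
        have z'D: "?z' \<in> D" unfolding z'eq using convex_D D hD t by (intro convexD) auto
        have mz': "m ?z' \<le> (1 - t) * m ?z + t * m (?z + ?J h)"
          unfolding z'eq using convex_m t by (intro convex_onD) auto
        have P: "\<Phi> (y, w) \<in> D" "m (\<Phi> (y, w)) = m ?z'"
          using inv[OF z1 z2] y(2) z'D by (simp_all add: diff_diff_eq)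
        have "y \<in> ball x r0" using yx2 by (simp add: s_def dist_norm norm_minus_commute)
        from min[OF this P(1)] have
          "\<phi>0 (x, w) + m ?z - v \<bullet> x \<le> \<phi>0 (y, w) + m ?z' - v \<bullet> y" by (simp add: obj_def P(2))
        moreover have "\<phi>0 (y, w) - \<phi>0 (x, w) \<le> g\<phi> (x, w) \<bullet> (y - x) + e * norm (y - x)"
          using d1[of y] yx2 by (simp add: s_def)
        moreover have "(1 - t) * m ?z + t * m (?z + ?J h) = m ?z + t * (m (?z + ?J h) - m ?z)"
          by (simp add: algebra_simps)
        ultimately have "?v \<bullet> (y - x) \<le> e * norm (y - x) + t * (m (?z + ?J h) - m ?z)"
          using mz' by (simp add: inner_diff_left inner_diff_right)
        moreover have "?v \<bullet> (y - x) = t * (?v \<bullet> h) + ?v \<bullet> (y - x - t *\<^sub>R h)"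
          by (simp add: inner_diff_right)
        moreover have "\<bar>?v \<bullet> (y - x - t *\<^sub>R h)\<bar> \<le> norm ?v * (e * t)"
          by (intro order_trans[OF Cauchy_Schwarz_ineq2] mult_left_mono y(1)) simp
        moreover have "e * norm (y - x) \<le> e * (t * (e + norm h))" using yx e by (intro mult_left_mono) auto
        ultimately have "t * (?v \<bullet> h) \<le> e * (t * (e + norm h)) + t * (m (?z + ?J h) - m ?z) + norm ?v * (e * t)"
          by linarith
        then have "t * \<kappa> \<le> t * (e * (e + norm h + norm ?v))" by (simp add: \<kappa>_def algebra_simps)
        then have "\<kappa> \<le> e * (e + norm h + norm ?v)" using t(1) by simp
        also have "\<dots> \<le> e * M" using e by (intro mult_left_mono) (auto simp: M_def)
        finally show False using e(3) \<kappa> by simp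
      qed
      from subdifferential_chain[OF D linear_J this]
      obtain y where "y \<in> subdifferential \<theta> ?z" "v - g\<phi> (x, w) = Jt (x, w) y" by blast
      then have "kkt v q y" by (auto simp: kkt_def q algebra_simps)
      then show ?thesis ..
    qed
    then show ?case unfolding q fst_conv snd_conv by blast
  qed
qed

text \<open>Under the perturbed parameter, \<open>xb\<close> misses \<open>zb\<close> by
  \<open>zb - \<Phi> (xb, w)\<close>. Metric regularity removes this gap up to \<open>S1\<close>,
  and along \<open>S1\<close> feasibility is inherited from \<open>zb\<close>.\<close>

lemma feasible_near:
  assumes e: "e > 0"
  shows "\<exists>\<delta>>0. \<forall>w\<in>ball wb \<delta>. \<exists>x\<in>ball xb e. \<Phi> (x, w) \<in> D"
proof -
  obtain \<rho> where \<rho>: "\<rho> > 0" and inv: "\<And>z z'. z \<in> ball zb \<rho> \<Longrightarrow> z' \<in> ball zb \<rho> \<Longrightarrow> z' - z \<in> S1 \<Longrightarrow>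
      (z \<in> D \<longrightarrow> z' \<in> D) \<and> m z' = m z"
    using theta_S1_invariant by blast
  obtain C \<delta> where C: "C > 0" "\<delta> > 0" and mr: "\<And>x0 w u. x0 \<in> ball xb \<delta> \<Longrightarrow> w \<in> ball wb \<delta> \<Longrightarrow> norm u < \<delta> \<Longrightarrow>
     (\<exists>x. norm (x - x0) \<le> C * norm u \<and> \<Phi> (x, w) - \<Phi> (x0, w) - u \<in> S1)"
    using metric_regularity by metis
  obtain r where r: "r > 0" "\<And>q. dist q q0 < r \<Longrightarrow> norm (\<Phi> q - zb) < \<rho>"
    using eventually_close[OF cont_\<Phi> \<rho>] unfolding eventually_nhds_metric zb_eq by blast
  define e' where "e' = min e (r / 2)"
  have e': "e' > 0" using e r by (simp add: e'_def)
  have "min \<delta> (e' / (2 * C)) > 0" using C e' by simp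
  from eventually_close[OF cont_\<Phi> this] obtain r' where r': "r' > 0"
      "\<And>q. dist q q0 < r' \<Longrightarrow> norm (\<Phi> q - zb) < min \<delta> (e' / (2 * C))"
    unfolding eventually_nhds_metric zb_eq by blast
  have "\<exists>x\<in>ball xb e. \<Phi> (x, w) \<in> D" if w: "w \<in> ball wb (min \<delta> (min r' (r / 2)))" for w
  proof -
    let ?u = "zb - \<Phi> (xb, w)"
    have u: "norm ?u < min \<delta> (e' / (2 * C))"
      using r'(2)[of "(xb, w)"] w by (simp add: norm_minus_commute dist_Pair_Pair dist_commute)
    then obtain x where x: "norm (x - xb) \<le> C * norm ?u" "\<Phi> (x, w) - \<Phi> (xb, w) - ?u \<in> S1"
      using mr[of xb w ?u] w C by auto
    have "C * norm ?u < C * (e' / C)"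
      using u C e' by (intro mult_strict_left_mono) (auto simp: field_simps)
    then have xe: "norm (x - xb) < e'" using x(1) C by simp
    have "dist (x, w) q0 \<le> norm (x - xb) + norm (w - wb)"
      unfolding dist_norm by (simp add: norm_Pair_le)
    then have "dist (x, w) q0 < r" using xe w by (simp add: e'_def dist_norm norm_minus_commute)
    then have "norm (\<Phi> (x, w) - zb) < \<rho>" by (rule r(2))
    then have "\<Phi> (x, w) \<in> D" using inv[of zb "\<Phi> (x, w)"] x(2) zb \<rho> by (simp add: dist_norm norm_minus_commute)
    then show ?thesis using xe by (intro bexI[of _ x]) (auto simp: e'_def dist_norm norm_minus_commute)
  qed
  then show ?thesis using C r r' by (intro exI[of _ "min \<delta> (min r' (r / 2))"]) auto
qed

lemma tendsto_obj:
  assumes "q \<in> Om" "f \<longlonglongrightarrow> q" "g \<longlonglongrightarrow> v"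
  shows "(\<lambda>k. obj (g k) (f k)) \<longlonglongrightarrow> obj v q" "(\<lambda>k. \<Phi> (f k)) \<longlonglongrightarrow> \<Phi> q"
proof -
  have c: "isCont \<phi>0 q" "isCont \<Phi> q"
    using cont_\<phi> cont_\<Phi> assms(1) open_Om continuous_on_eq_continuous_at by blast+
  show 1: "(\<lambda>k. \<Phi> (f k)) \<longlonglongrightarrow> \<Phi> q" by (rule isCont_tendsto_compose[OF c(2) assms(2)])
  show "(\<lambda>k. obj (g k) (f k)) \<longlonglongrightarrow> obj v q"
    unfolding obj_def
    by (intro tendsto_intros isCont_tendsto_compose[OF c(1) assms(2)] isCont_tendsto_compose[OF isCont_m 1] assms)
qed

lemma minimizer_exists:
  assumes "cball xb \<gamma> \<times> {w} \<subseteq> Om" "x0 \<in> cball xb \<gamma>" "\<Phi> (x0, w) \<in> D"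
  shows "\<exists>x\<in>cball xb \<gamma>. \<Phi> (x, w) \<in> D \<and> (\<forall>y\<in>cball xb \<gamma>. \<Phi> (y, w) \<in> D \<longrightarrow> obj v (x, w) \<le> obj v (y, w))"
proof -
  let ?X = "cball xb \<gamma> \<inter> (\<lambda>y. \<Phi> (y, w)) -` D"
  have c: "continuous_on (cball xb \<gamma>) (\<lambda>y. \<Phi> (y, w))" "continuous_on (cball xb \<gamma>) (\<lambda>y. \<phi>0 (y, w))"
    using assms(1) by (auto intro!: continuous_intros continuous_on_compose2[OF cont_\<Phi>] continuous_on_compose2[OF cont_\<phi>])
  have "closed ?X" using c(1) closed_D by (intro continuous_closed_preimage) auto
  then have comp: "compact ?X" by (meson bounded_Int bounded_cball compact_eq_bounded_closed)
  have "continuous_on ?X (\<lambda>y. obj v (y, w))"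
    unfolding obj_def fst_conv
    by (intro continuous_intros continuous_on_compose2[OF continuous_m] continuous_on_subset[OF c(1)] continuous_on_subset[OF c(2)]) auto
  from continuous_attains_inf[OF comp _ this] assms(2,3) show ?thesis by fastforce
qed

text \<open>By compactness: minimizers that stay away from \<open>xb\<close> while the parameters
  converge accumulate at a feasible point other than \<open>xb\<close>. Comparison with feasible
  points tending to \<open>xb\<close> shows that its value is no larger than that of
  \<open>xb\<close>.\<close>

lemma perturbed_minimizer:
  assumes \<gamma>: "\<gamma> > 0" "cball xb \<gamma> \<times> cball wb \<gamma> \<subseteq> Om" and e: "e > 0"
    and strict: "\<And>x. x \<in> cball xb \<gamma> \<Longrightarrow> x \<noteq> xb \<Longrightarrow> \<Phi> (x, wb) \<in> D \<Longrightarrow> obj vb q0 < obj vb (x, wb)"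
  shows "\<exists>\<delta>>0. \<forall>w\<in>ball wb \<delta>. \<forall>v\<in>ball vb \<delta>. \<exists>x\<in>ball xb e. x \<in> cball xb \<gamma> \<and> \<Phi> (x, w) \<in> D \<and>
    (\<forall>y\<in>cball xb \<gamma>. \<Phi> (y, w) \<in> D \<longrightarrow> obj v (x, w) \<le> obj v (y, w))"
proof (rule ccontr)
  assume neg: "\<not> ?thesis"
  \<comment> \<open>The cap at \<gamma> keeps the comparison points and the parameters inside the
    closed balls on which the data are controlled.\<close>
  define \<epsilon> where "\<epsilon> k = min \<gamma> (1 / real (Suc k))" for k
  have \<epsilon>: "\<epsilon> k > 0" for k using \<gamma> by (simp add: \<epsilon>_def)
  have \<epsilon>0: "\<epsilon> \<longlonglongrightarrow> 0"
  proof -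
    have "(\<lambda>k. min \<gamma> (1 / real (Suc k))) \<longlonglongrightarrow> min \<gamma> 0"
      by (intro tendsto_min tendsto_const LIMSEQ_Suc lim_1_over_n)
    then show ?thesis using \<gamma> unfolding \<epsilon>_def by (simp add: min_def)
  qed
  \<comment> \<open>A violation at scale \<open>\<epsilon> k\<close>: \<open>x\<close> is a
    minimizer that stays away from \<open>xb\<close>, and \<open>x'\<close> a feasible comparison
    point close to \<open>xb\<close>.\<close>
  define Q where "Q k w v x' x \<longleftrightarrow> w \<in> ball wb (\<epsilon> k) \<and> v \<in> ball vb (\<epsilon> k) \<and> x' \<in> ball xb (\<epsilon> k) \<and>
      x \<in> cball xb \<gamma> \<and> x \<notin> ball xb e \<and> \<Phi> (x, w) \<in> D \<and> obj v (x, w) \<le> obj v (x', w)" for k w v x' x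
  have ex: "\<exists>w v x' x. Q k w v x' x" for k
  proof -
    obtain \<delta> where \<delta>: "\<delta> > 0" "\<forall>w\<in>ball wb \<delta>. \<exists>x\<in>ball xb (\<epsilon> k). \<Phi> (x, w) \<in> D"
      using feasible_near[OF \<epsilon>] by blast
    have "min \<delta> (\<epsilon> k) > 0" using \<delta> \<epsilon> by simp
    with neg obtain w v where wv: "w \<in> ball wb (min \<delta> (\<epsilon> k))" "v \<in> ball vb (min \<delta> (\<epsilon> k))"
      "\<And>x. x \<in> ball xb e \<Longrightarrow> x \<in> cball xb \<gamma> \<Longrightarrow> \<Phi> (x, w) \<in> D \<Longrightarrow>
        \<exists>y\<in>cball xb \<gamma>. \<Phi> (y, w) \<in> D \<and> obj v (y, w) < obj v (x, w)"
      by (meson not_less)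
    have "w \<in> ball wb \<delta>" using wv(1) by simp
    with \<delta>(2) obtain x' where x': "x' \<in> ball xb (\<epsilon> k)" "\<Phi> (x', w) \<in> D" by blast
    have xc: "x' \<in> cball xb \<gamma>" using x'(1) by (simp add: \<epsilon>_def)
    have "w \<in> cball wb \<gamma>" using wv(1) by (simp add: \<epsilon>_def)
    then have "cball xb \<gamma> \<times> {w} \<subseteq> Om" using \<gamma>(2) by blast
    from minimizer_exists[OF this xc x'(2)] obtain x where x: "x \<in> cball xb \<gamma>" "\<Phi> (x, w) \<in> D"
      "\<And>y. y \<in> cball xb \<gamma> \<Longrightarrow> \<Phi> (y, w) \<in> D \<Longrightarrow> obj v (x, w) \<le> obj v (y, w)" by blast
    have "x \<notin> ball xb e" using wv(3) x by (meson not_less)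
    then have "Q k w v x' x" unfolding Q_def using wv(1,2) x(1,2) x' x(3)[OF xc x'(2)] by simp
    then show ?thesis by blast
  qed
  then obtain w v x' x where Q: "\<And>k. Q k (w k) (v k) (x' k) (x k)" by metis
  then have s: "\<And>k. w k \<in> ball wb (\<epsilon> k)" "\<And>k. v k \<in> ball vb (\<epsilon> k)"
      "\<And>k. x' k \<in> ball xb (\<epsilon> k)" "\<And>k. x k \<in> cball xb \<gamma>" "\<And>k. x k \<notin> ball xb e"
      "\<And>k. \<Phi> (x k, w k) \<in> D" "\<And>k. obj (v k) (x k, w k) \<le> obj (v k) (x' k, w k)"
    unfolding Q_def by blast+
  have lim: "f \<longlonglongrightarrow> c" if "\<And>k. f k \<in> ball c (\<epsilon> k)" for f :: "nat \<Rightarrow> 'e::metric_space" and c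
  proof -
    have "norm (dist (f k) c) \<le> \<epsilon> k" for k using that[of k] by (simp add: dist_commute[of _ c])
    then have "(\<lambda>k. dist (f k) c) \<longlonglongrightarrow> 0" by (rule Lim_null_comparison[OF always_eventually[OF allI] \<epsilon>0])
    then show ?thesis by (rule tendsto_dist_iff[THEN iffD2])
  qed
  have lw: "w \<longlonglongrightarrow> wb" using s(1) by (rule lim)
  have lv: "v \<longlonglongrightarrow> vb" using s(2) by (rule lim)
  have lx: "x' \<longlonglongrightarrow> xb" using s(3) by (rule lim)
  have "seq_compact (cball xb \<gamma>)" using compact_cball compact_eq_seq_compact_metric by blast
  moreover have "\<forall>k. x k \<in> cball xb \<gamma>" using s(4) by blast
  ultimately obtain xx r where
    xr: "xx \<in> cball xb \<gamma>" "strict_mono (r :: nat \<Rightarrow> nat)" "(x \<circ> r) \<longlonglongrightarrow> xx"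
    by (rule seq_compactE)
  have lr: "(\<lambda>k. w (r k)) \<longlonglongrightarrow> wb" "(\<lambda>k. v (r k)) \<longlonglongrightarrow> vb" "(\<lambda>k. x' (r k)) \<longlonglongrightarrow> xb"
    using LIMSEQ_subseq_LIMSEQ[OF lw xr(2)] LIMSEQ_subseq_LIMSEQ[OF lv xr(2)]
      LIMSEQ_subseq_LIMSEQ[OF lx xr(2)] by (simp_all add: o_def)
  have Om: "(xx, wb) \<in> Om" using xr(1) \<gamma> by auto
  have l1: "(\<lambda>k. (x (r k), w (r k))) \<longlonglongrightarrow> (xx, wb)" using xr(3) lr(1) by (auto intro!: tendsto_Pair simp: o_def)
  have l2: "(\<lambda>k. (x' (r k), w (r k))) \<longlonglongrightarrow> q0" using lr by (auto intro!: tendsto_Pair)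
  have "obj vb (xx, wb) \<le> obj vb q0"
    using tendsto_obj(1)[OF Om l1 lr(2)] tendsto_obj(1)[OF q0_Om l2 lr(2)] s(7) by (intro LIMSEQ_le) auto
  moreover have "\<Phi> (xx, wb) \<in> D"
    using closed_sequentially[OF closed_D _ tendsto_obj(2)[OF Om l1 lr(2)]] s(6) by blast
  moreover have "xx \<noteq> xb"
  proof -
    have "(x \<circ> r) k \<in> - ball xb e" for k using s(5) by simp
    then have "xx \<in> - ball xb e" using closed_sequentially[OF _ _ xr(3), of "- ball xb e"] by (simp add: closed_Compl)
    with e show ?thesis by auto
  qed
  ultimately show False using strict[OF xr(1)] by simp
qed

end

section \<open>Second-order sufficiency and Lipschitz stability\<close>

context composite begin

definition ssosc :: bool where
  "ssosc \<longleftrightarrow> (\<forall>u. A u \<in> N \<longrightarrow> u \<noteq> 0 \<longrightarrow> 0 < u \<bullet> H u)"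

abbreviation gradL :: "'x \<times> 'w \<Rightarrow> 'x" where "gradL q \<equiv> g\<phi> q + Jt q lamb"
abbreviation lag :: "'x \<Rightarrow> real" where "lag x \<equiv> \<phi>0 (x, wb) + lamb \<bullet> \<Phi> (x, wb)"

lemma ball_slice: "x \<in> ball xb \<delta> \<Longrightarrow> (x, wb) \<in> ball q0 \<delta>"
  by (simp add: dist_Pair_Pair)

text \<open>The quadratic term keeps the fixed matrix \<open>H\<close> and the error is uniform in
  both end points. The converse direction expands between two points neither of which is
  \<open>xb\<close>.\<close>

lemma second_order:
  assumes e: "e > 0"
  shows "\<exists>\<delta>>0. \<forall>x\<in>ball xb \<delta>. \<forall>y\<in>ball xb \<delta>.
    \<bar>lag y - lag x - gradL (x, wb) \<bullet> (y - x) - 1/2 * ((y - x) \<bullet> H (y - x))\<bar> \<le> e * (norm (y - x))\<^sup>2"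
proof -
  obtain C where "\<forall>e>0. \<exists>\<delta>>0. \<forall>q\<in>ball q0 \<delta>. \<forall>q'\<in>ball q0 \<delta>.
     norm (gradL q - gradL q' - H (fst q - fst q')) \<le> e * norm (fst q - fst q') + C * norm (snd q - snd q')"
    using strict_L unfolding strict_partial_def by blast
  with e obtain \<delta>1 where \<delta>1: "\<delta>1 > 0" and st: "\<And>q q'. q \<in> ball q0 \<delta>1 \<Longrightarrow> q' \<in> ball q0 \<delta>1 \<Longrightarrow>
     norm (gradL q - gradL q' - H (fst q - fst q')) \<le> e * norm (fst q - fst q') + C * norm (snd q - snd q')"
    by blast
  obtain \<delta>2 where \<delta>2: "\<delta>2 > 0" "ball q0 \<delta>2 \<subseteq> Om" using open_Om q0_Om open_contains_ball by blast
  define \<delta> where "\<delta> = min \<delta>1 \<delta>2"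
  have "\<bar>lag y - lag x - gradL (x, wb) \<bullet> (y - x) - 1/2 * ((y - x) \<bullet> H (y - x))\<bar> \<le> e * (norm (y - x))\<^sup>2"
    if x: "x \<in> ball xb \<delta>" and y: "y \<in> ball xb \<delta>" for x y
  proof -
    define h where "h = y - x"
    have seg: "x + s *\<^sub>R h \<in> ball xb \<delta>" if "0 \<le> s" "s \<le> 1" for s
    proof -
      have "x + s *\<^sub>R h = (1 - s) *\<^sub>R x + s *\<^sub>R y" by (simp add: h_def algebra_simps)
      then show ?thesis using convexD[OF convex_ball x y, of "1 - s" s] that by simp
    qed
    \<comment> \<open>The quadratic model is subtracted so that the derivative of \<open>k\<close>
      is the strict-differentiability remainder of the gradient, paired with
      \<open>h\<close>.\<close>
    define k where "k s = lag (x + s *\<^sub>R h) - s * (gradL (x, wb) \<bullet> h) - s\<^sup>2 / 2 * (h \<bullet> H h)" for s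
    have dk: "(k has_real_derivative (gradL (x + s *\<^sub>R h, wb) \<bullet> h - gradL (x, wb) \<bullet> h - s * (h \<bullet> H h))) (at s)"
      if "0 \<le> s" "s \<le> 1" for s
    proof -
      have Om: "(x + s *\<^sub>R h, wb) \<in> Om" using ball_slice[OF seg[OF that]] \<delta>2(2) by (auto simp: \<delta>_def)
      have l: "((\<lambda>s. x + s *\<^sub>R h) has_derivative (\<lambda>t. t *\<^sub>R h)) (at s)"
        by (auto intro!: derivative_eq_intros)
      have 1: "((\<lambda>s. \<phi>0 (x + s *\<^sub>R h, wb)) has_derivative (\<lambda>t. g\<phi> (x + s *\<^sub>R h, wb) \<bullet> (t *\<^sub>R h))) (at s)"
        using has_derivative_compose[OF l d\<phi>[OF Om]] by simp
      have 2: "((\<lambda>s. \<Phi> (x + s *\<^sub>R h, wb)) has_derivative (\<lambda>t. J (x + s *\<^sub>R h, wb) (t *\<^sub>R h))) (at s)"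
        using has_derivative_compose[OF l d\<Phi>[OF Om]] by simp
      have "((\<lambda>s. lag (x + s *\<^sub>R h)) has_derivative
          (\<lambda>t. g\<phi> (x + s *\<^sub>R h, wb) \<bullet> (t *\<^sub>R h) + lamb \<bullet> J (x + s *\<^sub>R h, wb) (t *\<^sub>R h))) (at s)"
        by (intro has_derivative_add 1 has_derivative_inner_right 2)
      also have "(\<lambda>t. g\<phi> (x + s *\<^sub>R h, wb) \<bullet> (t *\<^sub>R h) + lamb \<bullet> J (x + s *\<^sub>R h, wb) (t *\<^sub>R h))
          = (*) (gradL (x + s *\<^sub>R h, wb) \<bullet> h)"
        by (auto simp: inner_add_left Jt_inner(1) blinfun.scaleR_right algebra_simps)
      finally have 3: "((\<lambda>s. lag (x + s *\<^sub>R h)) has_real_derivative gradL (x + s *\<^sub>R h, wb) \<bullet> h) (at s)"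
        unfolding has_field_derivative_def .
      show ?thesis unfolding k_def
        by (rule derivative_eq_intros 3 refl | simp)+
    qed
    obtain s where s: "0 < s" "s < 1" "k 1 - k 0 = (1 - 0) * (gradL (x + s *\<^sub>R h, wb) \<bullet> h - gradL (x, wb) \<bullet> h - s * (h \<bullet> H h))"
      using MVT2[of 0 1 k "\<lambda>s. gradL (x + s *\<^sub>R h, wb) \<bullet> h - gradL (x, wb) \<bullet> h - s * (h \<bullet> H h)"] dk by auto
    let ?r = "gradL (x + s *\<^sub>R h, wb) - gradL (x, wb) - H (s *\<^sub>R h)"
    have "k 1 - k 0 = h \<bullet> ?r"
      using s(3) by (simp add: inner_diff_right inner_commute linear_scale[OF linear_H])
    then have "\<bar>k 1 - k 0\<bar> \<le> norm h * norm ?r" using Cauchy_Schwarz_ineq2 by metis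
    also have "norm ?r \<le> e * norm (s *\<^sub>R h)"
      using st[OF ball_slice ball_slice, of "x + s *\<^sub>R h" x] seg[of s] s x by (simp add: \<delta>_def)
    also have "\<dots> \<le> e * norm h" using s e by (simp add: mult_left_le_one_le)
    finally have "\<bar>k 1 - k 0\<bar> \<le> norm h * (e * norm h)" by (simp add: mult_left_mono)
    moreover have "k 1 - k 0 = lag y - lag x - gradL (x, wb) \<bullet> (y - x) - 1/2 * ((y - x) \<bullet> H (y - x))"
      by (simp add: k_def h_def)
    ultimately show ?thesis by (simp add: h_def power2_eq_square mult_ac)
  qed
  then show ?thesis using \<delta>1 \<delta>2 by (intro exI[of _ \<delta>]) (auto simp: \<delta>_def)
qed

text \<open>Points violating strictness converge along a unit direction \<open>uu\<close>. Their
  Lagrangian increment is nonpositive, which makes the quadratic form at \<open>uu\<close>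
  nonpositive, and it is of second order, which forces \<open>A uu\<close> into the critical cone;
  the SSOSC excludes this combination.\<close>

lemma strict_minimizer:
  assumes ss: ssosc
  shows "\<exists>\<gamma>>0. \<forall>x\<in>cball xb \<gamma>. x \<noteq> xb \<longrightarrow> \<Phi> (x, wb) \<in> D \<longrightarrow> obj vb q0 < obj vb (x, wb)"
proof (rule ccontr)
  assume neg: "\<not> ?thesis"
  define \<epsilon> where "\<epsilon> k = 1 / real (Suc k)" for k
  have \<epsilon>: "\<epsilon> k > 0" for k by (simp add: \<epsilon>_def)
  have \<epsilon>0: "\<epsilon> \<longlonglongrightarrow> 0" unfolding \<epsilon>_def by (intro LIMSEQ_Suc lim_1_over_n)
  have "\<forall>k. \<exists>x. x \<in> cball xb (\<epsilon> k) \<and> x \<noteq> xb \<and> \<Phi> (x, wb) \<in> D \<and> obj vb (x, wb) \<le> obj vb q0"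
    using neg \<epsilon> by (meson not_less)
  then obtain x where x: "\<And>k. x k \<in> cball xb (\<epsilon> k)" "\<And>k. x k \<noteq> xb" "\<And>k. \<Phi> (x k, wb) \<in> D"
      "\<And>k. obj vb (x k, wb) \<le> obj vb q0" by metis
  have "norm (dist (x k) xb) \<le> \<epsilon> k" for k using x(1)[of k] by (simp add: dist_commute)
  then have "(\<lambda>k. dist (x k) xb) \<longlonglongrightarrow> 0" by (rule Lim_null_comparison[OF always_eventually[OF allI] \<epsilon>0])
  then have lx: "x \<longlonglongrightarrow> xb" by (rule tendsto_dist_iff[THEN iffD2])
  define t where "t k = norm (x k - xb)" for k
  have t: "t k > 0" for k using x(2) by (simp add: t_def)
  have lt: "t \<longlonglongrightarrow> 0" unfolding t_def by (rule tendsto_norm_zero[OF LIM_zero[OF lx]])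
  define u where "u k = (1 / t k) *\<^sub>R (x k - xb)" for k
  have xu: "x k - xb = t k *\<^sub>R u k" for k using t[of k] by (simp add: u_def)
  have us: "u k \<in> sphere 0 1" for k using t[of k] by (simp add: u_def) (simp add: t_def)
  have "seq_compact (sphere 0 1 :: 'x set)" using compact_sphere compact_eq_seq_compact_metric by blast
  moreover have "\<forall>k. u k \<in> sphere 0 1" using us by blast
  ultimately obtain uu r where ur: "uu \<in> sphere 0 1" "strict_mono (r :: nat \<Rightarrow> nat)" "(u \<circ> r) \<longlonglongrightarrow> uu"
    by (rule seq_compactE)
  have lu: "(\<lambda>k. u (r k)) \<longlonglongrightarrow> uu" using ur(3) by (simp add: o_def)
  have ltr: "(\<lambda>k. t (r k)) \<longlonglongrightarrow> 0" using LIMSEQ_subseq_LIMSEQ[OF lt ur(2)] by (simp add: o_def)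
  have lxr: "(\<lambda>k. x (r k)) \<longlonglongrightarrow> xb" using LIMSEQ_subseq_LIMSEQ[OF lx ur(2)] by (simp add: o_def)
  have contH: "isCont H z" for z using linear_H linear_conv_bounded_linear linear_continuous_at by blast
  define f where "f k = \<Phi> (x k, wb) - zb" for k
  have lf: "(\<lambda>k. (1 / t (r k)) *\<^sub>R f (r k)) \<longlonglongrightarrow> A uu"
  proof -
    have d1: "(\<lambda>k. (1 / t (r k)) *\<^sub>R f (r k) - A (u (r k))) \<longlonglongrightarrow> 0"
    proof (rule tendstoI)
      fix e :: real assume "e > 0"
      then have e2: "e / 2 > 0" by simp
      obtain d0 where d0: "d0 > 0" "\<And>y. norm (y - xb) < d0 \<Longrightarrow> norm (\<Phi> (y, wb) - zb - A (y - xb)) \<le> e / 2 * norm (y - xb)"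
        using d\<Phi>[OF q0_Om] e2 unfolding has_derivative_at_alt zb_eq by blast
      have "\<forall>\<^sub>F k in sequentially. dist (x (r k)) xb < d0" using tendstoD[OF lxr d0(1)] .
      then show "\<forall>\<^sub>F k in sequentially. dist ((1 / t (r k)) *\<^sub>R f (r k) - A (u (r k))) 0 < e"
      proof eventually_elim
        case (elim k)
        have fA: "norm (f (r k) - A (x (r k) - xb)) \<le> e / 2 * t (r k)"
          using d0(2)[of "x (r k)"] elim by (simp add: f_def t_def dist_norm)
        have eq: "(1 / t (r k)) *\<^sub>R f (r k) - A (u (r k)) = (1 / t (r k)) *\<^sub>R (f (r k) - A (x (r k) - xb))"
          using t[of "r k"] unfolding xu by (simp add: blinfun.scaleR_right scaleR_diff_right)
        have "norm ((1 / t (r k)) *\<^sub>R f (r k) - A (u (r k))) = norm (f (r k) - A (x (r k) - xb)) / t (r k)"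
          unfolding eq using t[of "r k"] by simp
        also have "\<dots> \<le> e / 2" using t[of "r k"] fA by (simp only: pos_divide_le_eq)
        finally have "norm ((1 / t (r k)) *\<^sub>R f (r k) - A (u (r k))) \<le> e / 2" .
        then show ?case using \<open>e > 0\<close> by simp
      qed
    qed
    have d2: "(\<lambda>k. A (u (r k))) \<longlonglongrightarrow> A uu"
      by (rule bounded_linear.tendsto[OF blinfun.bounded_linear_right lu])
    show ?thesis using tendsto_add[OF d1 d2] by simp
  qed
  define E where "E k = lag (x k) - lag xb - vb \<bullet> (x k - xb)" for k
  have lE: "(\<lambda>k. E (r k) / (t (r k))\<^sup>2) \<longlonglongrightarrow> 1/2 * (uu \<bullet> H uu)"
  proof -
    have d1: "(\<lambda>k. E (r k) / (t (r k))\<^sup>2 - 1/2 * (u (r k) \<bullet> H (u (r k)))) \<longlonglongrightarrow> 0"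
    proof (rule tendstoI)
      fix e :: real assume "e > 0"
      then have e2: "e / 2 > 0" by simp
      obtain d0 where d0: "d0 > 0" "\<forall>x\<in>ball xb d0. \<forall>y\<in>ball xb d0.
        \<bar>lag y - lag x - gradL (x, wb) \<bullet> (y - x) - 1/2 * ((y - x) \<bullet> H (y - x))\<bar> \<le> e/2 * (norm (y - x))\<^sup>2"
        using second_order[OF e2] by blast
      have "\<forall>\<^sub>F k in sequentially. dist (x (r k)) xb < d0" using tendstoD[OF lxr d0(1)] .
      then show "\<forall>\<^sub>F k in sequentially. dist (E (r k) / (t (r k))\<^sup>2 - 1/2 * (u (r k) \<bullet> H (u (r k)))) 0 < e"
      proof eventually_elim
        case (elim k)
        let ?y = "x (r k)" and ?t = "t (r k)" and ?u = "u (r k)"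
        have "\<bar>E (r k) - 1/2 * ((?y - xb) \<bullet> H (?y - xb))\<bar> \<le> e/2 * ?t\<^sup>2"
          using d0(2)[rule_format, of xb ?y] d0(1) elim by (simp add: dist_commute vb_eq E_def t_def)
        also have "(?y - xb) \<bullet> H (?y - xb) = ?t\<^sup>2 * (?u \<bullet> H ?u)"
          unfolding xu by (simp add: linear_scale[OF linear_H] power2_eq_square)
        also have "E (r k) - 1/2 * (?t\<^sup>2 * (?u \<bullet> H ?u)) = ?t\<^sup>2 * (E (r k) / ?t\<^sup>2 - 1/2 * (?u \<bullet> H ?u))"
          using t[of "r k"] by (simp add: algebra_simps)
        finally have "?t\<^sup>2 * \<bar>E (r k) / ?t\<^sup>2 - 1/2 * (?u \<bullet> H ?u)\<bar> \<le> ?t\<^sup>2 * (e / 2)"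
          by (simp add: abs_mult mult.commute)
        then have "\<bar>E (r k) / ?t\<^sup>2 - 1/2 * (?u \<bullet> H ?u)\<bar> \<le> e / 2"
          using t[of "r k"] by (simp add: mult_le_cancel_left_pos)
        then show ?case using \<open>e > 0\<close> by simp
      qed
    qed
    have d2: "(\<lambda>k. 1/2 * (u (r k) \<bullet> H (u (r k)))) \<longlonglongrightarrow> 1/2 * (uu \<bullet> H uu)"
      by (intro tendsto_intros lu isCont_tendsto_compose[OF contH lu])
    show ?thesis using tendsto_add[OF d1 d2] by simp
  qed
  \<comment> \<open>The inequality between the objectives says that the excess of \<open>m\<close>
    over its minorant with slope \<open>lamb\<close> is at most \<open>- E k\<close>. Nonnegativity
    of that excess gives one bound, active pieces below \<open>m\<close> the other.\<close>
  have br: "a i \<bullet> f k - lamb \<bullet> f k \<le> - E k" "0 \<le> - E k" if i: "i \<in> K zb" for i k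
  proof -
    have 1: "m (\<Phi> (x k, wb)) - m zb - lamb \<bullet> f k \<le> - E k"
      using x(4)[of k] by (simp add: obj_def E_def f_def zb_eq inner_diff_right)
    have "m zb + lamb \<bullet> f k \<le> m (\<Phi> (x k, wb))"
      using lamb x(3)[of k] unfolding subdifferential_iff f_def by blast
    with 1 show "0 \<le> - E k" by simp
    have "a i \<bullet> f k \<le> m (\<Phi> (x k, wb)) - m zb"
      using m_ge[of i "\<Phi> (x k, wb)"] i by (simp add: K_iff f_def inner_diff_right)
    with 1 show "a i \<bullet> f k - lamb \<bullet> f k \<le> - E k" by simp
  qed
  obtain i0 where i0: "i0 \<in> K zb" by (rule K_nonempty)
  have "1/2 * (uu \<bullet> H uu) \<le> 0"
    using lE by (rule tendsto_upperbound) (use br(2)[OF i0] in \<open>auto intro!: always_eventually divide_nonpos_nonneg\<close>)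
  moreover have "A uu \<in> G"
    unfolding G_def
  proof (intro CollectI conjI ballI)
    fix i assume i: "i \<in> K zb"
    \<comment> \<open>Divided by \<open>t\<close> the bound \<open>- E\<close> vanishes in the
      limit, because \<open>E\<close> is of order \<open>t\<close> squared.\<close>
    have "(\<lambda>k. t (r k) * (E (r k) / (t (r k))\<^sup>2)) \<longlonglongrightarrow> 0 * (1/2 * (uu \<bullet> H uu))"
      by (intro tendsto_mult ltr lE)
    from tendsto_minus[OF this] have l0: "(\<lambda>k. - (t (r k) * (E (r k) / (t (r k))\<^sup>2))) \<longlonglongrightarrow> 0" by simp
    have l1: "(\<lambda>k. a i \<bullet> ((1 / t (r k)) *\<^sub>R f (r k)) - lamb \<bullet> ((1 / t (r k)) *\<^sub>R f (r k))) \<longlonglongrightarrow> a i \<bullet> A uu - lamb \<bullet> A uu"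
      by (intro tendsto_intros lf)
    have "a i \<bullet> A uu - lamb \<bullet> A uu \<le> 0"
    proof (rule LIMSEQ_le[OF l1 l0], intro exI allI impI)
      fix k
      have "a i \<bullet> f (r k) / t (r k) - lamb \<bullet> f (r k) / t (r k) \<le> - E (r k) / t (r k)"
        unfolding diff_divide_distrib[symmetric] using br(1)[OF i, of "r k"] t[of "r k"]
        by (intro divide_right_mono) auto
      then show "a i \<bullet> ((1 / t (r k)) *\<^sub>R f (r k)) - lamb \<bullet> ((1 / t (r k)) *\<^sub>R f (r k)) \<le> - (t (r k) * (E (r k) / (t (r k))\<^sup>2))"
        using t[of "r k"] by (simp add: power2_eq_square)
    qed
    then show "a i \<bullet> A uu \<le> lamb \<bullet> A uu" by simp
  next
    fix j assume j: "j \<in> I zb"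
    have l1: "(\<lambda>k. d j \<bullet> ((1 / t (r k)) *\<^sub>R f (r k))) \<longlonglongrightarrow> d j \<bullet> A uu"
      by (intro tendsto_intros lf)
    have "d j \<bullet> ((1 / t (r k)) *\<^sub>R f (r k)) \<le> 0" for k
    proof -
      have "d j \<bullet> f (r k) \<le> 0" using x(3)[of "r k"] j by (auto simp: f_def mem_D I_iff inner_diff_right)
      then show ?thesis using t[of "r k"] by (simp add: divide_nonpos_pos)
    qed
    then show "d j \<bullet> A uu \<le> 0" using tendsto_upperbound[OF l1 always_eventually] by auto
  qed
  then have "A uu \<in> N" using G_subset_N by blast
  moreover have "uu \<noteq> 0" using ur(1) by auto
  ultimately show False using ss unfolding ssosc_def by fastforce
qed

text \<open>Compactness of the unit sphere in the critical subspace; if that subspace is trivial,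
  any positive constant serves.\<close>

lemma ssosc_bound:
  assumes ss: ssosc
  shows "\<exists>\<kappa>>0. \<forall>u. A u \<in> N \<longrightarrow> \<kappa> * (norm u)\<^sup>2 \<le> u \<bullet> H u"
proof -
  let ?S = "{u. A u \<in> N} \<inter> sphere 0 1"
  have sub: "subspace {u. A u \<in> N}"
    using linear_subspace_vimage[OF linear_J subspace_N] by (simp add: vimage_def)
  have comp: "compact ?S" by (intro closed_Int_compact closed_subspace sub compact_sphere)
  have contH: "continuous_on X H" for X using linear_H linear_conv_bounded_linear linear_continuous_on by blast
  show ?thesis
  proof (cases "?S = {}")
    case True
    have "u = 0" if "A u \<in> N" for u
    proof (rule ccontr)
      assume "u \<noteq> 0"
      then have "(1 / norm u) *\<^sub>R u \<in> ?S" using subspace_scale[OF sub, of u] that by simp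
      with True show False by blast
    qed
    then have "1 * (norm u)\<^sup>2 \<le> u \<bullet> H u" if "A u \<in> N" for u using that linear_0[OF linear_H] by fastforce
    then show ?thesis by (intro exI[of _ 1]) simp
  next
    case False
    have "continuous_on ?S (\<lambda>u. u \<bullet> H u)" by (intro continuous_intros contH)
    from continuous_attains_inf[OF comp False this] obtain u0 where u0: "u0 \<in> ?S" "\<And>u. u \<in> ?S \<Longrightarrow> u0 \<bullet> H u0 \<le> u \<bullet> H u"
      by blast
    have pos: "u0 \<bullet> H u0 > 0" using ss u0(1) unfolding ssosc_def by auto
    have "u0 \<bullet> H u0 * (norm u)\<^sup>2 \<le> u \<bullet> H u" if "A u \<in> N" for u
    proof (cases "u = 0")
      case False
      let ?n = "(1 / norm u) *\<^sub>R u"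
      have "?n \<in> ?S" using subspace_scale[OF sub, of u] that False by simp
      from u0(2)[OF this] have "u0 \<bullet> H u0 \<le> (u \<bullet> H u) / (norm u)\<^sup>2"
        by (simp add: linear_scale[OF linear_H] power2_eq_square)
      then show ?thesis using False by (simp add: field_simps)
    qed (simp add: linear_0[OF linear_H])
    with pos show ?thesis by blast
  qed
qed

end

section \<open>Existence of KKT pairs and the Lipschitz estimate\<close>

context composite_nd begin

text \<open>Subtracting \<open>T (A x - y)\<close> moves the image of \<open>x\<close> to
  \<open>y\<close> up to an element of \<open>S1\<close>, which is contained in
  \<open>N\<close>.\<close>

lemma near_critical_subspace:
  "\<exists>B>0. \<forall>x. \<forall>y\<in>N. \<exists>s. A s \<in> N \<and> norm (x - s) \<le> B * norm (A x - y)"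
proof -
  obtain T where T: "linear T" "\<And>y. A (T y) - y \<in> S1" using right_inverse_exists by metis
  obtain B where B: "B > 0" "\<And>y. norm (T y) \<le> B * norm y" using linear_bounded_pos[OF T(1)] by blast
  have "\<exists>s. A s \<in> N \<and> norm (x - s) \<le> B * norm (A x - y)" if y: "y \<in> N" for x y
  proof (intro exI[of _ "x - T (A x - y)"] conjI)
    have "A (x - T (A x - y)) = y - (A (T (A x - y)) - (A x - y))" by (simp add: blinfun.diff_right)
    then show "A (x - T (A x - y)) \<in> N" using T(2) S1_subset_N y subspace_diff[OF subspace_N] by (metis subsetD)
    show "norm (x - (x - T (A x - y))) \<le> B * norm (A x - y)" using B(2) by simp
  qed
  with B(1) show ?thesis by blast
qed

text \<open>Coercivity at \<open>s\<close> passes to a nearby \<open>u\<close>, with every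
  correction carrying a factor \<rho>; in the application \<rho> is a small multiple of
  \<open>norm u\<close>.\<close>

lemma quadratic_lower_bound:
  assumes \<kappa>: "\<kappa> \<ge> 0" "\<kappa> * (norm s)\<^sup>2 \<le> s \<bullet> H s" and hb: "hb \<ge> 0" "\<And>u. norm (H u) \<le> hb * norm u"
    and \<rho>: "norm (u - s) \<le> \<rho>"
  shows "\<kappa> * (norm u)\<^sup>2 \<le> u \<bullet> H u + 2 * \<kappa> * norm u * \<rho> + hb * \<rho> * (2 * norm u + \<rho>)"
proof -
  let ?\<xi> = "norm u"
  have \<rho>0: "0 \<le> \<rho>" using \<rho> norm_ge_zero order_trans by blast
  have sn: "norm s \<le> ?\<xi> + \<rho>" "?\<xi> - \<rho> \<le> norm s"
    using \<rho> norm_triangle_sub[of s u] norm_triangle_sub[of u s] by (simp_all add: norm_minus_commute)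
  have "?\<xi>\<^sup>2 - 2 * ?\<xi> * \<rho> \<le> (norm s)\<^sup>2"
  proof (cases "\<rho> \<le> ?\<xi>")
    case True
    then have "(?\<xi> - \<rho>)\<^sup>2 \<le> (norm s)\<^sup>2" using sn(2) by (intro power_mono) auto
    moreover have "(?\<xi> - \<rho>)\<^sup>2 = ?\<xi>\<^sup>2 - 2 * ?\<xi> * \<rho> + \<rho>\<^sup>2" by (simp add: power2_diff)
    ultimately show ?thesis using zero_le_power2[of \<rho>] by linarith
  next
    case False
    then have "?\<xi> * ?\<xi> \<le> ?\<xi> * \<rho>" by (intro mult_left_mono) auto
    moreover have "0 \<le> ?\<xi> * \<rho>" using \<rho>0 by simp
    ultimately show ?thesis using zero_le_power2[of "norm s"] unfolding power2_eq_square[of ?\<xi>] by linarith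
  qed
  then have "\<kappa> * (?\<xi>\<^sup>2 - 2 * ?\<xi> * \<rho>) \<le> \<kappa> * (norm s)\<^sup>2" using \<kappa>(1) by (rule mult_left_mono)
  also have "\<dots> \<le> s \<bullet> H s" by (rule \<kappa>(2))
  also have "s \<bullet> H s = u \<bullet> H u - (u - s) \<bullet> H u - s \<bullet> H (u - s)"
    by (simp add: linear_diff[OF linear_H] inner_diff_left inner_diff_right)
  also have "\<dots> \<le> u \<bullet> H u + \<rho> * (hb * ?\<xi>) + (?\<xi> + \<rho>) * (hb * \<rho>)"
  proof -
    have "\<bar>(u - s) \<bullet> H u\<bar> \<le> \<rho> * (hb * ?\<xi>)"
      by (intro order_trans[OF Cauchy_Schwarz_ineq2] mult_mono \<rho> hb \<rho>0) auto
    moreover have "norm (H (u - s)) \<le> hb * \<rho>"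
      by (rule order_trans[OF hb(2)]) (intro mult_left_mono \<rho> hb(1))
    then have "\<bar>s \<bullet> H (u - s)\<bar> \<le> (?\<xi> + \<rho>) * (hb * \<rho>)"
      by (intro order_trans[OF Cauchy_Schwarz_ineq2] mult_mono sn) (auto simp: \<rho>0)
    ultimately show ?thesis by linarith
  qed
  finally show ?thesis by (simp add: algebra_simps)
qed

text \<open>The multipliers stay near \<open>lamb\<close>, so both \<open>\<Phi> q - zb\<close> and \<open>\<Phi> q' - zb\<close> lie in \<open>G\<close> and their difference in
  \<open>N\<close>, where \<open>H\<close> is positive definite; monotonicity of the subdifferential does the rest. All error terms
  are small compared with the difference of the points unless the parameters dominate it.\<close>

lemma kkt_lipschitz:
  assumes ss: ssosc
  shows "\<exists>L\<ge>0. \<exists>\<delta>>0. \<forall>q\<in>ball q0 \<delta>. \<forall>q'\<in>ball q0 \<delta>. \<forall>y\<in>ball lamb \<delta>. \<forall>y'\<in>ball lamb \<delta>. \<forall>v v'.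
    kkt v q y \<longrightarrow> kkt v' q' y' \<longrightarrow>
    norm (fst q - fst q') + norm (y - y') \<le> L * (norm (snd q - snd q') + norm (v - v'))"
proof -
  obtain \<kappa> where \<kappa>: "\<kappa> > 0" "\<And>u. A u \<in> N \<Longrightarrow> \<kappa> * (norm u)\<^sup>2 \<le> u \<bullet> H u" using ssosc_bound[OF ss] by blast
  obtain B where B: "B > 0" "\<And>x y. y \<in> N \<Longrightarrow> \<exists>s. A s \<in> N \<and> norm (x - s) \<le> B * norm (A x - y)"
    using near_critical_subspace by blast
  obtain hb where hb: "hb > 0" "\<And>u. norm (H u) \<le> hb * norm u" using linear_bounded_pos[OF linear_H] by blast
  obtain C0 where C0: "C0 > 0" "\<And>s. s \<in> S0 \<Longrightarrow> norm s \<le> C0 * norm (Jt q0 s)" using Jt_injective_bound by blast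
  obtain C1 where C1: "C1 \<ge> 0" "\<And>e. e > 0 \<Longrightarrow> \<exists>\<delta>>0. \<forall>q\<in>ball q0 \<delta>. \<forall>q'\<in>ball q0 \<delta>.
     norm (\<Phi> q - \<Phi> q' - A (fst q - fst q')) \<le> e * norm (fst q - fst q') + C1 * norm (snd q - snd q')"
    using strict_\<Phi> unfolding strict_partial_def by blast
  obtain C2 where C2: "C2 \<ge> 0" "\<And>e. e > 0 \<Longrightarrow> \<exists>\<delta>>0. \<forall>q\<in>ball q0 \<delta>. \<forall>q'\<in>ball q0 \<delta>.
     norm (gradL q - gradL q' - H (fst q - fst q')) \<le> e * norm (fst q - fst q') + C2 * norm (snd q - snd q')"
    using strict_L unfolding strict_partial_def by blast
  obtain CJ' d0 where CJ': "d0 > 0" "\<And>q q'. q\<in>ball q0 d0 \<Longrightarrow> q'\<in>ball q0 d0 \<Longrightarrow> norm (J q - J q') \<le> CJ' * norm (q - q')"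
    using lip_J by blast
  define CJ where "CJ = \<bar>CJ'\<bar> + 1"
  have CJ: "CJ > 0" "CJ' \<le> CJ" by (auto simp: CJ_def)
  \<comment> \<open>The constant in \<open>\<eta> \<le> P1 * (\<xi> + \<sigma>)\<close>; its factor
    2 comes from absorbing \<open>e * C0 * \<eta>\<close>, at most half of \<eta>.\<close>
  define P1 where "P1 = 2 * C0 * (hb + C2 + 3)"
  define B1 where "B1 = B * (1 + C1)"
  \<comment> \<open>The sum of the coefficients of \<open>e * \<xi>\<^sup>2\<close> in the final
    estimate. With \<open>e * M < \<kappa>\<close> that estimate contradicts coercivity.\<close>
  define M where "M = 1 + 2 * \<kappa> * B1 + hb * B1 * (2 + B1) + 2 * P1 * (1 + C1) + (2 + 2 * P1 + (C2 + 1))"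
  have P1: "P1 > 0" using C0 hb C2 by (simp add: P1_def)
  have B1: "B1 > 0" using B C1 by (simp add: B1_def)
  have M: "M > 0" unfolding M_def using \<kappa> B1 hb P1 C1 C2 by (intro add_pos_nonneg add_nonneg_nonneg mult_nonneg_nonneg) auto
  define e where "e = min 1 (min (1 / (2 * C0)) (\<kappa> / (2 * M)))"
  have e: "e > 0" "e \<le> 1" "e * C0 \<le> 1/2" "e * M < \<kappa>"
  proof -
    show "e > 0" "e \<le> 1" using C0 \<kappa> M by (auto simp: e_def)
    have "e * C0 \<le> 1 / (2 * C0) * C0" using C0 by (intro mult_right_mono) (auto simp: e_def)
    then show "e * C0 \<le> 1/2" using C0 by simp
    have "e * M \<le> \<kappa> / (2 * M) * M" using M by (intro mult_right_mono) (auto simp: e_def)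
    then show "e * M < \<kappa>" using M \<kappa> by simp
  qed
  obtain d1 where d1: "d1 > 0" "\<And>q q'. q\<in>ball q0 d1 \<Longrightarrow> q'\<in>ball q0 d1 \<Longrightarrow>
     norm (\<Phi> q - \<Phi> q' - A (fst q - fst q')) \<le> e * norm (fst q - fst q') + C1 * norm (snd q - snd q')"
    using C1(2)[OF e(1)] by blast
  obtain d2 where d2: "d2 > 0" "\<And>q q'. q\<in>ball q0 d2 \<Longrightarrow> q'\<in>ball q0 d2 \<Longrightarrow>
     norm (gradL q - gradL q' - H (fst q - fst q')) \<le> e * norm (fst q - fst q') + C2 * norm (snd q - snd q')"
    using C2(2)[OF e(1)] by blast
  obtain \<rho> where \<rho>: "\<rho> > 0" and ev: "\<forall>\<^sub>F q in nhds q0. subdifferential \<theta> (\<Phi> q) \<subseteq> subdifferential \<theta> zb \<and>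
      (\<forall>v\<in>subdifferential \<theta> (\<Phi> q). norm (v - lamb) < \<rho> \<longrightarrow> lamb \<in> subdifferential \<theta> (\<Phi> q))"
    using eventually_subdifferential by blast
  obtain d3 where d3: "d3 > 0" "\<And>q. q \<in> ball q0 d3 \<Longrightarrow> subdifferential \<theta> (\<Phi> q) \<subseteq> subdifferential \<theta> zb \<and>
      (\<forall>v\<in>subdifferential \<theta> (\<Phi> q). norm (v - lamb) < \<rho> \<longrightarrow> lamb \<in> subdifferential \<theta> (\<Phi> q)) \<and> norm (J q - J q0) < e"
    using eventually_conj[OF ev eventually_close_J[OF e(1)]] unfolding eventually_nhds_metric
    by (auto simp: dist_commute)
  \<comment> \<open>The entry \<open>e / CJ\<close> lets the closeness of \<open>y\<close> to
    \<open>lamb\<close> compensate the Lipschitz constant of the Jacobian in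
    \<open>r2\<close>.\<close>
  define \<delta> where "\<delta> = Min {d0, d1, d2, d3, \<rho>, e / CJ}"
  have \<delta>: "\<delta> > 0" using CJ'(1) d1(1) d2(1) d3(1) \<rho> e(1) CJ(1) by (simp add: \<delta>_def)
  have \<delta>le: "\<delta> \<le> d0" "\<delta> \<le> d1" "\<delta> \<le> d2" "\<delta> \<le> d3" "\<delta> \<le> \<rho>" "\<delta> \<le> e / CJ" 
    unfolding \<delta>_def by (rule Min_le; simp)+
  \<comment> \<open>Obtained by inserting \<open>\<xi> \<le> \<sigma> / e\<close> into
    \<open>\<eta> \<le> P1 * (\<xi> + \<sigma>)\<close> and adding the two.\<close>
  define L where "L = 1 / e + P1 * (1 / e + 1)"
  have "norm (fst q - fst q') + norm (y - y') \<le> L * (norm (snd q - snd q') + norm (v - v'))"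
    if q: "q \<in> ball q0 \<delta>" "q' \<in> ball q0 \<delta>" and y: "y \<in> ball lamb \<delta>" "y' \<in> ball lamb \<delta>"
      and k: "kkt v q y" "kkt v' q' y'" for q q' y y' v v'
  proof -
    define \<Delta>x where "\<Delta>x = fst q - fst q'"
    define \<Delta>y where "\<Delta>y = y - y'"
    define \<Delta>v where "\<Delta>v = v - v'"
    define \<xi> where "\<xi> = norm \<Delta>x"
    define \<eta> where "\<eta> = norm \<Delta>y"
    define \<omega> where "\<omega> = norm (snd q - snd q')"
    define \<sigma> where "\<sigma> = \<omega> + norm \<Delta>v"
    have nn: "0 \<le> \<xi>" "0 \<le> \<eta>" "0 \<le> \<omega>" "\<omega> \<le> \<sigma>" "norm \<Delta>v \<le> \<sigma>" "0 \<le> \<sigma>"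
      by (simp_all add: \<xi>_def \<eta>_def \<omega>_def \<sigma>_def)
    have inb: "q \<in> ball q0 d0" "q' \<in> ball q0 d0" "q \<in> ball q0 d1" "q' \<in> ball q0 d1"
      "q \<in> ball q0 d2" "q' \<in> ball q0 d2" "q \<in> ball q0 d3" "q' \<in> ball q0 d3"
      using q \<delta>le by auto
    have sub: "y \<in> subdifferential \<theta> (\<Phi> q)" "y' \<in> subdifferential \<theta> (\<Phi> q')"
      using k by (auto simp: kkt_def)
    have yn: "norm (y - lamb) < \<delta>" "norm (y' - lamb) < \<delta>" using y by (auto simp: dist_norm norm_minus_commute)
    then have "norm (y - lamb) < \<rho>" "norm (y' - lamb) < \<rho>" using \<delta>le(5) by linarith+
    then have lam: "lamb \<in> subdifferential \<theta> (\<Phi> q)" "lamb \<in> subdifferential \<theta> (\<Phi> q')"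
      using d3(2)[OF inb(7)] d3(2)[OF inb(8)] sub by blast+
    have "y \<in> S0" "y' \<in> S0"
      using d3(2)[OF inb(7)] d3(2)[OF inb(8)] sub subdifferential_subset_S0 by blast+
    then have \<Delta>yS: "\<Delta>y \<in> S0" unfolding \<Delta>y_def by (rule subspace_diff[OF subspace_S0])
    \<comment> \<open>The difference of the KKT equations is linearized in three steps: the
      Lagrangian gradient with frozen multiplier, the change of the Jacobian acting on the small
      vector \<open>y - lamb\<close>, and the replacement of \<open>q'\<close> by \<open>q0\<close>
      in front of the multiplier difference.\<close>
    define r1 where "r1 = gradL q - gradL q' - H \<Delta>x"
    define r2 where "r2 = Jt q (y - lamb) - Jt q' (y - lamb)"
    define r3 where "r3 = Jt q' \<Delta>y - Jt q0 \<Delta>y"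
    define R where "R = r1 + r2 + r3"
    have \<Delta>v_eq: "\<Delta>v = H \<Delta>x + Jt q0 \<Delta>y + R"
      using k unfolding kkt_def by (simp add: R_def r1_def r2_def r3_def \<Delta>v_def \<Delta>y_def linear_diff[OF linear_Jt])
    have r1: "norm r1 \<le> e * \<xi> + C2 * \<omega>" using d2(2)[OF inb(5,6)] by (simp add: r1_def \<xi>_def \<omega>_def \<Delta>x_def)
    have r2: "norm r2 \<le> e * (\<xi> + \<omega>)"
    proof -
      have "norm (q - q') \<le> \<xi> + \<omega>"
        using norm_Pair_le[of "fst (q - q')" "snd (q - q')"] unfolding prod.collapse by (simp add: \<xi>_def \<omega>_def \<Delta>x_def)
      then have "norm (J q - J q') \<le> CJ * (\<xi> + \<omega>)"
        using CJ by (intro order_trans[OF CJ'(2)[OF inb(1,2)]] mult_mono) auto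
      then have "norm (J q - J q') * norm (y - lamb) \<le> CJ * (\<xi> + \<omega>) * (e / CJ)"
        using yn(1) \<delta>le(6) CJ nn by (intro mult_mono) auto
      also have "\<dots> = e * (\<xi> + \<omega>)" using CJ by simp
      finally show ?thesis unfolding r2_def using norm_Jt_diff order_trans by blast
    qed
    have r3: "norm r3 \<le> e * \<eta>"
    proof -
      have "norm r3 \<le> norm (J q' - J q0) * norm \<Delta>y" unfolding r3_def by (rule norm_Jt_diff)
      also have "\<dots> \<le> e * \<eta>" using d3(2)[OF inb(8)] unfolding \<eta>_def by (intro mult_right_mono) auto
      finally show ?thesis .
    qed
    have R: "norm R \<le> 2 * (e * \<xi>) + (C2 + e) * \<omega> + e * \<eta>"
    proof -
      have "norm R \<le> norm r1 + norm r2 + norm r3" 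
        unfolding R_def using norm_triangle_ineq[of "r1 + r2" r3] norm_triangle_ineq[of r1 r2] by linarith
      with r1 r2 r3 show ?thesis by (simp add: algebra_simps)
    qed
    have \<eta>le: "\<eta> \<le> P1 * (\<xi> + \<sigma>)"
    proof -
      have eq: "Jt q0 \<Delta>y = \<Delta>v - H \<Delta>x - R" using \<Delta>v_eq by simp
      have "norm (Jt q0 \<Delta>y) \<le> norm \<Delta>v + norm (H \<Delta>x) + norm R"
        unfolding eq using norm_triangle_ineq4[of "\<Delta>v - H \<Delta>x" R] norm_triangle_ineq4[of \<Delta>v "H \<Delta>x"] by linarith
      also have "\<dots> \<le> \<sigma> + hb * \<xi> + (2 * (e * \<xi>) + (C2 + e) * \<omega> + e * \<eta>)"
        using nn hb(2)[of \<Delta>x] R by (simp add: \<xi>_def)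
      also have "\<dots> \<le> \<sigma> + hb * \<xi> + (2 * (1 * \<xi>) + (C2 + 1) * \<sigma> + e * \<eta>)"
        using nn e C2 hb(1) by (intro add_mono mult_mono) auto
      also have "\<dots> = (hb + 2) * \<xi> + (C2 + 2) * \<sigma> + e * \<eta>" by (simp add: algebra_simps)
      also have "\<dots> \<le> (hb + C2 + 3) * \<xi> + (hb + C2 + 3) * \<sigma> + e * \<eta>"
        using nn hb C2 by (intro add_mono mult_right_mono) auto
      finally have "norm (Jt q0 \<Delta>y) \<le> (hb + C2 + 3) * (\<xi> + \<sigma>) + e * \<eta>" by (simp add: algebra_simps)
      then have "C0 * norm (Jt q0 \<Delta>y) \<le> C0 * ((hb + C2 + 3) * (\<xi> + \<sigma>) + e * \<eta>)" using C0 by simp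
      with C0(2)[OF \<Delta>yS] have "\<eta> \<le> C0 * (hb + C2 + 3) * (\<xi> + \<sigma>) + (e * C0) * \<eta>"
        by (simp add: \<eta>_def algebra_simps)
      also have "(e * C0) * \<eta> \<le> 1/2 * \<eta>" using e nn by (intro mult_right_mono) auto
      finally show ?thesis by (simp add: P1_def)
    qed
    \<comment> \<open>If this failed, the change of the parameters would be below
      \<open>e * \<xi>\<close>, and every error term below would be at most a multiple of
      \<open>e * \<xi>\<close>.\<close>
    have \<xi>le: "\<xi> \<le> \<sigma> / e"
    proof (rule ccontr)
      assume "\<not> ?thesis"
      then have \<sigma>\<xi>: "\<sigma> < e * \<xi>" using e by (simp add: field_simps)
      then have \<xi>0: "\<xi> > 0" using nn by (cases "\<xi> = 0") auto
      have e\<xi>: "e * \<xi> \<le> \<xi>" using e nn by (simp add: mult_left_le_one_le)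
      have \<omega>e: "\<omega> \<le> e * \<xi>" and ve: "norm \<Delta>v \<le> e * \<xi>" and \<omega>\<xi>: "\<omega> \<le> \<xi>" using nn \<sigma>\<xi> e\<xi> by auto
      have \<eta>2: "\<eta> \<le> 2 * P1 * \<xi>"
      proof -
        have "P1 * (\<xi> + \<sigma>) \<le> P1 * (2 * \<xi>)" using P1 \<sigma>\<xi> e\<xi> by (intro mult_left_mono) auto
        with \<eta>le show ?thesis by simp
      qed
      let ?\<Delta>z = "\<Phi> q - \<Phi> q'"
      have zN: "?\<Delta>z \<in> N"
        using subspace_diff[OF subspace_N, of "\<Phi> q - zb" "\<Phi> q' - zb"] G_subset_N
          G_of_subdifferential(1)[OF lam(1)] G_of_subdifferential(1)[OF lam(2)] by auto
      have za: "norm (?\<Delta>z - A \<Delta>x) \<le> (1 + C1) * (e * \<xi>)"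
      proof -
        have "norm (?\<Delta>z - A \<Delta>x) \<le> e * \<xi> + C1 * \<omega>" using d1(2)[OF inb(3,4)] by (simp add: \<xi>_def \<omega>_def \<Delta>x_def)
        also have "C1 * \<omega> \<le> C1 * (e * \<xi>)" using C1 \<omega>e by (intro mult_left_mono) auto
        finally show ?thesis by (simp add: algebra_simps)
      qed
      obtain s where s: "A s \<in> N" "norm (\<Delta>x - s) \<le> B * norm (A \<Delta>x - ?\<Delta>z)" using B(2)[OF zN] by blast
      have \<rho>b: "norm (\<Delta>x - s) \<le> B1 * (e * \<xi>)"
      proof -
        have "B * norm (A \<Delta>x - ?\<Delta>z) \<le> B * ((1 + C1) * (e * \<xi>))"
          using za B by (intro mult_left_mono) (auto simp: norm_minus_commute)
        with s(2) show ?thesis by (simp add: B1_def mult.assoc)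
      qed
      let ?\<rho> = "B1 * (e * \<xi>)"
      have mono: "0 \<le> \<Delta>y \<bullet> ?\<Delta>z"
      proof -
        have "m (\<Phi> q) + y \<bullet> (\<Phi> q' - \<Phi> q) \<le> m (\<Phi> q')" "m (\<Phi> q') + y' \<bullet> (\<Phi> q - \<Phi> q') \<le> m (\<Phi> q)"
          using sub by (auto simp: subdifferential_iff)
        then show ?thesis by (simp add: \<Delta>y_def inner_diff_left inner_diff_right)
      qed
      have t1: "\<Delta>v \<bullet> \<Delta>x \<le> e * \<xi> * \<xi>"
        by (intro order_trans[OF norm_cauchy_schwarz] mult_mono ve) (use nn e(1) in \<open>auto simp: \<xi>_def\<close>)
      have t2: "- (\<Delta>y \<bullet> A \<Delta>x) \<le> 2 * P1 * \<xi> * ((1 + C1) * (e * \<xi>))"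
      proof -
        have "- (\<Delta>y \<bullet> A \<Delta>x) \<le> \<Delta>y \<bullet> (?\<Delta>z - A \<Delta>x)" using mono by (simp add: inner_diff_right)
        also have "\<dots> \<le> 2 * P1 * \<xi> * ((1 + C1) * (e * \<xi>))"
          by (intro order_trans[OF norm_cauchy_schwarz] mult_mono za) (use \<eta>2 P1 nn in \<open>auto simp: \<eta>_def\<close>)
        finally show ?thesis .
      qed
      have Rb: "norm R \<le> e * ((2 + 2 * P1 + (C2 + 1)) * \<xi>)"
      proof -
        have "(C2 + e) * \<omega> \<le> (C2 + 1) * (e * \<xi>)" using \<omega>e e C2 nn by (intro mult_mono) auto
        moreover have "e * \<eta> \<le> e * (2 * P1 * \<xi>)" using \<eta>2 e by (intro mult_left_mono) auto
        ultimately have "norm R \<le> 2 * (e * \<xi>) + (C2 + 1) * (e * \<xi>) + e * (2 * P1 * \<xi>)" using R by linarith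
        then show ?thesis by (simp add: algebra_simps)
      qed
      have t3: "- (R \<bullet> \<Delta>x) \<le> e * ((2 + 2 * P1 + (C2 + 1)) * \<xi>) * \<xi>"
      proof -
        have "- (R \<bullet> \<Delta>x) \<le> norm R * norm \<Delta>x" using Cauchy_Schwarz_ineq2[of R \<Delta>x] by linarith
        also have "\<dots> \<le> e * ((2 + 2 * P1 + (C2 + 1)) * \<xi>) * \<xi>" unfolding \<xi>_def[symmetric] using Rb nn by (intro mult_right_mono) auto
        finally show ?thesis .
      qed
      have "\<Delta>v \<bullet> \<Delta>x = \<Delta>x \<bullet> H \<Delta>x + \<Delta>y \<bullet> A \<Delta>x + R \<bullet> \<Delta>x"
        unfolding \<Delta>v_eq inner_add_left Jt_inner(1) inner_commute[of "H \<Delta>x"] ..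
      then have xH: "\<Delta>x \<bullet> H \<Delta>x \<le> e * \<xi> * \<xi> + 2 * P1 * \<xi> * ((1 + C1) * (e * \<xi>)) + e * ((2 + 2 * P1 + (C2 + 1)) * \<xi>) * \<xi>"
        using t1 t2 t3 by linarith
      have "\<kappa> * \<xi>\<^sup>2 \<le> \<Delta>x \<bullet> H \<Delta>x + 2 * \<kappa> * \<xi> * ?\<rho> + hb * ?\<rho> * (2 * \<xi> + ?\<rho>)"
        unfolding \<xi>_def
        by (rule quadratic_lower_bound[where s = s]) (use \<kappa> s hb \<rho>b in \<open>auto simp: \<xi>_def\<close>)
      also have "hb * ?\<rho> * (2 * \<xi> + ?\<rho>) \<le> hb * ?\<rho> * (2 * \<xi> + B1 * \<xi>)"
        using hb B1 e nn e\<xi> by (intro mult_left_mono add_left_mono) auto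
      finally have "\<kappa> * \<xi>\<^sup>2 \<le> e * \<xi> * \<xi> + 2 * P1 * \<xi> * ((1 + C1) * (e * \<xi>)) + e * ((2 + 2 * P1 + (C2 + 1)) * \<xi>) * \<xi>
          + 2 * \<kappa> * \<xi> * ?\<rho> + hb * ?\<rho> * (2 * \<xi> + B1 * \<xi>)" using xH by linarith
      also have "\<dots> = e * M * \<xi>\<^sup>2" by (simp add: M_def power2_eq_square algebra_simps)
      finally have "\<kappa> \<le> e * M" using \<xi>0 by simp
      with e(4) show False by simp
    qed
    have "\<xi> + \<eta> \<le> \<sigma> / e + P1 * (\<sigma> / e + \<sigma>)"
    proof -
      have "P1 * (\<xi> + \<sigma>) \<le> P1 * (\<sigma> / e + \<sigma>)" using P1 \<xi>le by (intro mult_left_mono) auto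
      then show ?thesis using \<xi>le \<eta>le by linarith
    qed
    also have "\<dots> = L * \<sigma>" by (simp add: L_def algebra_simps)
    finally show ?thesis by (simp add: \<xi>_def \<eta>_def \<sigma>_def \<omega>_def \<Delta>x_def \<Delta>y_def \<Delta>v_def)
  qed
  moreover have "L \<ge> 0" using e P1 by (simp add: L_def)
  ultimately show ?thesis using \<delta> by blast
qed

text \<open>The perturbed minimizer lies in the interior of the ball over which it minimizes, so it
  is a free local minimizer and has a multiplier, which is close to \<open>lamb\<close>.\<close>

lemma kkt_exists:
  assumes \<gamma>: "\<gamma> > 0" "cball xb \<gamma> \<times> cball wb \<gamma> \<subseteq> Om" and r: "r > 0"
    and strict: "\<And>x. x \<in> cball xb \<gamma> \<Longrightarrow> x \<noteq> xb \<Longrightarrow> \<Phi> (x, wb) \<in> D \<Longrightarrow> obj vb q0 < obj vb (x, wb)"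
  shows "\<exists>s>0. \<forall>w\<in>ball wb s. \<forall>v\<in>ball vb s. \<exists>x\<in>ball xb r. \<exists>y\<in>ball lamb r. kkt v (x, w) y \<and> \<Phi> (x, w) \<in> D \<and>
    (\<forall>x'\<in>cball xb \<gamma>. \<Phi> (x', w) \<in> D \<longrightarrow> obj v (x, w) \<le> obj v (x', w))"
proof -
  obtain \<delta>1 where \<delta>1: "\<delta>1 > 0" and mc: "\<forall>\<^sub>F q in nhds q0. \<forall>v y. norm (v - vb) < \<delta>1 \<longrightarrow> kkt v q y \<longrightarrow> norm (y - lamb) < r"
    using multiplier_close[OF r] by blast
  obtain d where d: "d > 0" and near: "\<And>q. dist q q0 < d \<Longrightarrow>
      (\<forall>v y. norm (v - vb) < \<delta>1 \<longrightarrow> kkt v q y \<longrightarrow> norm (y - lamb) < r) \<and>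
      (\<forall>v. \<Phi> q \<in> D \<longrightarrow> (\<exists>r>0. \<forall>y\<in>ball (fst q) r. \<Phi> (y, snd q) \<in> D \<longrightarrow> obj v q \<le> obj v (y, snd q)) \<longrightarrow> (\<exists>y. kkt v q y))"
    using eventually_conj[OF mc local_minimizer_kkt] unfolding eventually_nhds_metric by blast
  \<comment> \<open>With \<open>e \<le> \<gamma> / 2\<close> a ball of radius
    \<open>\<gamma> / 2\<close> around the minimizer stays in
    \<open>cball xb \<gamma>\<close>.\<close>
  define e where "e = min r (min (\<gamma> / 2) (d / 2))"
  have e: "e > 0" using r \<gamma> d by (simp add: e_def)
  obtain \<delta>2 where \<delta>2: "\<delta>2 > 0" "\<And>w v. w \<in> ball wb \<delta>2 \<Longrightarrow> v \<in> ball vb \<delta>2 \<Longrightarrow> \<exists>x\<in>ball xb e. x \<in> cball xb \<gamma> \<and> \<Phi> (x, w) \<in> D \<and>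
    (\<forall>y\<in>cball xb \<gamma>. \<Phi> (y, w) \<in> D \<longrightarrow> obj v (x, w) \<le> obj v (y, w))"
    using perturbed_minimizer[OF \<gamma> e strict] by blast
  define s where "s = min \<delta>2 (min \<delta>1 (d / 2))"
  have "\<exists>x\<in>ball xb r. \<exists>y\<in>ball lamb r. kkt v (x, w) y \<and> \<Phi> (x, w) \<in> D \<and>
      (\<forall>x'\<in>cball xb \<gamma>. \<Phi> (x', w) \<in> D \<longrightarrow> obj v (x, w) \<le> obj v (x', w))"
    if w: "w \<in> ball wb s" and v: "v \<in> ball vb s" for w v
  proof -
    obtain x where x: "x \<in> ball xb e" "\<Phi> (x, w) \<in> D" "\<And>y. y \<in> cball xb \<gamma> \<Longrightarrow> \<Phi> (y, w) \<in> D \<Longrightarrow> obj v (x, w) \<le> obj v (y, w)"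
      using \<delta>2(2)[of w v] w v by (auto simp: s_def)
    have "dist (x, w) q0 \<le> norm (x - xb) + norm (w - wb)" unfolding dist_norm by (simp add: norm_Pair_le)
    also have "\<dots> < d" using x(1) w by (simp add: e_def s_def dist_norm norm_minus_commute)
    finally have n: "dist (x, w) q0 < d" .
    have sub: "ball x (\<gamma> / 2) \<subseteq> cball xb \<gamma>"
    proof
      fix y assume "y \<in> ball x (\<gamma> / 2)"
      then show "y \<in> cball xb \<gamma>" using x(1) dist_triangle[of xb y x] by (simp add: e_def)
    qed
    have "\<exists>r>0. \<forall>y\<in>ball x r. \<Phi> (y, w) \<in> D \<longrightarrow> obj v (x, w) \<le> obj v (y, w)"
      by (rule exI[of _ "\<gamma> / 2"]) (use sub x(3) \<gamma> in auto)
    then obtain y where y: "kkt v (x, w) y" using near[OF n] x(2) unfolding fst_conv snd_conv by blast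
    have "norm (v - vb) < \<delta>1" using v by (simp add: s_def dist_norm norm_minus_commute)
    then have "norm (y - lamb) < r" using near[OF n] y by blast
    then have "y \<in> ball lamb r" by (simp add: dist_norm norm_minus_commute)
    moreover have "x \<in> ball xb r" using x(1) by (simp add: e_def)
    ultimately show ?thesis using x y by blast
  qed
  then show ?thesis using \<delta>2(1) \<delta>1 d by (intro exI[of _ s]) (auto simp: s_def)
qed

end

section \<open>Localizations of the KKT map\<close>

lemma dist_pair_le: "dist (x, w) (x', w') \<le> dist x x' + dist w w'"
  unfolding dist_Pair_Pair by (rule sqrt_sum_squares_le_sum) simp_all

context composite begin

lemma Om_box: "\<exists>\<gamma>>0. cball xb \<gamma> \<times> cball wb \<gamma> \<subseteq> Om"
proof -
  obtain d where d: "d > 0" "ball q0 d \<subseteq> Om" using open_Om q0_Om open_contains_ball by blast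
  have "cball xb (d / 3) \<times> cball wb (d / 3) \<subseteq> ball q0 d"
  proof
    fix q assume "q \<in> cball xb (d / 3) \<times> cball wb (d / 3)"
    then obtain x w where q: "q = (x, w)" "dist xb x \<le> d / 3" "dist wb w \<le> d / 3" by auto
    then show "q \<in> ball q0 d" using d(1) dist_pair_le[of xb wb x w] by simp
  qed
  with d show ?thesis by (intro exI[of _ "d / 3"]) auto
qed

text \<open>Only points over \<open>Om\<close> are prescribed, since \<open>g\<phi>\<close> and
  \<open>J\<close> are known to be derivatives only there.\<close>

definition kkt_map :: "('w \<times> 'x \<Rightarrow> ('x \<times> 'm) set) \<Rightarrow> bool" where
  "kkt_map F \<longleftrightarrow> (\<forall>x w v y. (x, w) \<in> Om \<longrightarrow> ((x, y) \<in> F (w, v) \<longleftrightarrow> kkt v (x, w) y))"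

text \<open>Reduces a localization to what the converse uses: uniqueness of KKT pairs in product
  balls, and a positive Lipschitz constant in \<open>v\<close> at the fixed parameter
  \<open>wb\<close>.\<close>

lemma localization_unique:
  assumes loc: "lipschitz_localization F (wb, vb) (xb, lamb)" and F: "kkt_map F"
  shows "\<exists>r>0. \<exists>L>0. \<exists>g. (\<forall>w\<in>ball wb r. \<forall>v\<in>ball vb r. \<forall>x\<in>ball xb r. \<forall>y\<in>ball lamb r. kkt v (x, w) y \<longrightarrow> g (w, v) = (x, y)) \<and>
     (\<forall>v\<in>ball vb r. \<forall>v'\<in>ball vb r. dist (g (wb, v)) (g (wb, v')) \<le> L * dist v v')"
proof -
  obtain U V g L where loc: "(wb, vb) \<in> interior U" "(xb, lamb) \<in> interior V" "L-lipschitz_on U g"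
     "{(s, t). t \<in> F s} \<inter> (U \<times> V) = {(s, g s) |s. s \<in> U}"
    using loc unfolding lipschitz_localization_def by blast
  obtain e1 where e1: "e1 > 0" "ball (wb, vb) e1 \<subseteq> U" using loc(1) mem_interior by blast
  obtain e2 where e2: "e2 > 0" "ball (xb, lamb) e2 \<subseteq> V" using loc(2) mem_interior by blast
  obtain \<gamma> where \<gamma>: "\<gamma> > 0" "cball xb \<gamma> \<times> cball wb \<gamma> \<subseteq> Om" using Om_box by blast
  define r where "r = min \<gamma> (min (e1 / 2) (e2 / 2))"
  have r: "r > 0" using e1 e2 \<gamma> by (simp add: r_def)
  have inU: "(w, v) \<in> U" if "w \<in> ball wb r" "v \<in> ball vb r" for w v
    using that dist_pair_le[of wb vb w v] by (intro subsetD[OF e1(2)]) (auto simp: r_def)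
  have inV: "(x, y) \<in> V" if "x \<in> ball xb r" "y \<in> ball lamb r" for x y
    using that dist_pair_le[of xb lamb x y] by (intro subsetD[OF e2(2)]) (auto simp: r_def)
  have "g (w, v) = (x, y)"
    if w: "w \<in> ball wb r" "v \<in> ball vb r" and x: "x \<in> ball xb r" "y \<in> ball lamb r" and k: "kkt v (x, w) y" for w v x y
  proof -
    have "(x, w) \<in> Om" using x(1) w(1) \<gamma>(2) by (auto simp: r_def)
    then have "(x, y) \<in> F (w, v)" using F k unfolding kkt_map_def by blast
    then have "((w, v), (x, y)) \<in> {(s, t). t \<in> F s} \<inter> (U \<times> V)" using inU[OF w] inV[OF x] by blast
    then show ?thesis unfolding loc(4) by auto
  qed
  moreover have "dist (g (wb, v)) (g (wb, v')) \<le> (\<bar>L\<bar> + 1) * dist v v'" if "v \<in> ball vb r" "v' \<in> ball vb r" for v v'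
  proof -
    have "dist (g (wb, v)) (g (wb, v')) \<le> L * dist (wb, v) (wb, v')"
      using lipschitz_onD[OF loc(3)] inU that r by simp
    also have "\<dots> \<le> (\<bar>L\<bar> + 1) * dist v v'" unfolding dist_Pair_Pair by (intro mult_mono) auto
    finally show ?thesis .
  qed
  ultimately show ?thesis using r by (intro exI[of _ r] conjI exI[of _ "\<bar>L\<bar> + 1"] exI[of _ g]) auto
qed

text \<open>Along a segment into the relative interior of the subdifferential the multiplier is not unique
  for the perturbed \<open>v\<close> as soon as some \<open>s\<close> in \<open>S0\<close> is annihilated by \<open>Jt q0\<close>.\<close>

lemma nd_of_localization:
  assumes loc: "lipschitz_localization F (wb, vb) (xb, lamb)" and F: "kkt_map F"
    and s: "s \<in> S0" "Jt q0 s = 0"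
  shows "s = 0"
proof -
  obtain r g where r: "r > 0" and u: "\<And>w v x y. w \<in> ball wb r \<Longrightarrow> v \<in> ball vb r \<Longrightarrow> x \<in> ball xb r \<Longrightarrow> y \<in> ball lamb r \<Longrightarrow>
     kkt v (x, w) y \<Longrightarrow> g (w, v) = (x, y)"
    using localization_unique[OF loc F] by blast
  let ?P = "subdifferential \<theta> zb"
  have "rel_interior ?P \<noteq> {}" using lamb convex_subdifferential by (metis empty_iff rel_interior_eq_empty)
  then obtain y1 where y1: "y1 \<in> rel_interior ?P" by blast
  obtain bt where bt: "bt > 0" "\<And>y. norm (Jt q0 y) \<le> bt * norm y" using linear_bounded_pos[OF linear_Jt] by blast
  \<comment> \<open>\<open>t * c\<close> dominates both the displacement of the multiplier and its
    image under \<open>Jt q0\<close>, so one choice of \<open>t\<close> keeps \<open>y\<close> near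
    \<open>lamb\<close> and the induced \<open>v\<close> near \<open>vb\<close>.\<close>
  define c where "c = (bt + 1) * (norm (y1 - lamb) + 1)"
  have c: "c > 0" unfolding c_def using bt by (intro mult_pos_pos) (auto simp: add_nonneg_pos)
  define t where "t = min 1 (r / (2 * c))"
  have t: "0 < t" "t \<le> 1" using r c by (auto simp: t_def)
  have tc: "t * c < r"
  proof -
    have "t * c \<le> r / (2 * c) * c" using c by (intro mult_right_mono) (auto simp: t_def)
    then show ?thesis using c r by simp
  qed
  define y where "y = lamb - t *\<^sub>R (lamb - y1)"
  have yr: "y \<in> rel_interior ?P"
    unfolding y_def by (rule rel_interior_convex_shrink[OF convex_subdifferential y1 lamb t])
  have yd: "y - lamb = t *\<^sub>R (y1 - lamb)" by (simp add: y_def algebra_simps)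
  have ny: "norm (y - lamb) * (bt + 1) < r"
  proof -
    have "norm (y1 - lamb) * (bt + 1) \<le> c" using bt by (simp add: c_def algebra_simps)
    then have "t * (norm (y1 - lamb) * (bt + 1)) \<le> t * c" using t by (intro mult_left_mono) auto
    moreover have "norm (y - lamb) * (bt + 1) = t * (norm (y1 - lamb) * (bt + 1))" using t by (simp add: yd)
    ultimately show ?thesis using tc by linarith
  qed
  have nyr: "norm (y - lamb) < r" "bt * norm (y - lamb) < r"
    using ny bt by (auto simp: algebra_simps) (smt (verit) norm_ge_zero mult_nonneg_nonneg)+
  obtain e where e: "e > 0" "ball y e \<inter> affine hull ?P \<subseteq> ?P" using yr by (auto simp: mem_rel_interior_ball)
  \<comment> \<open>A step along \<open>s\<close> this short stays in the relative neighbourhood of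
    \<open>y\<close> inside the subdifferential and in the ball of radius \<open>r\<close> around
    \<open>lamb\<close>.\<close>
  define k where "k = min (e / 2) ((r - norm (y - lamb)) / 2) / (norm s + 1)"
  have ns: "norm s + 1 > 0" by (simp add: add_nonneg_pos)
  have k: "k > 0" using e nyr ns by (simp add: k_def)
  have kn: "k * norm s < e" "k * norm s < r - norm (y - lamb)"
  proof -
    have "k * norm s \<le> k * (norm s + 1)" using k by (intro mult_left_mono) auto
    also have "\<dots> = min (e / 2) ((r - norm (y - lamb)) / 2)" using ns by (simp add: k_def)
    finally show "k * norm s < e" "k * norm s < r - norm (y - lamb)" using e nyr by auto
  qed
  let ?y' = "y + k *\<^sub>R s"
  have yP: "y \<in> ?P" using yr rel_interior_subset by blast
  have "?y' \<in> S0" using yP subdifferential_subset_S0 s(1) subspace_S0 by (blast intro: subspace_add subspace_scale)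
  moreover have "?y' \<in> ball y e" using kn(1) k by (simp add: dist_norm)
  ultimately have y'P: "?y' \<in> ?P" using e(2) unfolding S0_def by blast
  let ?v = "g\<phi> q0 + Jt q0 y"
  have "kkt ?v q0 y" "kkt ?v q0 ?y'"
    using yP y'P s(2) by (simp_all add: kkt_def zb_eq linear_add[OF linear_Jt] linear_scale[OF linear_Jt])
  moreover have "?v \<in> ball vb r"
  proof -
    have "norm (?v - vb) = norm (Jt q0 (y - lamb))" by (simp add: vb_eq linear_diff[OF linear_Jt])
    then show ?thesis using bt(2)[of "y - lamb"] nyr(2) by (simp add: dist_norm norm_minus_commute)
  qed
  moreover have "y \<in> ball lamb r" using nyr by (simp add: dist_norm norm_minus_commute)
  moreover have "?y' \<in> ball lamb r"
  proof -
    have "norm (?y' - lamb) \<le> norm (y - lamb) + norm (k *\<^sub>R s)"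
      using norm_triangle_ineq[of "y - lamb" "k *\<^sub>R s"] by (simp add: algebra_simps)
    then have "norm (?y' - lamb) < r" using kn(2) k by simp
    then show ?thesis unfolding mem_ball by (subst dist_commute) (simp only: dist_norm)
  qed
  ultimately have "(xb, y) = (xb, ?y')" using u[of wb ?v xb y] u[of wb ?v xb ?y'] r by simp
  then show ?thesis using k by simp
qed

end

context composite_nd begin

text \<open>Existence comes from perturbed minimizers, while \<open>kkt_lipschitz\<close> yields the
  Lipschitz bound and, applied with equal parameters, uniqueness.\<close>

lemma localization_of_ssosc:
  assumes ss: ssosc and F: "kkt_map F"
  shows "lipschitz_localization F (wb, vb) (xb, lamb)"
proof -
  obtain \<gamma>1 where \<gamma>1: "\<gamma>1 > 0" "\<forall>x\<in>cball xb \<gamma>1. x \<noteq> xb \<longrightarrow> \<Phi> (x, wb) \<in> D \<longrightarrow> obj vb q0 < obj vb (x, wb)"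
    using strict_minimizer[OF ss] by blast
  obtain \<gamma>2 where \<gamma>2: "\<gamma>2 > 0" "cball xb \<gamma>2 \<times> cball wb \<gamma>2 \<subseteq> Om" using Om_box by blast
  define \<gamma> where "\<gamma> = min \<gamma>1 \<gamma>2"
  have \<gamma>: "\<gamma> > 0" "cball xb \<gamma> \<times> cball wb \<gamma> \<subseteq> Om"
    "\<And>x. x \<in> cball xb \<gamma> \<Longrightarrow> x \<noteq> xb \<Longrightarrow> \<Phi> (x, wb) \<in> D \<Longrightarrow> obj vb q0 < obj vb (x, wb)"
  proof -
    have "cball xb \<gamma> \<subseteq> cball xb \<gamma>2" "cball wb \<gamma> \<subseteq> cball wb \<gamma>2" "cball xb \<gamma> \<subseteq> cball xb \<gamma>1"
      by (auto simp: \<gamma>_def)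
    with \<gamma>1 \<gamma>2 show "cball xb \<gamma> \<times> cball wb \<gamma> \<subseteq> Om"
      "\<And>x. x \<in> cball xb \<gamma> \<Longrightarrow> x \<noteq> xb \<Longrightarrow> \<Phi> (x, wb) \<in> D \<Longrightarrow> obj vb q0 < obj vb (x, wb)" by blast+
    show "\<gamma> > 0" using \<gamma>1 \<gamma>2 by (simp add: \<gamma>_def)
  qed
  obtain L \<delta> where L: "L \<ge> 0" "\<delta> > 0" and lip: "\<And>q q' y y' v v'. q\<in>ball q0 \<delta> \<Longrightarrow> q'\<in>ball q0 \<delta> \<Longrightarrow> y\<in>ball lamb \<delta> \<Longrightarrow> y'\<in>ball lamb \<delta> \<Longrightarrow>
    kkt v q y \<Longrightarrow> kkt v' q' y' \<Longrightarrow>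
    norm (fst q - fst q') + norm (y - y') \<le> L * (norm (snd q - snd q') + norm (v - v'))"
    using kkt_lipschitz[OF ss] by blast
  define r where "r = min (\<delta> / 2) \<gamma>"
  have r: "r > 0" "r \<le> \<delta> / 2" "r \<le> \<gamma>" using L \<gamma> by (auto simp: r_def)
  obtain s0 where s0: "s0 > 0" and ex: "\<And>w v. w\<in>ball wb s0 \<Longrightarrow> v\<in>ball vb s0 \<Longrightarrow> \<exists>x\<in>ball xb r. \<exists>y\<in>ball lamb r. kkt v (x, w) y"
  proof -
    have "\<exists>s>0. \<forall>w\<in>ball wb s. \<forall>v\<in>ball vb s. \<exists>x\<in>ball xb r. \<exists>y\<in>ball lamb r. kkt v (x, w) y \<and> \<Phi> (x, w) \<in> D \<and>
        (\<forall>x'\<in>cball xb \<gamma>. \<Phi> (x', w) \<in> D \<longrightarrow> obj v (x, w) \<le> obj v (x', w))"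
      by (rule kkt_exists[OF \<gamma>(1,2) r(1)]) (rule \<gamma>(3))
    then show thesis using that by meson
  qed
  define s where "s = min s0 r"
  have s: "s > 0" "s \<le> s0" "s \<le> r" using s0 r by (auto simp: s_def)
  let ?U = "ball wb s \<times> ball vb s" and ?V = "ball xb r \<times> ball lamb r"
  have Fk: "(x, y) \<in> F (w, v) \<longleftrightarrow> kkt v (x, w) y" if "x \<in> ball xb r" "w \<in> ball wb s" for x y w v
  proof -
    have "(x, w) \<in> cball xb \<gamma> \<times> cball wb \<gamma>" using that r s by auto
    then show ?thesis using F \<gamma>(2) unfolding kkt_map_def by blast
  qed
  define g where "g u = (SOME t. t \<in> ?V \<and> t \<in> F u)" for u
  have g: "g u \<in> ?V \<and> g u \<in> F u" if u0: "u \<in> ?U" for u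
    unfolding g_def
  proof (rule someI_ex)
    obtain w v where u: "u = (w, v)" "w \<in> ball wb s" "v \<in> ball vb s" using u0 by (rule SigmaE)
    then obtain x y where "x\<in>ball xb r" "y\<in>ball lamb r" "kkt v (x, w) y" using ex[of w v] s by auto
    then show "\<exists>t. t \<in> ?V \<and> t \<in> F u" using Fk[of x w y v] u by (intro exI[of _ "(x, y)"]) simp
  qed
  have key: "dist t t' \<le> 2 * L * dist u u'"
    if u: "u \<in> ?U" "u' \<in> ?U" and t: "t \<in> ?V" "t \<in> F u" "t' \<in> ?V" "t' \<in> F u'" for t t' u u'
  proof -
    obtain w v where uu: "u = (w, v)" "w \<in> ball wb s" "v \<in> ball vb s" using u(1) by (rule SigmaE)
    obtain w' v' where uu': "u' = (w', v')" "w' \<in> ball wb s" "v' \<in> ball vb s" using u(2) by (rule SigmaE)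
    obtain x y where tt: "t = (x, y)" "x \<in> ball xb r" "y \<in> ball lamb r" using t(1) by (rule SigmaE)
    obtain x' y' where tt': "t' = (x', y')" "x' \<in> ball xb r" "y' \<in> ball lamb r" using t(3) by (rule SigmaE)
    have k: "kkt v (x, w) y" "kkt v' (x', w') y'" using t tt tt' uu uu' Fk by auto
    have b: "(x, w) \<in> ball q0 \<delta>" "(x', w') \<in> ball q0 \<delta>"
      using tt(2) tt'(2) uu(2) uu'(2) r s dist_pair_le[of xb wb x w] dist_pair_le[of xb wb x' w'] by auto
    have b': "y \<in> ball lamb \<delta>" "y' \<in> ball lamb \<delta>" using tt tt' r L by auto
    have "dist t t' \<le> norm (x - x') + norm (y - y')"
      unfolding tt(1) tt'(1) using dist_pair_le[of x y x' y'] by (simp add: dist_norm)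
    also have "\<dots> \<le> L * (norm (w - w') + norm (v - v'))" using lip[OF b b' k] by simp
    \<comment> \<open>The factor 2 appears because each of the two parameter differences is at most
      the distance of the pairs.\<close>
    also have "\<dots> \<le> L * (2 * dist u u')"
      unfolding uu(1) uu'(1) using dist_fst_le[of "(w, v)" "(w', v')"] dist_snd_le[of "(w, v)" "(w', v')"] L(1)
      by (intro mult_left_mono) (auto simp: dist_norm)
    finally show ?thesis by simp
  qed
  show ?thesis
    unfolding lipschitz_localization_def
  proof (intro exI conjI)
    have "open ?U" "open ?V" by (auto intro: open_Times)
    then show "(wb, vb) \<in> interior ?U" "(xb, lamb) \<in> interior ?V"
      using s(1) r(1) by (auto simp: interior_open)
    show "g \<in> ?U \<rightarrow> ?V" using g by blast
    show "(2 * L)-lipschitz_on ?U g"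
      using L(1) g key by (intro lipschitz_onI) auto
    show "{(s, t). t \<in> F s} \<inter> (?U \<times> ?V) = {(s, g s) |s. s \<in> ?U}"
    proof (intro equalityI subsetI)
      fix z assume "z \<in> {(s, t). t \<in> F s} \<inter> (?U \<times> ?V)"
      then obtain u t where z: "z = (u, t)" "t \<in> F u" "u \<in> ?U" "t \<in> ?V" by auto
      have "dist t (g u) \<le> 2 * L * dist u u" by (rule key) (use z g in blast)+
      then show "z \<in> {(s, g s) |s. s \<in> ?U}" using z by auto
    next
      fix z assume "z \<in> {(s, g s) |s. s \<in> ?U}"
      then show "z \<in> {(s, t). t \<in> F s} \<inter> (?U \<times> ?V)" using g by auto
    qed
  qed
qed

text \<open>Uniqueness of KKT pairs upgrades minimality of \<open>xb\<close> to strict minimality,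
  so minimizers persist for \<open>v\<close> near \<open>vb\<close> and coincide with the localized
  solutions. Growth is thus available around each of them and not only around
  \<open>xb\<close>.\<close>

lemma ssosc_of_localization:
  assumes loc: "lipschitz_localization F (wb, vb) (xb, lamb)" and F: "kkt_map F"
    and \<gamma>0: "\<gamma>0 > 0" and min: "\<And>x. x \<in> cball xb \<gamma>0 \<Longrightarrow> \<Phi> (x, wb) \<in> D \<Longrightarrow> obj vb q0 \<le> obj vb (x, wb)"
  shows ssosc
proof -
  obtain r L g where r: "r > 0" and L: "L > 0"
    and uniq: "\<And>w v x y. w \<in> ball wb r \<Longrightarrow> v \<in> ball vb r \<Longrightarrow> x \<in> ball xb r \<Longrightarrow> y \<in> ball lamb r \<Longrightarrow>
     kkt v (x, w) y \<Longrightarrow> g (w, v) = (x, y)"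
    and lip: "\<And>v v'. v \<in> ball vb r \<Longrightarrow> v' \<in> ball vb r \<Longrightarrow> dist (g (wb, v)) (g (wb, v')) \<le> L * dist v v'"
    using localization_unique[OF loc F] by metis
  have kkt0: "kkt vb q0 lamb" using lamb by (simp add: kkt_def vb_eq zb_eq)
  have g0: "g (wb, vb) = (xb, lamb)" using uniq[of wb vb xb lamb] kkt0 r by simp
  obtain \<delta>1 where \<delta>1: "\<delta>1 > 0" and mc: "\<forall>\<^sub>F q in nhds q0. \<forall>v y. norm (v - vb) < \<delta>1 \<longrightarrow> kkt v q y \<longrightarrow> norm (y - lamb) < r"
    using multiplier_close[OF r] by blast
  obtain d where d: "d > 0" and near: "\<And>q. dist q q0 < d \<Longrightarrow>
      (\<forall>v y. norm (v - vb) < \<delta>1 \<longrightarrow> kkt v q y \<longrightarrow> norm (y - lamb) < r) \<and>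
      (\<forall>v. \<Phi> q \<in> D \<longrightarrow> (\<exists>r>0. \<forall>y\<in>ball (fst q) r. \<Phi> (y, snd q) \<in> D \<longrightarrow> obj v q \<le> obj v (y, snd q)) \<longrightarrow> (\<exists>y. kkt v q y))"
    using eventually_conj[OF mc local_minimizer_kkt] unfolding eventually_nhds_metric by blast
  obtain \<gamma>2 where \<gamma>2: "\<gamma>2 > 0" "cball xb \<gamma>2 \<times> cball wb \<gamma>2 \<subseteq> Om" using Om_box by blast
  define \<gamma> where "\<gamma> = min (\<gamma>0 / 2) (min \<gamma>2 (min (d / 2) (r / 2)))"
  have \<gamma>: "\<gamma> > 0" "\<gamma> \<le> \<gamma>0 / 2" "\<gamma> \<le> \<gamma>2" "\<gamma> < d" "\<gamma> < r" using \<gamma>0 \<gamma>2 d r by (auto simp: \<gamma>_def)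
  have Om: "cball xb \<gamma> \<times> cball wb \<gamma> \<subseteq> Om"
    using \<gamma>2(2) \<gamma>(3) by (meson Sigma_mono order_trans subset_cball)
  \<comment> \<open>A point with no larger value would itself be a local minimizer for
    \<open>vb\<close>, so it would carry a KKT pair in the localization box different from
    \<open>(xb, lamb)\<close>.\<close>
  have strict: "obj vb q0 < obj vb (x, wb)" if x: "x \<in> cball xb \<gamma>" "x \<noteq> xb" "\<Phi> (x, wb) \<in> D" for x
  proof (rule ccontr)
    assume "\<not> ?thesis"
    then have "obj vb (x, wb) \<le> obj vb q0" by simp
    then have le: "obj vb (x, wb) \<le> obj vb (y, wb)" if "y \<in> cball xb \<gamma>0" "\<Phi> (y, wb) \<in> D" for y
      using min[OF that] by simp
    have "ball x (\<gamma>0 / 2) \<subseteq> cball xb \<gamma>0"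
    proof
      fix y assume "y \<in> ball x (\<gamma>0 / 2)"
      then show "y \<in> cball xb \<gamma>0" using x(1) \<gamma>(2) dist_triangle[of xb y x] by simp
    qed
    then have "\<exists>r>0. \<forall>y\<in>ball x r. \<Phi> (y, wb) \<in> D \<longrightarrow> obj vb (x, wb) \<le> obj vb (y, wb)"
      using le \<gamma>0 by (intro exI[of _ "\<gamma>0 / 2"]) auto
    moreover have n: "dist (x, wb) q0 < d" using x(1) \<gamma>(4) by (simp add: dist_Pair_Pair dist_commute)
    ultimately obtain y where y: "kkt vb (x, wb) y"
      using near[OF n] x(3) unfolding fst_conv snd_conv by blast
    have "norm (vb - vb) < \<delta>1" using \<delta>1 by simp
    then have "norm (y - lamb) < r" using near[OF n] y by blast
    then have "y \<in> ball lamb r" by (simp add: dist_norm norm_minus_commute)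
    then have "g (wb, vb) = (x, y)" using uniq[of wb vb x y] y r x(1) \<gamma>(5) by simp
    with g0 x(2) show False by simp
  qed
  obtain s where s: "s > 0" and ex: "\<And>v. v \<in> ball vb s \<Longrightarrow> \<exists>x\<in>ball xb r. \<exists>y\<in>ball lamb r. kkt v (x, wb) y \<and> \<Phi> (x, wb) \<in> D \<and>
        (\<forall>x'\<in>cball xb \<gamma>. \<Phi> (x', wb) \<in> D \<longrightarrow> obj v (x, wb) \<le> obj v (x', wb))"
  proof -
    have "\<exists>s>0. \<forall>w\<in>ball wb s. \<forall>v\<in>ball vb s. \<exists>x\<in>ball xb r. \<exists>y\<in>ball lamb r. kkt v (x, w) y \<and> \<Phi> (x, w) \<in> D \<and>
        (\<forall>x'\<in>cball xb \<gamma>. \<Phi> (x', w) \<in> D \<longrightarrow> obj v (x, w) \<le> obj v (x', w))"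
      by (rule kkt_exists[OF \<gamma>(1) Om r]) (rule strict)
    then obtain s where "s > 0" "\<forall>w\<in>ball wb s. \<forall>v\<in>ball vb s. \<exists>x\<in>ball xb r. \<exists>y\<in>ball lamb r. kkt v (x, w) y \<and> \<Phi> (x, w) \<in> D \<and>
        (\<forall>x'\<in>cball xb \<gamma>. \<Phi> (x', w) \<in> D \<longrightarrow> obj v (x, w) \<le> obj v (x', w))" by blast
    then show thesis using that[of s] by simp
  qed
  define X where "X v = fst (g (wb, v))" for v
  \<comment> \<open>The bound \<open>\<gamma> / L\<close> keeps \<open>X v\<close> in the ball over
    which the problems are minimized, so the solutions for two parameters can be compared with each
    other.\<close>
  define \<rho> where "\<rho> = min (min r s) (\<gamma> / L)"
  have \<rho>: "\<rho> > 0" "\<rho> \<le> r" "\<rho> \<le> s" "\<rho> \<le> \<gamma> / L" using r s L \<gamma> by (auto simp: \<rho>_def)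
  have X: "\<Phi> (X v, wb) \<in> D" "\<And>x'. x' \<in> cball xb \<gamma> \<Longrightarrow> \<Phi> (x', wb) \<in> D \<Longrightarrow> obj v (X v, wb) \<le> obj v (x', wb)"
    if v: "v \<in> ball vb \<rho>" for v
  proof -
    have vs: "v \<in> ball vb s" "v \<in> ball vb r" using v \<rho> by auto
    obtain x y where xy: "x \<in> ball xb r" "y \<in> ball lamb r" "kkt v (x, wb) y" "\<Phi> (x, wb) \<in> D"
        "\<forall>x'\<in>cball xb \<gamma>. \<Phi> (x', wb) \<in> D \<longrightarrow> obj v (x, wb) \<le> obj v (x', wb)" using ex[OF vs(1)] by blast
    have "X v = x" using uniq[of wb v x y] xy vs(2) r by (simp add: X_def)
    with xy show "\<Phi> (X v, wb) \<in> D" "\<And>x'. x' \<in> cball xb \<gamma> \<Longrightarrow> \<Phi> (x', wb) \<in> D \<Longrightarrow> obj v (X v, wb) \<le> obj v (x', wb)" by auto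
  qed
  have Xlip: "norm (X v - X v') \<le> L * norm (v - v')" if "v \<in> ball vb \<rho>" "v' \<in> ball vb \<rho>" for v v'
  proof -
    have "dist (X v) (X v') \<le> dist (g (wb, v)) (g (wb, v'))" unfolding X_def by (rule dist_fst_le)
    also have "\<dots> \<le> L * dist v v'" using that \<rho> by (intro lip) auto
    finally show ?thesis by (simp add: dist_norm)
  qed
  have Xin: "X v \<in> cball xb \<gamma>" if v: "v \<in> ball vb \<rho>" for v
  proof -
    have "norm (X v - X vb) \<le> L * norm (v - vb)" using v \<rho> by (intro Xlip) auto
    also have "\<dots> \<le> L * (\<gamma> / L)" using v \<rho>(4) L by (intro mult_left_mono) (auto simp: dist_norm norm_minus_commute)
    also have "\<dots> = \<gamma>" using L by simp
    finally show ?thesis by (simp add: X_def g0 dist_norm norm_minus_commute)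
  qed
  \<comment> \<open>Compare with the minimizer for the parameter shifted in the direction \<open>y - X v\<close>.\<close>
  have growth: "obj v (X v, wb) + (norm (y - X v))\<^sup>2 / (4 * L) \<le> obj v (y, wb)"
    if v: "v \<in> ball vb \<rho>" and y: "y \<in> cball xb \<gamma>" "\<Phi> (y, wb) \<in> D"
      and v': "v + (1 / (2 * L)) *\<^sub>R (y - X v) \<in> ball vb \<rho>" for v y
  proof -
    let ?h = "y - X v"
    \<comment> \<open>A shift by \<open>k *\<^sub>R ?h\<close> gains \<open>k\<close> times the
      squared norm of \<open>?h\<close> and loses at most \<open>L * k\<^sup>2\<close> times it,
      because the minimizer moves. The difference \<open>k - L * k\<^sup>2\<close> is largest here,
      with value \<open>1 / (4 * L)\<close>.\<close>
    let ?k = "1 / (2 * L)"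
    let ?v' = "v + ?k *\<^sub>R ?h"
    have 1: "obj ?v' (X ?v', wb) \<le> obj ?v' (y, wb)" using X(2)[OF v' y] .
    have 2: "obj v (X v, wb) \<le> obj v (X ?v', wb)" using X(2)[OF v Xin[OF v'] X(1)[OF v']] .
    have 3: "norm (X ?v' - X v) \<le> L * (?k * norm ?h)" using Xlip[OF v' v] L by simp
    have "?h \<bullet> (X ?v' - X v) \<le> norm ?h * (L * (?k * norm ?h))"
      by (intro order_trans[OF norm_cauchy_schwarz] mult_left_mono 3) simp
    then have "?k * (?h \<bullet> (X ?v' - X v)) \<le> ?k * (norm ?h * (L * (?k * norm ?h)))"
      using L by (intro mult_left_mono) auto
    moreover have "?k * (norm ?h * (L * (?k * norm ?h))) = (norm ?h)\<^sup>2 / (4 * L)"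
      using L by (simp add: power2_eq_square field_simps)
    moreover have "?k * (?h \<bullet> (y - X v)) = (norm ?h)\<^sup>2 / (2 * L)" by (simp add: power2_norm_eq_inner)
    moreover have "(norm ?h)\<^sup>2 / (2 * L) - (norm ?h)\<^sup>2 / (4 * L) = (norm ?h)\<^sup>2 / (4 * L)"
      using L by (simp add: field_simps)
    moreover have "obj v (y, wb) = obj ?v' (y, wb) + ?k * (?h \<bullet> y)"
      "obj ?v' (X ?v', wb) = obj v (X ?v', wb) - ?k * (?h \<bullet> X ?v')"
      by (simp_all add: obj_def inner_add_left)
    moreover have "?h \<bullet> y - ?h \<bullet> X ?v' = ?h \<bullet> (y - X v) - ?h \<bullet> (X ?v' - X v)" by (simp add: inner_diff_right)
    then have "?k * (?h \<bullet> y) - ?k * (?h \<bullet> X ?v') = ?k * (?h \<bullet> (y - X v)) - ?k * (?h \<bullet> (X ?v' - X v))"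
      by (metis right_diff_distrib)
    ultimately show ?thesis using 1 2 by linarith
  qed
  have path: "\<And>h e. e > 0 \<Longrightarrow> \<exists>\<tau>>0. \<forall>t. 0 < t \<and> t < \<tau> \<longrightarrow>
     (\<exists>y. norm (y - xb - t *\<^sub>R h) \<le> e * t \<and> \<Phi> (y, wb) - zb - t *\<^sub>R A h \<in> S1)"
    using eventually_nhds_x_imp_x[OF feasible_path] by (simp add: zb_eq)
  have on_G: "\<Phi> (y, wb) - zb \<in> G" if "\<Phi> (y, wb) - zb - t *\<^sub>R A h \<in> S1" "A h \<in> G" "0 < t" for y t h
    using G_add_S1[OF G_scale[OF that(2)] that(1), of t] that(3) by simp
  obtain \<rho>a where \<rho>a: "\<rho>a > 0" "\<And>z. z \<in> ball zb \<rho>a \<Longrightarrow> z - zb \<in> G \<Longrightarrow> lamb \<in> subdifferential \<theta> z"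
    using subdifferential_of_G by blast
  obtain r1 where r1: "r1 > 0" "\<And>q. dist q q0 < r1 \<Longrightarrow> norm (\<Phi> q - zb) < \<rho>a"
    using eventually_close[OF cont_\<Phi> \<rho>a(1)] unfolding eventually_nhds_metric zb_eq by blast
  obtain hb where hb: "hb > 0" "\<And>u. norm (H u) \<le> hb * norm u" using linear_bounded_pos[OF linear_H] by blast
  obtain C2 where "\<forall>e>0. \<exists>\<delta>>0. \<forall>q\<in>ball q0 \<delta>. \<forall>q'\<in>ball q0 \<delta>.
     norm (gradL q - gradL q' - H (fst q - fst q')) \<le> e * norm (fst q - fst q') + C2 * norm (snd q - snd q')"
    using strict_L unfolding strict_partial_def by blast
  from this[rule_format, OF zero_less_one] obtain r2 where r2: "r2 > 0" "\<And>q q'. q\<in>ball q0 r2 \<Longrightarrow> q'\<in>ball q0 r2 \<Longrightarrow>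
     norm (gradL q - gradL q' - H (fst q - fst q')) \<le> 1 * norm (fst q - fst q') + C2 * norm (snd q - snd q')"
    by blast
  show ?thesis
    unfolding ssosc_def
  proof (intro allI impI)
    fix u assume uN: "A u \<in> N" and u0: "u \<noteq> 0"
    obtain gg e0 where gg: "gg \<in> G" "e0 > 0" "gg + e0 *\<^sub>R A u \<in> G" using G_relative_interior uN by blast
    obtain T where T: "linear T" "\<And>y. A (T y) - y \<in> S1" using right_inverse_exists by metis
    \<comment> \<open>Lifts of the two elements \<open>gg\<close> and
      \<open>gg + e0 *\<^sub>R A u\<close> of \<open>G\<close>, correct modulo \<open>S1\<close>,
      that differ by exactly \<open>e0 *\<^sub>R u\<close>.\<close>
    define h1 where "h1 = T gg"
    define h2 where "h2 = h1 + e0 *\<^sub>R u"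
    have hG: "A h1 \<in> G" "A h2 \<in> G"
      using G_add_S1[OF gg(1) T(2)[of gg]] G_add_S1[OF gg(3) T(2)[of gg]]
      by (simp_all add: h1_def h2_def blinfun.add_right blinfun.scaleR_right algebra_simps)
    \<comment> \<open>Here \<open>z\<close> is the scaled difference of points on the two arcs. As
      \<open>e\<close> tends to 0 it converges to \<open>e0 *\<^sub>R u\<close>, and the inequality
      becomes positivity of the quadratic form at \<open>u\<close>.\<close>
    have claim: "\<exists>z. norm (z - e0 *\<^sub>R u) \<le> 2 * e \<and> (norm z)\<^sup>2 / (4 * L) - e * (norm z)\<^sup>2 \<le> 1/2 * (z \<bullet> H z)"
      if e: "0 < e" "e \<le> 1" for e
    proof -
      obtain \<delta>a where \<delta>a: "\<delta>a > 0" "\<And>x y. x \<in> ball xb \<delta>a \<Longrightarrow> y \<in> ball xb \<delta>a \<Longrightarrow>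
        \<bar>lag y - lag x - gradL (x, wb) \<bullet> (y - x) - 1/2 * ((y - x) \<bullet> H (y - x))\<bar> \<le> e * (norm (y - x))\<^sup>2"
        using second_order[OF e(1)] by blast
      \<comment> \<open>\<open>\<rho> / (2 * (hb + 1))\<close> keeps the Lagrangian gradient at
        \<open>x\<close> within \<open>\<rho> / 2\<close> of \<open>vb\<close>;
        \<open>\<rho> * L / 4\<close> limits the additional shift by
        \<open>(y - x) / (2 * L)\<close> to \<open>\<rho> / 4\<close>.\<close>
      define R where "R = Min {\<delta>a, r1, r2, \<gamma>, r, \<rho> * L / 4, \<rho> / (2 * (hb + 1))}"
      have R: "R > 0" using \<delta>a(1) r1(1) r2(1) \<gamma>(1) r \<rho>(1) L hb(1)
        unfolding R_def by (subst Min_gr_iff) auto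
      have Rle: "R \<le> \<delta>a" "R \<le> r1" "R \<le> r2" "R \<le> \<gamma>" "R \<le> r" "R \<le> \<rho> * L / 4" "R \<le> \<rho> / (2 * (hb + 1))"
        unfolding R_def by (rule Min_le; simp)+
      obtain \<tau>1 where \<tau>1: "\<tau>1 > 0" "\<And>t. 0 < t \<Longrightarrow> t < \<tau>1 \<Longrightarrow>
          \<exists>y. norm (y - xb - t *\<^sub>R h1) \<le> e * t \<and> \<Phi> (y, wb) - zb - t *\<^sub>R A h1 \<in> S1"
        using path[OF e(1), of h1] by blast
      obtain \<tau>2 where \<tau>2: "\<tau>2 > 0" "\<And>t. 0 < t \<Longrightarrow> t < \<tau>2 \<Longrightarrow>
          \<exists>y. norm (y - xb - t *\<^sub>R h2) \<le> e * t \<and> \<Phi> (y, wb) - zb - t *\<^sub>R A h2 \<in> S1"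
        using path[OF e(1), of h2] by blast
      define n where "n = norm h1 + norm h2 + 1"
      have n: "n > 0" by (simp add: n_def add_nonneg_pos)
      define t where "t = min (min (\<tau>1 / 2) (\<tau>2 / 2)) (R / (2 * n))"
      have t: "0 < t" "t < \<tau>1" "t < \<tau>2" using \<tau>1(1) \<tau>2(1) R n by (auto simp: t_def)
      have "t * n \<le> R / (2 * n) * n" using n by (intro mult_right_mono) (auto simp: t_def)
      also have "\<dots> = R / 2" using n by simp
      finally have tn: "t * n < R" using R by simp
      obtain x where x: "norm (x - xb - t *\<^sub>R h1) \<le> e * t" "\<Phi> (x, wb) - zb - t *\<^sub>R A h1 \<in> S1" using \<tau>1(2) t by blast
      obtain y where y: "norm (y - xb - t *\<^sub>R h2) \<le> e * t" "\<Phi> (y, wb) - zb - t *\<^sub>R A h2 \<in> S1" using \<tau>2(2) t by blast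
      have inR: "norm (x' - xb) < R" if "norm (x' - xb - t *\<^sub>R h) \<le> e * t" "norm h + 1 \<le> n" for x' h
      proof -
        have "norm (x' - xb) \<le> norm (x' - xb - t *\<^sub>R h) + norm (t *\<^sub>R h)"
          using norm_triangle_ineq[of "x' - xb - t *\<^sub>R h" "t *\<^sub>R h"] by simp
        also have "\<dots> \<le> 1 * t + t * norm h"
          using that(1) t e by (intro add_mono order_trans[OF that(1)] mult_right_mono) auto
        also have "\<dots> = t * (norm h + 1)" by (simp add: algebra_simps)
        also have "\<dots> \<le> t * n" using that(2) t by (intro mult_left_mono) auto
        finally show ?thesis using tn by simp
      qed
      have xR: "norm (x - xb) < R" and yR: "norm (y - xb) < R"
        using inR[OF x(1)] inR[OF y(1)] by (auto simp: n_def)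
      have lam: "lamb \<in> subdifferential \<theta> (\<Phi> (x', wb))" if "norm (x' - xb) < R" "\<Phi> (x', wb) - zb \<in> G" for x'
      proof -
        have "dist (x', wb) q0 < r1" using that(1) Rle(2) by (simp add: dist_Pair_Pair dist_norm)
        then have "\<Phi> (x', wb) \<in> ball zb \<rho>a" using r1(2)[of "(x', wb)"] by (simp add: dist_norm norm_minus_commute)
        then show ?thesis using \<rho>a(2) that(2) by blast
      qed
      have lx: "lamb \<in> subdifferential \<theta> (\<Phi> (x, wb))" using lam[OF xR on_G[OF x(2) hG(1) t(1)]] .
      have ly: "lamb \<in> subdifferential \<theta> (\<Phi> (y, wb))" using lam[OF yR on_G[OF y(2) hG(2) t(1)]] .
      \<comment> \<open>The parameter for which \<open>(x, lamb)\<close> is a KKT pair; uniqueness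
        then identifies \<open>x\<close> with the minimizer \<open>X v\<close>.\<close>
      define v where "v = gradL (x, wb)"
      have vn: "norm (v - vb) < \<rho> / 2"
      proof -
        have b: "(x, wb) \<in> ball q0 r2" "q0 \<in> ball q0 r2"
          using xR Rle(3) r2(1) by (auto simp: dist_Pair_Pair dist_norm norm_minus_commute)
        have "norm (v - vb - H (x - xb)) \<le> norm (x - xb)" using r2(2)[OF b] by (simp add: v_def vb_eq)
        then have "norm (v - vb) \<le> norm (x - xb) + norm (H (x - xb))"
          using norm_triangle_ineq[of "v - vb - H (x - xb)" "H (x - xb)"] by simp
        also have "\<dots> \<le> (hb + 1) * norm (x - xb)" using hb(2)[of "x - xb"] by (simp add: algebra_simps)
        also have "\<dots> < (hb + 1) * (\<rho> / (2 * (hb + 1)))" using xR Rle(7) hb by (intro mult_strict_left_mono) auto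
        also have "\<dots> = \<rho> / 2"
        proof -
          have "c * (\<rho> / (2 * c)) = \<rho> / 2" if "c > 0" for c :: real using that by simp
          then show ?thesis using hb(1) by (meson add_pos_pos zero_less_one)
        qed
        finally show ?thesis .
      qed
      have vb': "v \<in> ball vb \<rho>" using vn \<rho>(1) by (simp add: dist_norm norm_minus_commute)
      have Xv: "X v = x"
      proof -
        have k: "kkt v (x, wb) lamb" using lx by (simp add: kkt_def v_def)
        have "g (wb, v) = (x, lamb)"
          by (rule uniq[OF _ _ _ _ k])
            (use r vb' \<rho> xR Rle in \<open>auto simp: dist_norm norm_minus_commute\<close>)
        then show ?thesis by (simp add: X_def)
      qed
      have yD: "y \<in> cball xb \<gamma>" "\<Phi> (y, wb) \<in> D"
        using yR Rle(4) ly by (auto simp: dist_norm norm_minus_commute subdifferential_iff)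
      have yx: "norm (y - x) \<le> 2 * R"
        using norm_triangle_ineq4[of "y - xb" "x - xb"] xR yR by simp
      have v'b: "v + (1 / (2 * L)) *\<^sub>R (y - X v) \<in> ball vb \<rho>"
      proof -
        have "norm ((1 / (2 * L)) *\<^sub>R (y - x)) = 1 / (2 * L) * norm (y - x)" using L by simp
        also have "norm (y - x) \<le> 2 * (\<rho> * L / 4)" using yx Rle(6) by linarith
        then have "1 / (2 * L) * norm (y - x) \<le> 1 / (2 * L) * (2 * (\<rho> * L / 4))"
          by (rule mult_left_mono) (use L in simp)
        also have "\<dots> = \<rho> / 4" using L by simp
        finally have "norm (v + (1 / (2 * L)) *\<^sub>R (y - x) - vb) < \<rho>"
          using vn \<rho>(1) norm_triangle_ineq[of "v - vb" "(1 / (2 * L)) *\<^sub>R (y - x)"] by (simp add: algebra_simps)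
        then show ?thesis unfolding Xv mem_ball by (subst dist_commute) (simp only: dist_norm)
      qed
      have "obj v (x, wb) + (norm (y - x))\<^sup>2 / (4 * L) \<le> obj v (y, wb)"
        using growth[OF vb' yD v'b] unfolding Xv .
      \<comment> \<open>With \<open>lamb\<close> a subgradient at both values, \<open>m\<close>
        increases by exactly \<open>lamb \<bullet> (\<Phi> (y, wb) - \<Phi> (x, wb))\<close>, so the
        objective can be replaced by the smooth Lagrangian.\<close>
      moreover have "obj v (y, wb) - obj v (x, wb) = lag y - lag x - v \<bullet> (y - x)"
        using G_of_subdifferential(2)[OF lx] G_of_subdifferential(2)[OF ly]
        by (simp add: obj_def inner_diff_right)
      moreover have "lag y - lag x - v \<bullet> (y - x) \<le> 1/2 * ((y - x) \<bullet> H (y - x)) + e * (norm (y - x))\<^sup>2"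
        using \<delta>a(2)[of x y] xR yR Rle(1) unfolding v_def by (simp add: dist_norm norm_minus_commute)
      ultimately have main: "(norm (y - x))\<^sup>2 / (4 * L) - e * (norm (y - x))\<^sup>2 \<le> 1/2 * ((y - x) \<bullet> H (y - x))"
        by linarith
      define z where "z = (1 / t) *\<^sub>R (y - x)"
      have yz: "y - x = t *\<^sub>R z" using t by (simp add: z_def)
      have "t\<^sup>2 * ((norm z)\<^sup>2 / (4 * L) - e * (norm z)\<^sup>2) \<le> t\<^sup>2 * (1/2 * (z \<bullet> H z))"
        using main unfolding yz by (simp add: linear_scale[OF linear_H] power_mult_distrib algebra_simps power2_eq_square)
      then have "(norm z)\<^sup>2 / (4 * L) - e * (norm z)\<^sup>2 \<le> 1/2 * (z \<bullet> H z)"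
        using t by (simp only: mult_le_cancel_left_pos zero_less_power)
      moreover have "norm (z - e0 *\<^sub>R u) \<le> 2 * e"
      proof -
        have "t *\<^sub>R (z - e0 *\<^sub>R u) = (y - xb - t *\<^sub>R h2) - (x - xb - t *\<^sub>R h1)"
          unfolding scaleR_diff_right yz[symmetric] by (simp add: h2_def algebra_simps)
        then have "norm (t *\<^sub>R (z - e0 *\<^sub>R u)) \<le> e * t + e * t"
          using x(1) y(1) norm_triangle_ineq4 by (metis add_mono order_trans)
        then have "t * norm (z - e0 *\<^sub>R u) \<le> t * (2 * e)" using t by simp
        then show ?thesis using t by (simp only: mult_le_cancel_left_pos)
      qed
      ultimately show ?thesis by blast
    qed
    define \<epsilon> where "\<epsilon> k = 1 / real (Suc k)" for k
    have \<epsilon>: "0 < \<epsilon> k" "\<epsilon> k \<le> 1" for k by (simp_all add: \<epsilon>_def)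
    have \<epsilon>0: "\<epsilon> \<longlonglongrightarrow> 0" unfolding \<epsilon>_def by (intro LIMSEQ_Suc lim_1_over_n)
    have "\<forall>k. \<exists>z. norm (z - e0 *\<^sub>R u) \<le> 2 * \<epsilon> k \<and> (norm z)\<^sup>2 / (4 * L) - \<epsilon> k * (norm z)\<^sup>2 \<le> 1/2 * (z \<bullet> H z)"
      using claim \<epsilon> by blast
    then obtain z where z: "\<And>k. norm (z k - e0 *\<^sub>R u) \<le> 2 * \<epsilon> k"
        "\<And>k. (norm (z k))\<^sup>2 / (4 * L) - \<epsilon> k * (norm (z k))\<^sup>2 \<le> 1/2 * (z k \<bullet> H (z k))" by metis
    have l2: "(\<lambda>k. 2 * \<epsilon> k) \<longlonglongrightarrow> 0" using tendsto_mult[OF tendsto_const[of 2] \<epsilon>0] by simp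
    have "(\<lambda>k. z k - e0 *\<^sub>R u) \<longlonglongrightarrow> 0"
      by (rule Lim_null_comparison[OF always_eventually[OF allI] l2]) (rule z(1))
    then have lz: "z \<longlonglongrightarrow> e0 *\<^sub>R u" by (rule LIM_zero_cancel)
    have contH: "isCont H x" for x using linear_H linear_conv_bounded_linear linear_continuous_at by blast
    have "(\<lambda>k. (norm (z k))\<^sup>2 / (4 * L) - \<epsilon> k * (norm (z k))\<^sup>2) \<longlonglongrightarrow> (norm (e0 *\<^sub>R u))\<^sup>2 / (4 * L) - 0 * (norm (e0 *\<^sub>R u))\<^sup>2"
      using L by (intro tendsto_intros lz \<epsilon>0) auto
    moreover have "(\<lambda>k. 1/2 * (z k \<bullet> H (z k))) \<longlonglongrightarrow> 1/2 * ((e0 *\<^sub>R u) \<bullet> H (e0 *\<^sub>R u))"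
      by (intro tendsto_intros lz isCont_tendsto_compose[OF contH lz])
    ultimately have "(norm (e0 *\<^sub>R u))\<^sup>2 / (4 * L) - 0 * (norm (e0 *\<^sub>R u))\<^sup>2 \<le> 1/2 * ((e0 *\<^sub>R u) \<bullet> H (e0 *\<^sub>R u))"
      by (rule LIMSEQ_le) (use z(2) in blast)
    moreover have "(norm (e0 *\<^sub>R u))\<^sup>2 / (4 * L) > 0" using gg(2) u0 L by simp
    moreover have "(e0 *\<^sub>R u) \<bullet> H (e0 *\<^sub>R u) = e0\<^sup>2 * (u \<bullet> H u)"
      by (simp add: linear_scale[OF linear_H] power2_eq_square)
    ultimately have "0 < e0\<^sup>2 * (u \<bullet> H u)" by linarith
    then show "0 < u \<bullet> H u" using gg(2) by (simp add: zero_less_mult_iff)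
  qed
qed

end

section \<open>The equivalence\<close>

lemma argmin_over_iff:
  "x \<in> A \<Longrightarrow> f x \<noteq> \<infinity> \<Longrightarrow> x \<in> argmin_over A f \<longleftrightarrow> (\<forall>y\<in>A. f x \<le> f y)"
  unfolding argmin_over_def by auto

context composite begin

lemma gderiv_lagrangian:
  assumes Om: "(x, w) \<in> Om"
  shows "GDERIV (\<lambda>x'. lagrangian \<phi>0 \<Phi> x' w y) x :> v \<longleftrightarrow> v = g\<phi> (x, w) + Jt (x, w) y"
proof -
  have "((\<lambda>x'. \<phi>0 (x', w) + y \<bullet> \<Phi> (x', w)) has_derivative (\<lambda>h. g\<phi> (x, w) \<bullet> h + y \<bullet> J (x, w) h)) (at x)"
    by (intro has_derivative_add has_derivative_inner_right d\<phi> d\<Phi> Om)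
  also have "(\<lambda>h. g\<phi> (x, w) \<bullet> h + y \<bullet> J (x, w) h) = (\<lambda>h. h \<bullet> (g\<phi> (x, w) + Jt (x, w) y))"
    by (simp add: inner_add_right Jt_inner(2) inner_commute)
  finally have d: "((\<lambda>x'. lagrangian \<phi>0 \<Phi> x' w y) has_derivative (\<lambda>h. h \<bullet> (g\<phi> (x, w) + Jt (x, w) y))) (at x)"
    by (simp add: lagrangian_def)
  show ?thesis
  proof
    assume "GDERIV (\<lambda>x'. lagrangian \<phi>0 \<Phi> x' w y) x :> v"
    then have "(\<lambda>h. h \<bullet> v) = (\<lambda>h. h \<bullet> (g\<phi> (x, w) + Jt (x, w) y))"
      unfolding gderiv_def using d has_derivative_unique by blast
    then show "v = g\<phi> (x, w) + Jt (x, w) y" by (metis vector_eq_ldot)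
  qed (use d in \<open>simp add: gderiv_def\<close>)
qed

lemma kkt_map_S_KKT: "kkt_map (S_KKT \<phi>0 \<theta> \<Phi>)"
  by (auto simp: kkt_map_def S_KKT_def kkt_def gderiv_lagrangian)

lemma gradient_lagrangian:
  "(x, w) \<in> Om \<Longrightarrow> gradient (\<lambda>x'. lagrangian \<phi>0 \<Phi> x' w y) x = g\<phi> (x, w) + Jt (x, w) y"
  unfolding gradient_def by (rule the_equality) (simp_all add: gderiv_lagrangian)

lemma jac_x_eq: "jac_x \<Phi> xb wb = A"
  unfolding jac_x_def using frechet_derivative_at[OF d\<Phi>[OF q0_Om]] by simp

text \<open>With both parameters equal to \<open>wb\<close> and one point equal to
  \<open>xb\<close>, \<open>strict_L\<close> is ordinary differentiability of \<open>gradL\<close>.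
  It transfers to \<open>gradient\<close> because the two agree on an open neighbourhood.\<close>

lemma hess_form_eq: "hess_form (\<lambda>x. lagrangian \<phi>0 \<Phi> x wb lamb) xb u = u \<bullet> H u"
proof -
  obtain C where C: "\<forall>e>0. \<exists>\<delta>>0. \<forall>q\<in>ball q0 \<delta>. \<forall>q'\<in>ball q0 \<delta>.
     norm (gradL q - gradL q' - H (fst q - fst q')) \<le> e * norm (fst q - fst q') + C * norm (snd q - snd q')"
    using strict_L unfolding strict_partial_def by blast
  have "((\<lambda>x. gradL (x, wb)) has_derivative H) (at xb)"
    unfolding has_derivative_at_alt
  proof (intro conjI allI impI)
    show "bounded_linear H" using linear_H linear_conv_bounded_linear by blast
    fix e :: real assume "e > 0"
    with C obtain \<delta> where \<delta>: "\<delta> > 0" "\<And>q q'. q\<in>ball q0 \<delta> \<Longrightarrow> q'\<in>ball q0 \<delta> \<Longrightarrow>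
       norm (gradL q - gradL q' - H (fst q - fst q')) \<le> e * norm (fst q - fst q') + C * norm (snd q - snd q')"
      by blast
    have "norm (gradL (y, wb) - gradL q0 - H (y - xb)) \<le> e * norm (y - xb)" if "norm (y - xb) < \<delta>" for y
      using \<delta>(2)[OF ball_slice ball_slice, of y xb] that \<delta>(1) by (simp add: dist_norm norm_minus_commute)
    then show "\<exists>d>0. \<forall>y. norm (y - xb) < d \<longrightarrow> norm (gradL (y, wb) - gradL q0 - H (y - xb)) \<le> e * norm (y - xb)"
      using \<delta>(1) by blast
  qed
  moreover have "open {x. (x, wb) \<in> Om}"
    using open_vimage[OF open_Om, of "\<lambda>x. (x, wb)"] by (simp add: vimage_def continuous_on_Pair)
  ultimately have "(gradient (\<lambda>x. lagrangian \<phi>0 \<Phi> x wb lamb) has_derivative H) (at xb)"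
    using has_derivative_transform_within_open[of "\<lambda>x. gradL (x, wb)" H xb UNIV "{x. (x, wb) \<in> Om}"]
      q0_Om gradient_lagrangian[of _ wb lamb] by simp
  from frechet_derivative_at[OF this] show ?thesis by (simp add: hess_form_def)
qed

lemma composite_SSOSC_eq: "composite_SSOSC \<phi>0 \<Phi> l a \<alpha> p d \<beta> xb wb lamb \<longleftrightarrow> ssosc"
proof -
  obtain c \<mu> where r: "multiplier_rep a d (K zb) (I zb) lamb c \<mu>"
    using subdifferential_rep[OF zb] lamb by blast
  show ?thesis
    using composite_SSOSC_iff[OF _ _ r, of l \<alpha> \<Phi> xb wb p \<beta> \<phi>0]
    by (auto simp: zb_eq[symmetric] crit_subspace_eq[OF r] jac_x_eq hess_form_eq ssosc_def)
qed

lemma nondegenerate_eq: "nondegenerate \<theta> \<Phi> xb wb \<longleftrightarrow> (\<forall>s\<in>S0. Jt q0 s = 0 \<longrightarrow> s = 0)"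
  using parallel_subspace_eq subspace_0[OF subspace_S0] linear_0[OF linear_Jt]
  by (auto simp: nondegenerate_def zb_eq[symmetric] S0_def jac_x_eq)

lemma argmin_loc_iff:
  assumes "\<gamma> > 0"
  shows "xb \<in> argmin_loc \<phi>0 \<theta> \<Phi> xb \<gamma> wb vb \<longleftrightarrow>
    (\<forall>x\<in>cball xb \<gamma>. \<Phi> (x, wb) \<in> D \<longrightarrow> obj vb q0 \<le> obj vb (x, wb))"
proof -
  let ?f = "\<lambda>x. ereal (\<phi>0 (x, wb)) + \<theta> (\<Phi> (x, wb)) - ereal (vb \<bullet> x)"
  have f: "?f x = (if \<Phi> (x, wb) \<in> D then ereal (obj vb (x, wb)) else \<infinity>)" for x
    by (simp add: theta_eq theta_infty obj_def)
  have "?f xb \<noteq> \<infinity>" using zb by (simp only: f) (simp add: zb_eq)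
  moreover have "xb \<in> {x. norm (x - xb) \<le> \<gamma>}" using assms by simp
  ultimately have "xb \<in> argmin_loc \<phi>0 \<theta> \<Phi> xb \<gamma> wb vb \<longleftrightarrow> (\<forall>x\<in>{x. norm (x - xb) \<le> \<gamma>}. ?f xb \<le> ?f x)"
    unfolding argmin_loc_def by (rule argmin_over_iff[rotated])
  also have "\<dots> \<longleftrightarrow> (\<forall>x\<in>cball xb \<gamma>. \<Phi> (x, wb) \<in> D \<longrightarrow> obj vb q0 \<le> obj vb (x, wb))"
    unfolding f using zb by (auto simp: zb_eq dist_norm norm_minus_commute)
  finally show ?thesis .
qed

lemma svll_iff_ssosc_nd:
  "SVLL \<phi>0 \<theta> \<Phi> xb lamb wb vb \<and> (\<exists>\<gamma>>0. xb \<in> argmin_loc \<phi>0 \<theta> \<Phi> xb \<gamma> wb vb) \<longleftrightarrow>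
   composite_SSOSC \<phi>0 \<Phi> l a \<alpha> p d \<beta> xb wb lamb \<and> nondegenerate \<theta> \<Phi> xb wb"
  (is "?svll \<and> ?min \<longleftrightarrow> _")
proof
  assume "composite_SSOSC \<phi>0 \<Phi> l a \<alpha> p d \<beta> xb wb lamb \<and> nondegenerate \<theta> \<Phi> xb wb"
  then have ss: ssosc and nd: "\<And>s. s \<in> S0 \<Longrightarrow> Jt q0 s = 0 \<Longrightarrow> s = 0"
    by (auto simp: composite_SSOSC_eq nondegenerate_eq)
  interpret nd: composite_nd \<theta> l a \<alpha> p d \<beta> zb lamb \<phi>0 \<Phi> xb wb Om g\<phi> J H vb
    by unfold_locales (rule nd)
  have ?svll unfolding SVLL_def by (rule nd.localization_of_ssosc[OF ss kkt_map_S_KKT])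
  moreover obtain \<gamma> where \<gamma>: "\<gamma> > 0"
    "\<forall>x\<in>cball xb \<gamma>. x \<noteq> xb \<longrightarrow> \<Phi> (x, wb) \<in> D \<longrightarrow> obj vb q0 < obj vb (x, wb)"
    using strict_minimizer[OF ss] by blast
  then have ?min using argmin_loc_iff[OF \<gamma>(1)] by (intro exI[of _ \<gamma>]) (metis less_le order_refl)
  ultimately show "?svll \<and> ?min" by blast
next
  assume asm: "?svll \<and> ?min"
  then have loc: "lipschitz_localization (S_KKT \<phi>0 \<theta> \<Phi>) (wb, vb) (xb, lamb)" by (simp add: SVLL_def)
  obtain \<gamma> where \<gamma>: "\<gamma> > 0" "xb \<in> argmin_loc \<phi>0 \<theta> \<Phi> xb \<gamma> wb vb" using asm by blast
  \<comment> \<open>Nondegeneracy has to come first, since the growth argument takes place in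
    \<open>composite_nd\<close>.\<close>
  have nd: "s \<in> S0 \<Longrightarrow> Jt q0 s = 0 \<Longrightarrow> s = 0" for s by (rule nd_of_localization[OF loc kkt_map_S_KKT])
  interpret nd: composite_nd \<theta> l a \<alpha> p d \<beta> zb lamb \<phi>0 \<Phi> xb wb Om g\<phi> J H vb
    by unfold_locales (rule nd)
  have ssosc
    by (rule nd.ssosc_of_localization[OF loc kkt_map_S_KKT \<gamma>(1)]) (use \<gamma>(2) argmin_loc_iff[OF \<gamma>(1)] in blast)
  with nd show "composite_SSOSC \<phi>0 \<Phi> l a \<alpha> p d \<beta> xb wb lamb \<and> nondegenerate \<theta> \<Phi> xb wb"
    by (simp add: composite_SSOSC_eq nondegenerate_eq)
qed

end

section \<open>Strict differentiability of the smooth data\<close>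

definition strict_deriv :: "('p::real_normed_vector \<Rightarrow> 'y::real_normed_vector) \<Rightarrow> ('p \<Rightarrow> 'y) \<Rightarrow> 'p \<Rightarrow> bool" where
  "strict_deriv f D q0 \<longleftrightarrow> bounded_linear D \<and>
     (\<forall>e>0. \<exists>\<delta>>0. \<forall>q\<in>ball q0 \<delta>. \<forall>q'\<in>ball q0 \<delta>. norm (f q - f q' - D (q - q')) \<le> e * norm (q - q'))"

lemma strict_derivD:
  "strict_deriv f D q0 \<Longrightarrow> e > 0 \<Longrightarrow>
     \<exists>\<delta>>0. \<forall>q\<in>ball q0 \<delta>. \<forall>q'\<in>ball q0 \<delta>. norm (f q - f q' - D (q - q')) \<le> e * norm (q - q')"
  by (simp add: strict_deriv_def)

text \<open>The mean value inequality on a ball where the derivative stays within \<open>e\<close>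
  of its value at \<open>q0\<close>.\<close>

lemma strict_deriv_of_C1:
  fixes f :: "'p::real_normed_vector \<Rightarrow> 'y::real_normed_vector" and f' :: "'p \<Rightarrow> 'p \<Rightarrow>\<^sub>L 'y"
  assumes S: "open S" "q0 \<in> S" and f: "\<And>q. q \<in> S \<Longrightarrow> (f has_derivative f' q) (at q)"
    and c: "continuous_on S f'"
  shows "strict_deriv f (f' q0) q0"
  unfolding strict_deriv_def
proof (intro conjI allI impI blinfun.bounded_linear_right)
  fix e :: real assume e: "e > 0"
  have "isCont f' q0" using c S continuous_on_eq_continuous_at by blast
  then obtain d1 where d1: "d1 > 0" "\<And>q. dist q q0 < d1 \<Longrightarrow> dist (f' q) (f' q0) < e"
    using e unfolding continuous_at_eps_delta by blast
  obtain d2 where d2: "d2 > 0" "ball q0 d2 \<subseteq> S" using S open_contains_ball by blast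
  define \<delta> where "\<delta> = min d1 d2"
  have \<delta>: "\<delta> > 0" using d1(1) d2(1) by (simp add: \<delta>_def)
  have "norm (f q - f q' - f' q0 (q - q')) \<le> e * norm (q - q')" if q: "q \<in> ball q0 \<delta>" "q' \<in> ball q0 \<delta>" for q q'
  proof -
    have "norm (f q - f q' - f' q0 (q - q')) \<le> norm (q - q') * e"
    proof (rule differentiable_bound_linearization[where S = "ball q0 \<delta>"])
      fix t :: real assume t: "t \<in> {0..1}"
      have "q' + t *\<^sub>R (q - q') = (1 - t) *\<^sub>R q' + t *\<^sub>R q" by (simp add: algebra_simps)
      then show "q' + t *\<^sub>R (q - q') \<in> ball q0 \<delta>" using convexD[OF convex_ball q(2,1), of "1 - t" t] t by simp
    next
      fix x assume x: "x \<in> ball q0 \<delta>"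
      then have "x \<in> S" using d2(2) by (auto simp: \<delta>_def)
      then show "(f has_derivative f' x) (at x within ball q0 \<delta>)" using f has_derivative_at_withinI by blast
      have "dist x q0 < d1" using x by (simp add: \<delta>_def dist_commute)
      then have "norm (f' x - f' q0) < e" using d1(2) by (simp add: dist_norm)
      moreover have eq: "blinfun_apply (f' x) - blinfun_apply (f' q0) = blinfun_apply (f' x - f' q0)"
        by (simp add: fun_eq_iff blinfun.diff_left)
      ultimately show "onorm (blinfun_apply (f' x) - blinfun_apply (f' q0)) \<le> e"
        by (simp add: norm_blinfun.rep_eq eq)
    qed (use \<delta> in simp)
    then show ?thesis by (simp add: mult.commute)
  qed
  with \<delta> show "\<exists>\<delta>>0. \<forall>q\<in>ball q0 \<delta>. \<forall>q'\<in>ball q0 \<delta>. norm (f q - f q' - f' q0 (q - q')) \<le> e * norm (q - q')" by blast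
qed

lemma strict_deriv_linear:
  assumes f: "strict_deriv f D q0" and T: "bounded_linear T"
  shows "strict_deriv (\<lambda>q. T (f q)) (\<lambda>h. T (D h)) q0"
  unfolding strict_deriv_def
proof (intro conjI allI impI)
  show "bounded_linear (\<lambda>h. T (D h))" using f T bounded_linear_compose unfolding strict_deriv_def by blast
  fix e :: real assume e: "e > 0"
  interpret T: bounded_linear T by fact
  obtain B where B: "B > 0" "\<And>x. norm (T x) \<le> norm x * B" using T.pos_bounded by blast
  have "e / B > 0" using e B by simp
  from strict_derivD[OF f this] obtain \<delta> where \<delta>: "\<delta> > 0"
    "\<And>q q'. q \<in> ball q0 \<delta> \<Longrightarrow> q' \<in> ball q0 \<delta> \<Longrightarrow> norm (f q - f q' - D (q - q')) \<le> e / B * norm (q - q')" by blast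
  have "norm (T (f q) - T (f q') - T (D (q - q'))) \<le> e * norm (q - q')" if "q \<in> ball q0 \<delta>" "q' \<in> ball q0 \<delta>" for q q'
  proof -
    have "norm (T (f q) - T (f q') - T (D (q - q'))) \<le> norm (f q - f q' - D (q - q')) * B"
      using B(2)[of "f q - f q' - D (q - q')"] by (simp add: T.diff)
    also have "\<dots> \<le> e / B * norm (q - q') * B" using \<delta>(2)[OF that] B by (intro mult_right_mono) auto
    finally show ?thesis using B(1) by simp
  qed
  with \<delta>(1) show "\<exists>\<delta>>0. \<forall>q\<in>ball q0 \<delta>. \<forall>q'\<in>ball q0 \<delta>.
      norm (T (f q) - T (f q') - T (D (q - q'))) \<le> e * norm (q - q')" by blast
qed

lemma strict_deriv_add:
  assumes f: "strict_deriv f D q0" and g: "strict_deriv g E q0"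
  shows "strict_deriv (\<lambda>q. f q + g q) (\<lambda>h. D h + E h) q0"
  unfolding strict_deriv_def
proof (intro conjI allI impI)
  show "bounded_linear (\<lambda>h. D h + E h)" using f g bounded_linear_add unfolding strict_deriv_def by blast
  fix e :: real assume "e > 0"
  then have e: "e / 2 > 0" by simp
  obtain d1 where d1: "d1 > 0"
    "\<And>q q'. q \<in> ball q0 d1 \<Longrightarrow> q' \<in> ball q0 d1 \<Longrightarrow> norm (f q - f q' - D (q - q')) \<le> e / 2 * norm (q - q')"
    using strict_derivD[OF f e] by blast
  obtain d2 where d2: "d2 > 0"
    "\<And>q q'. q \<in> ball q0 d2 \<Longrightarrow> q' \<in> ball q0 d2 \<Longrightarrow> norm (g q - g q' - E (q - q')) \<le> e / 2 * norm (q - q')"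
    using strict_derivD[OF g e] by blast
  have "norm (f q + g q - (f q' + g q') - (D (q - q') + E (q - q'))) \<le> e * norm (q - q')"
    if "q \<in> ball q0 (min d1 d2)" "q' \<in> ball q0 (min d1 d2)" for q q'
  proof -
    have eq: "f q + g q - (f q' + g q') - (D (q - q') + E (q - q'))
        = (f q - f q' - D (q - q')) + (g q - g q' - E (q - q'))" by simp
    show ?thesis unfolding eq
      by (rule order_trans[OF norm_triangle_ineq]) (use d1(2)[of q q'] d2(2)[of q q'] that in auto)
  qed
  then show "\<exists>\<delta>>0. \<forall>q\<in>ball q0 \<delta>. \<forall>q'\<in>ball q0 \<delta>.
      norm (f q + g q - (f q' + g q') - (D (q - q') + E (q - q'))) \<le> e * norm (q - q')"
    using d1(1) d2(1) by (intro exI[of _ "min d1 d2"]) auto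
qed

lemma strict_deriv_lipschitz:
  assumes f: "strict_deriv f D q0"
  shows "\<exists>C. \<exists>\<delta>>0. \<forall>q\<in>ball q0 \<delta>. \<forall>q'\<in>ball q0 \<delta>. norm (f q - f q') \<le> C * norm (q - q')"
proof -
  interpret D: bounded_linear D using f by (simp add: strict_deriv_def)
  obtain B where B: "\<And>x. norm (D x) \<le> norm x * B" using D.pos_bounded by blast
  obtain \<delta> where \<delta>: "\<delta> > 0"
    "\<And>q q'. q \<in> ball q0 \<delta> \<Longrightarrow> q' \<in> ball q0 \<delta> \<Longrightarrow> norm (f q - f q' - D (q - q')) \<le> 1 * norm (q - q')"
    using strict_derivD[OF f zero_less_one] by blast
  have "norm (f q - f q') \<le> (1 + B) * norm (q - q')" if "q \<in> ball q0 \<delta>" "q' \<in> ball q0 \<delta>" for q q'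
    using norm_triangle_ineq[of "f q - f q' - D (q - q')" "D (q - q')"] \<delta>(2)[OF that] B[of "q - q'"]
    by (simp add: algebra_simps)
  with \<delta>(1) show ?thesis by blast
qed

lemma strict_partial_of_strict_deriv:
  assumes f: "strict_deriv f D q0"
  shows "strict_partial f (\<lambda>h. D (h, 0)) q0"
proof -
  interpret D: bounded_linear D using f by (simp add: strict_deriv_def)
  obtain B where B: "B > 0" "\<And>x. norm (D x) \<le> norm x * B" using D.pos_bounded by blast
  show ?thesis
    unfolding strict_partial_def
  proof (rule exI[of _ "B + 1"], intro conjI allI impI)
    show "0 \<le> B + 1" using B(1) by simp
    fix e :: real assume e: "e > 0"
    \<comment> \<open>The cap at 1 keeps the coefficient of the parameter increment at most
      \<open>B + 1\<close>, however large \<open>e\<close> is.\<close>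
    then have "min e 1 > 0" by simp
    from strict_derivD[OF f this] obtain \<delta> where \<delta>: "\<delta> > 0"
      "\<And>q q'. q \<in> ball q0 \<delta> \<Longrightarrow> q' \<in> ball q0 \<delta> \<Longrightarrow> norm (f q - f q' - D (q - q')) \<le> min e 1 * norm (q - q')" by blast
    have "norm (f q - f q' - D (fst q - fst q', 0)) \<le> e * norm (fst q - fst q') + (B + 1) * norm (snd q - snd q')"
      if "q \<in> ball q0 \<delta>" "q' \<in> ball q0 \<delta>" for q q'
    proof -
      let ?h = "fst q - fst q'" and ?k = "snd q - snd q'"
      have qq: "q - q' = (?h, 0) + (0, ?k)" by (simp add: prod_eq_iff)
      have "f q - f q' - D (?h, 0) = (f q - f q' - D (q - q')) + D (0, ?k)" unfolding qq D.add by simp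
      then have "norm (f q - f q' - D (?h, 0)) \<le> norm (f q - f q' - D (q - q')) + norm (D (0, ?k))"
        by (metis norm_triangle_ineq)
      also have "norm (f q - f q' - D (q - q')) \<le> min e 1 * norm (q - q')" by (rule \<delta>(2)[OF that])
      also have "min e 1 * norm (q - q') \<le> min e 1 * (norm ?h + norm ?k)"
        using norm_triangle_ineq[of "(?h, 0)" "(0, ?k)"] e unfolding qq by (intro mult_left_mono) auto
      also have "\<dots> \<le> e * norm ?h + 1 * norm ?k"
        unfolding distrib_left by (intro add_mono mult_right_mono) auto
      also have "norm (D (0, ?k)) \<le> B * norm ?k" using B(2)[of "(0, ?k)"] by (simp add: mult.commute)
      finally show ?thesis by (simp add: algebra_simps)
    qed
    with \<delta>(1) show "\<exists>\<delta>>0. \<forall>q\<in>ball q0 \<delta>. \<forall>q'\<in>ball q0 \<delta>.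
        norm (f q - f q' - D (fst q - fst q', 0)) \<le> e * norm (fst q - fst q') + (B + 1) * norm (snd q - snd q')" by blast
  qed
qed

lemma has_derivative_slice:
  assumes "(f has_derivative D) (at (x, w))"
  shows "((\<lambda>x. f (x, w)) has_derivative (\<lambda>h. D (h, 0))) (at x)"
proof -
  have "((\<lambda>x. (x, w)) has_derivative (\<lambda>h. (h, 0))) (at x)" by (auto intro!: derivative_eq_intros)
  from has_derivative_compose[OF this assms] show ?thesis .
qed

theorem theorem3p2:
  fixes \<theta> :: "real ^ 'm \<Rightarrow> ereal"
    and \<phi>0 :: "(real ^ 'n) \<times> (real ^ 'd) \<Rightarrow> real"
    and \<Phi> :: "(real ^ 'n) \<times> (real ^ 'd) \<Rightarrow> real ^ 'm"
    and l p :: nat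
    and a d :: "nat \<Rightarrow> real ^ 'm"
    and \<alpha> \<beta> :: "nat \<Rightarrow> real"
    and xb vb :: "real ^ 'n" and wb :: "real ^ 'd" and zb lamb :: "real ^ 'm"
  assumes "cpwl_rep \<theta> l a \<alpha> p d \<beta>"
    and "C2_on \<phi>0 UNIV"
    and "C2_around \<Phi> (xb, wb)"
    and "zb = \<Phi> (xb, wb)" and "zb \<in> edom \<theta>"
    and "0 \<in> affine hull (subdifferential \<theta> zb)"
    and "vb \<in> (\<lambda>y. gradient (\<lambda>x. \<phi>0 (x, wb)) xb + adjoint (jac_x \<Phi> xb wb) y)
                ` subdifferential \<theta> zb"
    and "lamb \<in> subdifferential \<theta> zb"
    and "vb = gradient (\<lambda>x. \<phi>0 (x, wb)) xb + adjoint (jac_x \<Phi> xb wb) lamb"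
  shows "(composite_SSOSC \<phi>0 \<Phi> l a \<alpha> p d \<beta> xb wb lamb \<and> nondegenerate \<theta> \<Phi> xb wb \<longrightarrow>
            SVLL \<phi>0 \<theta> \<Phi> xb lamb wb vb \<and> (\<exists>\<gamma>>0. xb \<in> argmin_loc \<phi>0 \<theta> \<Phi> xb \<gamma> wb vb)) \<and>
         (first_order_qc \<theta> \<Phi> xb wb \<longrightarrow>
            SVLL \<phi>0 \<theta> \<Phi> xb lamb wb vb \<and> (\<exists>\<gamma>>0. xb \<in> argmin_loc \<phi>0 \<theta> \<Phi> xb \<gamma> wb vb) \<longrightarrow>
            composite_SSOSC \<phi>0 \<Phi> l a \<alpha> p d \<beta> xb wb lamb \<and> nondegenerate \<theta> \<Phi> xb wb)"
proof -
  let ?q0 = "(xb, wb)"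
  from assms(2)[unfolded C2_on_def] obtain \<phi>' \<phi>'' where
    "\<forall>q\<in>UNIV. (\<phi>0 has_derivative blinfun_apply (\<phi>' q)) (at q)"
    "\<forall>q\<in>UNIV. (\<phi>' has_derivative blinfun_apply (\<phi>'' q)) (at q)" and c\<phi>: "continuous_on UNIV \<phi>''"
    by blast
  then have \<phi>: "\<And>q. (\<phi>0 has_derivative blinfun_apply (\<phi>' q)) (at q)"
      "\<And>q. (\<phi>' has_derivative blinfun_apply (\<phi>'' q)) (at q)"
    by blast+
  obtain Om where Om: "open Om" "?q0 \<in> Om" and C2: "C2_on \<Phi> Om"
    using assms(3) unfolding C2_around_def by blast
  from C2[unfolded C2_on_def] obtain \<Phi>' \<Phi>'' where
    "\<forall>q\<in>Om. (\<Phi> has_derivative blinfun_apply (\<Phi>' q)) (at q)"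
    "\<forall>q\<in>Om. (\<Phi>' has_derivative blinfun_apply (\<Phi>'' q)) (at q)" and c\<Phi>: "continuous_on Om \<Phi>''"
    by blast
  then have \<Phi>: "\<And>q. q \<in> Om \<Longrightarrow> (\<Phi> has_derivative blinfun_apply (\<Phi>' q)) (at q)"
      "\<And>q. q \<in> Om \<Longrightarrow> (\<Phi>' has_derivative blinfun_apply (\<Phi>'' q)) (at q)"
    by blast+
  have cont: "continuous_on Om \<phi>0" "continuous_on Om \<Phi>" "continuous_on Om \<phi>'" "continuous_on Om \<Phi>'" "continuous_on Om \<phi>''"
    using has_derivative_at_withinI[OF \<phi>(1)] has_derivative_at_withinI[OF \<Phi>(1)]
      has_derivative_at_withinI[OF \<phi>(2)] has_derivative_at_withinI[OF \<Phi>(2)] continuous_on_subset[OF c\<phi>]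
    by (auto intro!: has_derivative_continuous_on)
  have sd: "strict_deriv \<Phi> (\<Phi>' ?q0) ?q0" "strict_deriv \<Phi>' (\<Phi>'' ?q0) ?q0" "strict_deriv \<phi>' (\<phi>'' ?q0) ?q0"
    by (rule strict_deriv_of_C1[OF Om \<Phi>(1) cont(4)] strict_deriv_of_C1[OF Om \<Phi>(2) c\<Phi>]
        strict_deriv_of_C1[OF Om \<phi>(2) cont(5)]; assumption)+
  \<comment> \<open>The embedding of the decision variable; composing with it makes the partial
    Jacobian a bounded linear map that depends linearly on the full derivative.\<close>
  define E :: "(real ^ 'n) \<Rightarrow>\<^sub>L ((real ^ 'n) \<times> (real ^ 'd))" where "E = Blinfun (\<lambda>h. (h, 0))"
  have E: "blinfun_apply E h = (h, 0)" for h
    unfolding E_def by (subst bounded_linear_Blinfun_apply) (auto intro!: bounded_linear_Pair bounded_linear_ident bounded_linear_zero)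
  define J where "J q = \<Phi>' q o\<^sub>L E" for q
  have J: "blinfun_apply (J q) = (\<lambda>h. \<Phi>' q (h, 0))" for q by (simp add: J_def E fun_eq_iff)
  \<comment> \<open>\<open>\<Lambda>1\<close> is the Riesz vector of the x-part of a functional, and
    \<open>\<Lambda>2\<close> applies the adjoint of the x-part of a Jacobian to
    \<open>lamb\<close>. Written as sums over the basis, both are visibly bounded linear in the
    derivative, so gradients inherit its strict differentiability.\<close>
  define \<Lambda>1 :: "(((real ^ 'n) \<times> (real ^ 'd)) \<Rightarrow>\<^sub>L real) \<Rightarrow> real ^ 'n" where
    "\<Lambda>1 f = (\<Sum>b\<in>Basis. f (b, 0) *\<^sub>R b)" for f
  define \<Lambda>2 :: "(((real ^ 'n) \<times> (real ^ 'd)) \<Rightarrow>\<^sub>L (real ^ 'm)) \<Rightarrow> real ^ 'n" where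
    "\<Lambda>2 f = (\<Sum>b\<in>Basis. (lamb \<bullet> f (b, 0)) *\<^sub>R b)" for f
  have bl1: "bounded_linear \<Lambda>1" unfolding \<Lambda>1_def by (intro bounded_linear_intros)
  have bl2: "bounded_linear \<Lambda>2" unfolding \<Lambda>2_def by (intro bounded_linear_intros)
  have riesz: "(\<Sum>b\<in>Basis. f b *\<^sub>R b) \<bullet> h = f h" if "linear f" for f :: "real ^ 'n \<Rightarrow> real" and h
  proof -
    have "f h = f (\<Sum>b\<in>Basis. (h \<bullet> b) *\<^sub>R b)" by (simp add: euclidean_representation)
    also have "\<dots> = (\<Sum>b\<in>Basis. (h \<bullet> b) * f b)" using that by (simp add: linear_sum linear_scale o_def)
    finally show ?thesis unfolding inner_sum_left by (simp add: inner_commute mult.commute)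
  qed
  have lin: "linear (\<lambda>h. blinfun_apply f (h, 0))" for f :: "((real ^ 'n) \<times> (real ^ 'd)) \<Rightarrow>\<^sub>L 'y::real_normed_vector"
  proof -
    have "linear (blinfun_apply (f o\<^sub>L E))" by (simp add: blinfun.bounded_linear_right bounded_linear.linear)
    moreover have "blinfun_apply (f o\<^sub>L E) = (\<lambda>h. f (h, 0))" by (simp add: E fun_eq_iff)
    ultimately show ?thesis by simp
  qed
  have \<Lambda>1: "\<Lambda>1 f \<bullet> h = f (h, 0)" for f h unfolding \<Lambda>1_def by (rule riesz[OF lin])
  have \<Lambda>2: "\<Lambda>2 f = adjoint (\<lambda>h. f (h, 0)) lamb" for f
  proof -
    have "\<Lambda>2 f \<bullet> h = lamb \<bullet> f (h, 0)" for h
      unfolding \<Lambda>2_def using lin[of f]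
      by (intro riesz) (auto simp: linear_iff inner_add_right)
    then have "\<Lambda>2 f \<bullet> h = adjoint (\<lambda>h. f (h, 0)) lamb \<bullet> h" for h by (simp add: adjoint_clauses(2)[OF lin])
    then show ?thesis by (metis vector_eq_rdot)
  qed
  define g where "g q = \<Lambda>1 (\<phi>' q)" for q
  \<comment> \<open>The x-part of the strict derivative of
    \<open>q \<mapsto> \<Lambda>1 (\<phi>' q) + \<Lambda>2 (\<Phi>' q)\<close>, the gradient of the
    Lagrangian at the multiplier \<open>lamb\<close>.\<close>
  define H where "H h = \<Lambda>1 (\<phi>'' ?q0 (h, 0)) + \<Lambda>2 (\<Phi>'' ?q0 (h, 0))" for h
  have d\<phi>: "((\<lambda>x. \<phi>0 (x, w)) has_derivative (\<lambda>h. g (x, w) \<bullet> h)) (at x)" for x w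
    unfolding g_def \<Lambda>1 by (rule has_derivative_slice[OF \<phi>(1)])
  have d\<Phi>: "((\<lambda>x. \<Phi> (x, w)) has_derivative blinfun_apply (J (x, w))) (at x)" if "(x, w) \<in> Om" for x w
    unfolding J by (rule has_derivative_slice[OF \<Phi>(1)[OF that]])
  have gb: "gradient (\<lambda>x. \<phi>0 (x, wb)) xb = g ?q0"
    unfolding gradient_def
  proof (rule the_equality)
    show "GDERIV (\<lambda>x. \<phi>0 (x, wb)) xb :> g ?q0" using d\<phi> by (simp add: gderiv_def inner_commute)
    fix v assume "GDERIV (\<lambda>x. \<phi>0 (x, wb)) xb :> v"
    then have "(\<lambda>h. h \<bullet> v) = (\<lambda>h. g ?q0 \<bullet> h)" unfolding gderiv_def using d\<phi> has_derivative_unique by blast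
    then show "v = g ?q0" by (metis inner_commute vector_eq_ldot)
  qed
  have jb: "jac_x \<Phi> xb wb = blinfun_apply (J ?q0)"
    unfolding jac_x_def using frechet_derivative_at[OF d\<Phi>[OF Om(2)]] by simp
  interpret composite \<theta> l a \<alpha> p d \<beta> zb lamb \<phi>0 \<Phi> xb wb Om g J H vb
  proof (intro composite.intro cpwl_point.intro cpwl.intro cpwl_point_axioms.intro composite_axioms.intro)
    show "cpwl_rep \<theta> l a \<alpha> p d \<beta>" "zb \<in> edom \<theta>" "lamb \<in> subdifferential \<theta> zb"
      "0 \<in> affine hull subdifferential \<theta> zb" "zb = \<Phi> ?q0" by fact+
    show "open Om" "?q0 \<in> Om" "continuous_on Om \<phi>0" "continuous_on Om \<Phi>" by fact+
    show "continuous_on Om g" unfolding g_def by (rule bounded_linear.continuous_on[OF bl1 cont(3)])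
    show "((\<lambda>x. \<phi>0 (x, w)) has_derivative (\<lambda>h. g (x, w) \<bullet> h)) (at x)" for x w by (rule d\<phi>)
    show "((\<lambda>x. \<Phi> (x, w)) has_derivative blinfun_apply (J (x, w))) (at x)" if "(x, w) \<in> Om" for x w
      by (rule d\<Phi>[OF that])
    show "strict_partial \<Phi> (blinfun_apply (J ?q0)) ?q0"
      unfolding J by (rule strict_partial_of_strict_deriv[OF sd(1)])
    have sN: "strict_deriv (\<lambda>q. \<Lambda>1 (\<phi>' q) + \<Lambda>2 (\<Phi>' q)) (\<lambda>h. \<Lambda>1 (\<phi>'' ?q0 h) + \<Lambda>2 (\<Phi>'' ?q0 h)) ?q0"
      by (rule strict_deriv_add[OF strict_deriv_linear[OF sd(3) bl1] strict_deriv_linear[OF sd(2) bl2]])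
    have "(\<lambda>q. g q + adjoint (blinfun_apply (J q)) lamb) = (\<lambda>q. \<Lambda>1 (\<phi>' q) + \<Lambda>2 (\<Phi>' q))"
      by (simp add: g_def \<Lambda>2 J)
    then show "strict_partial (\<lambda>q. g q + adjoint (blinfun_apply (J q)) lamb) H ?q0"
      using strict_partial_of_strict_deriv[OF sN] by (simp add: H_def[abs_def])
    have "bounded_linear (\<lambda>h. \<Lambda>1 (\<phi>'' ?q0 h) + \<Lambda>2 (\<Phi>'' ?q0 h))" using sN by (simp only: strict_deriv_def)
    from bounded_linear_compose[OF this blinfun.bounded_linear_right[of E]]
    have "bounded_linear H" unfolding H_def[abs_def] E .
    then show "linear H" by (rule bounded_linear.linear)
    have "bounded_linear (\<lambda>f. f o\<^sub>L E)" for E :: "(real ^ 'n) \<Rightarrow>\<^sub>L ((real ^ 'n) \<times> (real ^ 'd))"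
      by (rule bounded_bilinear.bounded_linear_left[OF bounded_bilinear_blinfun_compose])
    from strict_deriv_lipschitz[OF strict_deriv_linear[OF sd(2) this]]
    show "\<exists>C. \<exists>\<delta>>0. \<forall>q\<in>ball ?q0 \<delta>. \<forall>q'\<in>ball ?q0 \<delta>. norm (J q - J q') \<le> C * norm (q - q')"
      unfolding J_def .
    show "vb = g ?q0 + adjoint (blinfun_apply (J ?q0)) lamb" using assms(9) by (simp add: gb jb)
  qed
  show ?thesis using svll_iff_ssosc_nd by blast
qed

end
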